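(* Let $q\in\mathbf{C}$, $|q|>1$, $K=\mathbf{C}(\{z\})$. Let $\mu_1<\cdots<\mu_k$ be integers, $r_1,\dots,r_k\in\mathbf{N}^*$, $A_i\in\mathrm{GL}_{r_i}(\mathbf{C})$, $P_i:=(K^{r_i},\Phi_{z^{\mu_i}A_i})$ and $n=r_1+\cdots+r_k$. For $U=(U_{i,j})_{1\le i<j\le k}$ with $U_{i,j}\in\mathrm{Mat}_{r_i,r_j}(K)$, let $A_U$ be the block upper triangular matrix with diagonal blocks $z^{\mu_i}A_i$ and $(i,j)$ block $U_{i,j}$ for $i<j$, and let $\overline{M_U}\in\mathcal{F}(P_1,\dots,P_k)$ be the class of the $q$-difference module $M_U=(K^n,\Phi_{A_U})$. Then the map $U\mapsto\overline{M_U}$ from $$\prod_{1\le i<j\le k}\mathrm{Mat}_{r_i,r_j}(K_{\mu_i,\mu_j})$$ to $\mathcal{F}(P_1,\dots,P_k)$ is a bijection.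
   Context: $\mathbf{C}(\{z\})$ is the fraction field of the ring of convergent power series, with automorphism $\sigma_qf(z)=f(qz)$. For integers $\mu<\nu$, $K_{\mu,\nu}$ denotes $\sum_{i=0}^{\nu-\mu-1}\mathbf{C}z^i$ or, at will, $\sum_{i=\mu}^{\nu-1}\mathbf{C}z^i$ (the statement holds for either choice). A $q$-difference module over $K$ is a pair $(E,\Phi)$, $E$ a finite dimensional $K$-vector space, $\Phi$ a $\sigma_q$-linear bijection of $E$; morphisms are $K$-linear maps commuting with the $\Phi$'s. For $A\in\mathrm{GL}_n(K)$, $(K^n,\Phi_A)$ is given by $\Phi_A(X)=A^{-1}\sigma_q(X)$. Morphisms from $(K^n,\Phi_A)$ to $(K^p,\Phi_B)$ are the matrices $F\in\mathrm{Mat}_{p,n}(K)$ with $(\sigma_qF)A=BF$. The module $P_i$ is pure isoclinic of slope $\mu_i$. $\mathcal{F}(P_1,\dots,P_k)$ is the set of equivalence classes of filtered $q$-difference modules $0=M_0\subset M_1\subset\cdots\subset M_k=M$ endowed with isomorphisms $u_i:M_i/M_{i-1}\simeq P_i$; two such objects are equivalent if there is a morphism $f:M\to M'$ with $f(M_i)\subset M'_i$ and whose induced maps $g_i:M_i/M_{i-1}\to M'_i/M'_{i-1}$ satisfy $u_i=u'_i\circ g_i$. (The filtration is here necessarily the canonical filtration of $M$ by slopes.) $M_U$ carries the filtration by the first blocks of coordinates and the tautological isomorphisms $u_i$. *)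

theory Defs
  imports "HOL-Complex_Analysis.Laurent_Convergence" "HOL-Algebra.AbelCoset"
    "Jordan_Normal_Form.VS_Connect"
begin

section \<open>The difference field of convergent Laurent series\<close>

typedef conv_laurent = "{F :: complex fls. fls_conv_radius F > 0}"
  morphisms to_fls of_fls
  by (rule exI[of _ 0]) simp

setup_lifting type_definition_conv_laurent

lemma fls_conv_radius_inverse_pos:
  fixes F :: "complex fls"
  assumes "fls_conv_radius F > 0"
  shows "fls_conv_radius (inverse F) > 0"
proof (cases "F = 0")
  case False
  define f where "f = fls_base_factor_to_fps F"
  define d where "d = fls_subdegree F"
  have f0: "fps_nth f 0 \<noteq> 0"
    using False by (simp add: f_def)
  have "F * fls_shift d (fps_to_fls (inverse f)) =
      fls_shift (- d) (fps_to_fls f) * fls_shift d (fps_to_fls (inverse f))"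
    unfolding f_def d_def by (subst (1) fls_conv_base_factor_to_fps_shift_subdegree) simp
  also have "\<dots> = fps_to_fls (f * inverse f)"
    by (simp only: fls_times_both_shifted_simp fls_times_fps_to_fls) simp
  also have "f * inverse f = 1"
    using inverse_mult_eq_1[OF f0] by (simp add: mult.commute)
  finally have "inverse F = fls_shift d (fps_to_fls (inverse f))"
    by (intro inverse_unique) simp
  moreover have "fps_conv_radius f > 0"
    using assms by (simp add: f_def fls_conv_radius_altdef)
  ultimately show ?thesis
    using f0 by (simp add: fps_conv_radius_inverse_pos)
qed auto

text \<open>The type is the fraction field of the ring of convergent power series, realised inside the
  formal Laurent series.\<close>

lemma fls_conv_radius_pos_iff_quotient:
  "fls_conv_radius F > 0 \<longleftrightarrow>
     (\<exists>f g. fps_conv_radius f > 0 \<and> fps_conv_radius g > 0 \<and> g \<noteq> 0 \<and>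
        F = fps_to_fls f / fps_to_fls g)"
proof
  assume pos: "fls_conv_radius F > 0"
  define f where "f = fls_base_factor_to_fps F * fps_X ^ nat (fls_subdegree F)"
  define g :: "complex fps" where "g = fps_X ^ nat (- fls_subdegree F)"
  have F: "F = fls_shift (- fls_subdegree F) (fps_to_fls (fls_base_factor_to_fps F))"
    by (rule fls_conv_base_factor_to_fps_shift_subdegree)
  have "F * fps_to_fls g = fps_to_fls f"
    by (subst F) (simp add: f_def g_def fls_times_fps_to_fls fps_to_fls_power
        fls_X_power_times_conv_shift fls_shifted_times_simps)
  moreover have "fps_conv_radius f > 0"
    unfolding f_def using pos
    by (intro less_le_trans[OF _ fps_conv_radius_mult]) (simp add: fls_conv_radius_altdef)
  moreover have "fps_conv_radius g > 0" "g \<noteq> 0"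
    by (simp_all add: g_def)
  ultimately show "\<exists>f g. fps_conv_radius f > 0 \<and> fps_conv_radius g > 0 \<and> g \<noteq> 0 \<and>
      F = fps_to_fls f / fps_to_fls g"
    by (intro exI[of _ f] exI[of _ g]) (auto simp: field_simps)
next
  assume "\<exists>f g. fps_conv_radius f > 0 \<and> fps_conv_radius g > 0 \<and> g \<noteq> 0 \<and>
      F = fps_to_fls f / fps_to_fls g"
  then show "fls_conv_radius F > 0"
    by (auto simp: divide_inverse intro!: less_le_trans[OF _ fls_conv_radius_mult]
        fls_conv_radius_inverse_pos)
qed

instantiation conv_laurent :: field
begin

lift_definition zero_conv_laurent :: conv_laurent is 0 by simp
lift_definition one_conv_laurent :: conv_laurent is 1 by simp
lift_definition plus_conv_laurent :: "conv_laurent \<Rightarrow> conv_laurent \<Rightarrow> conv_laurent" is "(+)"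
  by (rule less_le_trans[OF _ fls_conv_radius_add]) auto
lift_definition minus_conv_laurent :: "conv_laurent \<Rightarrow> conv_laurent \<Rightarrow> conv_laurent" is "(-)"
  by (rule less_le_trans[OF _ fls_conv_radius_diff]) auto
lift_definition uminus_conv_laurent :: "conv_laurent \<Rightarrow> conv_laurent" is uminus by simp
lift_definition times_conv_laurent :: "conv_laurent \<Rightarrow> conv_laurent \<Rightarrow> conv_laurent" is "(*)"
  by (rule less_le_trans[OF _ fls_conv_radius_mult]) auto
lift_definition inverse_conv_laurent :: "conv_laurent \<Rightarrow> conv_laurent" is inverse
  by (rule fls_conv_radius_inverse_pos)
definition divide_conv_laurent :: "conv_laurent \<Rightarrow> conv_laurent \<Rightarrow> conv_laurent" where
  "divide_conv_laurent f g = f * inverse g"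

instance
proof
  fix a b :: conv_laurent
  show "a div b = a * inverse b"
    by (simp add: divide_conv_laurent_def)
qed (transfer; simp add: algebra_simps)+

end

text \<open>The scaling automorphism \<open>f(z) \<mapsto> f(q z)\<close>; \<open>sigma_nth\<close> below gives its coefficients.\<close>

lemma fls_nth_compose_scale:
  fixes q :: complex
  assumes "q \<noteq> 0"
  shows "fls_nth (fls_compose_fps F (fps_const q * fps_X)) n = q powi n * fls_nth F n"
proof -
  define d where "d = fls_subdegree F"
  have X: "fps_to_fls (fps_const q * fps_X) powi m = fls_shift (- m) (fls_const (q powi m))" for m
  proof -
    have "fls_const q * fls_X powi m = fls_const q * fls_shift (- m) 1" for m
    proof (cases "m \<ge> 0")
      case True
      then show ?thesis
        by (simp add: power_int_def fls_X_power_conv_shift_1)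
    next
      case False
      then show ?thesis
        by (simp add: power_int_def fls_inverse_X fls_X_inv_power_conv_shift_1)
    qed
    then have "fls_X powi m = (fls_shift (- m) 1 :: complex fls)"
      using assms by simp
    moreover have "fls_const q powi m = fls_const (q powi m)"
      by (simp add: power_int_def fls_const_power fls_inverse_const)
    ultimately show ?thesis
      by (simp add: fls_times_fps_to_fls power_int_mult_distrib fls_shifted_times_simps)
  qed
  show ?thesis
  proof (cases "F = 0")
    case False
    have "fls_nth (fls_compose_fps F (fps_const q * fps_X)) n =
        (if n \<ge> d then q ^ nat (n - d) * q powi d * fls_nth F n else 0)"
      by (simp add: fls_compose_fps_def X d_def[symmetric] fls_shifted_times_simps
          fls_base_factor_to_fps_nth)
    also have "\<dots> = q powi n * fls_nth F n"
    proof (cases "n \<ge> d")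
      case True
      then have "q ^ nat (n - d) * q powi d = q powi (n - d) * q powi d"
        by (simp add: power_int_def)
      also have "\<dots> = q powi n"
        using assms by (simp add: power_int_add[symmetric])
      finally show ?thesis
        using True by simp
    qed (simp add: d_def)
    finally show ?thesis .
  qed simp
qed

lemma fls_conv_radius_compose_scale:
  fixes q :: complex
  assumes "fls_conv_radius F > 0"
  shows "fls_conv_radius (fls_compose_fps F (fps_const q * fps_X)) > 0"
proof (cases "q = 0")
  case False
  have "fls_regpart (fls_compose_fps F (fps_const q * fps_X)) =
      Abs_fps (\<lambda>n. q ^ n * fps_nth (fls_regpart F) n)"
    using False by (intro fps_ext) (simp add: fls_nth_compose_scale)
  then have "fls_conv_radius (fls_compose_fps F (fps_const q * fps_X)) =
      fls_conv_radius F / ereal (norm q)"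
    using conv_radius_mult_power[OF False, of "fps_nth (fls_regpart F)"]
    by (simp add: fls_conv_radius_def fps_conv_radius_def)
  also have "\<dots> > 0"
    using assms False by (cases "fls_conv_radius F") auto
  finally show ?thesis .
qed (simp add: fls_compose_fps_0_right)

lift_definition sigma_q :: "complex \<Rightarrow> conv_laurent \<Rightarrow> conv_laurent" is
  "\<lambda>q F. fls_compose_fps F (fps_const q * fps_X)"
  by (rule fls_conv_radius_compose_scale)

lemma sigma_nth:
  "q \<noteq> 0 \<Longrightarrow> fls_nth (to_fls (sigma_q q f)) n = q powi n * fls_nth (to_fls f) n"
  by transfer (rule fls_nth_compose_scale)

lift_definition cl_const :: "complex \<Rightarrow> conv_laurent" is fls_const by simp
lift_definition zvar :: conv_laurent is fls_X by simp

text \<open>The two admissible choices for the space \<open>K\<^bsub>\<mu>,\<nu>\<^esub>\<close> of Laurent polynomials with \<open>\<nu> - \<mu>\<close>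
  coefficients.\<close>

definition K_low :: "int \<Rightarrow> int \<Rightarrow> conv_laurent set" where
  "K_low \<mu> \<nu> = {\<Sum>i\<in>{0..\<nu> - \<mu> - 1}. cl_const (c i) * zvar powi i | c. True}"

definition K_window :: "int \<Rightarrow> int \<Rightarrow> conv_laurent set" where
  "K_window \<mu> \<nu> = {\<Sum>i\<in>{\<mu>..\<nu> - 1}. cl_const (c i) * zvar powi i | c. True}"


section \<open>\<open>q\<close>-difference modules\<close>

record 'e qdiff = "(conv_laurent, 'e) module" +
  Phi :: "'e \<Rightarrow> 'e"

definition qdiff_module :: "complex \<Rightarrow> 'e qdiff \<Rightarrow> bool" where
  "qdiff_module q E \<longleftrightarrow>
     vectorspace class_ring E \<and> vectorspace.fin_dim class_ring E \<and>
     bij_betw (Phi E) (carrier E) (carrier E) \<and>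
     (\<forall>x\<in>carrier E. \<forall>y\<in>carrier E. Phi E (x \<oplus>\<^bsub>E\<^esub> y) = Phi E x \<oplus>\<^bsub>E\<^esub> Phi E y) \<and>
     (\<forall>a. \<forall>x\<in>carrier E. Phi E (a \<odot>\<^bsub>E\<^esub> x) = sigma_q q a \<odot>\<^bsub>E\<^esub> Phi E x)"

definition qdiff_hom :: "'e qdiff \<Rightarrow> 'f qdiff \<Rightarrow> ('e \<Rightarrow> 'f) set" where
  "qdiff_hom E E' =
     {f \<in> LinearCombinations.module_hom class_ring E E'.
        \<forall>x\<in>carrier E. f (Phi E x) = Phi E' (f x)}"

definition qdiff_iso :: "'e qdiff \<Rightarrow> 'f qdiff \<Rightarrow> ('e \<Rightarrow> 'f) set" where
  "qdiff_iso E E' = {f \<in> qdiff_hom E E'. bij_betw f (carrier E) (carrier E')}"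

text \<open>The quotient by a sub-object with carrier \<open>N\<close>, on the set of cosets. The ring multiplication
  and unit inherited from \<^typ>\<open>('a, 'b) module\<close> play no role for modules. Adding \<open>N\<close> in the
  scalar multiplication makes it yield a full coset for the scalar \<open>0\<close> as well.\<close>

definition qdiff_quot :: "'e qdiff \<Rightarrow> 'e set \<Rightarrow> 'e set qdiff" where
  "qdiff_quot E N =
     \<lparr>carrier = a_rcosets\<^bsub>E\<^esub> N, mult = undefined, one = undefined, zero = N, add = set_add E,
      smult = (\<lambda>a C. N <+>\<^bsub>E\<^esub> ((\<lambda>x. a \<odot>\<^bsub>E\<^esub> x) ` C)), Phi = (\<lambda>C. Phi E ` C)\<rparr>"

text \<open>The map \<open>E/N \<rightarrow> E'/N'\<close>, \<open>x + N \<mapsto> f x + N'\<close>, induced by \<open>f\<close> with \<open>f ` N \<subseteq> N'\<close>: for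
  such \<open>f\<close> all members of the union coincide.\<close>

definition induced_map :: "'f qdiff \<Rightarrow> 'f set \<Rightarrow> ('e \<Rightarrow> 'f) \<Rightarrow> 'e set \<Rightarrow> 'f set" where
  "induced_map E' N' f C = (\<Union>x\<in>C. N' +>\<^bsub>E'\<^esub> f x)"

abbreviation GL :: "nat \<Rightarrow> 'a :: field mat set" where
  "GL n \<equiv> Units (ring_mat TYPE('a) n ())"

definition std_qdiff :: "complex \<Rightarrow> nat \<Rightarrow> conv_laurent mat \<Rightarrow> conv_laurent vec qdiff" where
  "std_qdiff q n A =
     \<lparr>carrier = carrier_vec n, mult = undefined, one = undefined, zero = 0\<^sub>v n, add = (+),
      smult = (\<cdot>\<^sub>v),
      Phi = (\<lambda>X. (inv\<^bsub>ring_mat TYPE(conv_laurent) n ()\<^esub> A) *\<^sub>v map_vec (sigma_q q) X)\<rparr>"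


section \<open>Filtered modules with prescribed graded pieces\<close>

text \<open>Only the values of \<open>filt_sub\<close> at \<open>0, \<dots>, k\<close> and of \<open>filt_iso\<close> at \<open>1, \<dots>, k\<close> matter.\<close>

record ('e, 'p) filt_qdiff =
  filt_mod :: "'e qdiff"
  filt_sub :: "nat \<Rightarrow> 'e set"
  filt_iso :: "nat \<Rightarrow> 'e set \<Rightarrow> 'p"

definition filt_step :: "('e, 'p) filt_qdiff \<Rightarrow> nat \<Rightarrow> 'e qdiff" where
  "filt_step X i = (filt_mod X)\<lparr>carrier := filt_sub X i\<rparr>"

definition filt_gr :: "('e, 'p) filt_qdiff \<Rightarrow> nat \<Rightarrow> 'e set qdiff" where
  "filt_gr X i = qdiff_quot (filt_step X i) (filt_sub X (i - 1))"

definition filtered :: "complex \<Rightarrow> nat \<Rightarrow> (nat \<Rightarrow> 'p qdiff) \<Rightarrow> ('e, 'p) filt_qdiff \<Rightarrow> bool" where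
  "filtered q k P X \<longleftrightarrow>
     qdiff_module q (filt_mod X) \<and>
     filt_sub X 0 = {\<zero>\<^bsub>filt_mod X\<^esub>} \<and> filt_sub X k = carrier (filt_mod X) \<and>
     (\<forall>i\<in>{1..k}. filt_sub X (i - 1) \<subseteq> filt_sub X i) \<and>
     (\<forall>i\<le>k. qdiff_module q (filt_step X i)) \<and>
     (\<forall>i\<in>{1..k}. filt_iso X i \<in> qdiff_iso (filt_gr X i) (P i))"

text \<open>The two underlying types may differ, so that modules on different types can be compared.\<close>

definition filt_equiv :: "nat \<Rightarrow> ('e, 'p) filt_qdiff \<Rightarrow> ('f, 'p) filt_qdiff \<Rightarrow> bool" where
  "filt_equiv k X Y \<longleftrightarrow>
     (\<exists>f\<in>qdiff_hom (filt_mod X) (filt_mod Y).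
        (\<forall>i\<le>k. f ` filt_sub X i \<subseteq> filt_sub Y i) \<and>
        (\<forall>i\<in>{1..k}. \<forall>C\<in>carrier (filt_gr X i).
           filt_iso X i C = filt_iso Y i (induced_map (filt_step Y i) (filt_sub Y (i - 1)) f C)))"

definition filt_rel ::
    "complex \<Rightarrow> nat \<Rightarrow> (nat \<Rightarrow> 'p qdiff) \<Rightarrow> ('e, 'p) filt_qdiff rel" where
  "filt_rel q k P = {(X, Y). filtered q k P X \<and> filtered q k P Y \<and> filt_equiv k X Y}"

text \<open>Since the class of all modules is not a set, modules are taken on subsets of one type. Every
  finite dimensional vector space has a copy among the spaces of column vectors.\<close>

definition filt_classes ::
    "complex \<Rightarrow> nat \<Rightarrow> (nat \<Rightarrow> conv_laurent vec qdiff) \<Rightarrow>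
       (conv_laurent vec, conv_laurent vec) filt_qdiff set set" where
  "filt_classes q k P = {X. filtered q k P X} // filt_rel q k P"


section \<open>Block triangular matrices\<close>

text \<open>Blocks are numbered from \<open>1\<close>; rows and columns from \<open>0\<close>. Block \<open>i\<close> occupies the indices from
  \<open>block_start r i\<close> to \<open>block_end r i - 1\<close>.\<close>

definition block_start :: "(nat \<Rightarrow> nat) \<Rightarrow> nat \<Rightarrow> nat" where
  "block_start r i = (\<Sum>l\<in>{1..<i}. r l)"

definition block_end :: "(nat \<Rightarrow> nat) \<Rightarrow> nat \<Rightarrow> nat" where
  "block_end r i = (\<Sum>l\<in>{1..i}. r l)"

definition block_index :: "(nat \<Rightarrow> nat) \<Rightarrow> nat \<Rightarrow> nat" where
  "block_index r a = (LEAST i. a < block_end r i)"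

definition block_mat :: "(nat \<Rightarrow> nat) \<Rightarrow> nat \<Rightarrow> (nat \<Rightarrow> nat \<Rightarrow> 'a mat) \<Rightarrow> 'a mat" where
  "block_mat r k B = mat (block_end r k) (block_end r k)
     (\<lambda>(a, b). let i = block_index r a; j = block_index r b
        in B i j $$ (a - block_start r i, b - block_start r j))"

lemma block_end_eq: "i \<ge> 1 \<Longrightarrow> block_end r i = block_start r i + r i"
  by (cases i) (simp_all add: block_end_def block_start_def atLeastLessThanSuc_atLeastAtMost)

lemma block_index_eq:
  assumes "i \<ge> 1" "a < r i"
  shows "block_index r (block_start r i + a) = i"
  unfolding block_index_def
proof (rule Least_equality)
  show "block_start r i + a < block_end r i"
    using assms by (simp add: block_end_eq)
next
  fix j assume j: "block_start r i + a < block_end r j"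
  show "i \<le> j"
  proof (rule ccontr)
    assume "\<not> i \<le> j"
    then have "block_end r j \<le> block_start r i"
      unfolding block_end_def block_start_def by (intro sum_mono2) auto
    with j show False by simp
  qed
qed

lemma block_mat_index:
  assumes "i \<in> {1..k}" "j \<in> {1..k}" "a < r i" "b < r j"
  shows "block_mat r k B $$ (block_start r i + a, block_start r j + b) = B i j $$ (a, b)"
proof -
  have le: "block_end r l \<le> block_end r k" if "l \<in> {1..k}" for l
    using that unfolding block_end_def by (intro sum_mono2) auto
  have "block_start r i + a < block_end r k" "block_start r j + b < block_end r k"
    using le[of i] le[of j] assms by (auto simp: block_end_eq)
  then show ?thesis
    using assms by (simp add: block_mat_def block_index_eq)
qed

definition diag_block :: "(nat \<Rightarrow> int) \<Rightarrow> (nat \<Rightarrow> complex mat) \<Rightarrow> nat \<Rightarrow> conv_laurent mat" where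
  "diag_block \<mu> A i = (zvar powi \<mu> i) \<cdot>\<^sub>m map_mat cl_const (A i)"

definition pure_piece ::
    "complex \<Rightarrow> (nat \<Rightarrow> nat) \<Rightarrow> (nat \<Rightarrow> int) \<Rightarrow> (nat \<Rightarrow> complex mat) \<Rightarrow> nat \<Rightarrow>
       conv_laurent vec qdiff" where
  "pure_piece q r \<mu> A i = std_qdiff q (r i) (diag_block \<mu> A i)"

definition A_mat ::
    "nat \<Rightarrow> (nat \<Rightarrow> nat) \<Rightarrow> (nat \<Rightarrow> int) \<Rightarrow> (nat \<Rightarrow> complex mat) \<Rightarrow>
       (nat \<times> nat \<Rightarrow> conv_laurent mat) \<Rightarrow> conv_laurent mat" where
  "A_mat k r \<mu> A U = block_mat r k
     (\<lambda>i j. if i = j then diag_block \<mu> A i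
            else if i < j then U (i, j)
            else 0\<^sub>m (r i) (r j))"

text \<open>The tautological isomorphism \<open>M\<^sub>i/M\<^sub>i\<^sub>-\<^sub>1 \<rightarrow> P\<^sub>i\<close> reads off the coordinates of block \<open>i\<close>, which
  agree for all members of a coset.\<close>

definition M_filt ::
    "complex \<Rightarrow> nat \<Rightarrow> (nat \<Rightarrow> nat) \<Rightarrow> (nat \<Rightarrow> int) \<Rightarrow> (nat \<Rightarrow> complex mat) \<Rightarrow>
       (nat \<times> nat \<Rightarrow> conv_laurent mat) \<Rightarrow> (conv_laurent vec, conv_laurent vec) filt_qdiff" where
  "M_filt q k r \<mu> A U =
     \<lparr>filt_mod = std_qdiff q (block_end r k) (A_mat k r \<mu> A U),
      filt_sub = (\<lambda>i. {x \<in> carrier_vec (block_end r k).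
               \<forall>a. block_end r i \<le> a \<and> a < block_end r k \<longrightarrow> x $ a = 0}),
      filt_iso = (\<lambda>i C. the_elem ((\<lambda>x. vec (r i) (\<lambda>a. x $ (block_start r i + a))) ` C))\<rparr>"

definition mat_over :: "'a set \<Rightarrow> nat \<Rightarrow> nat \<Rightarrow> 'a mat set" where
  "mat_over S m n = {X \<in> carrier_mat m n. \<forall>a<m. \<forall>b<n. X $$ (a, b) \<in> S}"

definition block_params ::
    "(int \<Rightarrow> int \<Rightarrow> conv_laurent set) \<Rightarrow> nat \<Rightarrow> (nat \<Rightarrow> nat) \<Rightarrow> (nat \<Rightarrow> int) \<Rightarrow>
       (nat \<times> nat \<Rightarrow> conv_laurent mat) set" where
  "block_params KK k r \<mu> =
     (\<Pi>\<^sub>E (i, j)\<in>{(i, j). 1 \<le> i \<and> i < j \<and> j \<le> k}. mat_over (KK (\<mu> i) (\<mu> j)) (r i) (r j))"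

end

theory Submission
  imports Defs
begin

text \<open>
  Lifting the standard bases of the graded pieces puts every filtered module in the form \<open>M\<^sub>V\<close>
  with \<open>V\<close> having arbitrary entries in \<open>K\<close>, and morphisms \<open>M\<^sub>V \<rightarrow> M\<^sub>U\<close> that induce the identity
  on the graded pieces are the block unipotent matrices \<open>F\<close> with \<open>\<sigma>\<^sub>q(F) A\<^sub>V = A\<^sub>U F\<close>. Proceeding away
  from the diagonal, the block \<open>(i, j)\<close> of this equation has the shape
  \<open>z\<^bsup>\<mu>\<^sub>i\<^esup> A\<^sub>i F\<^sub>i\<^sub>j - z\<^bsup>\<mu>\<^sub>j\<^esup> \<sigma>\<^sub>q(F\<^sub>i\<^sub>j) A\<^sub>j + U\<^sub>i\<^sub>j = G\<close> with \<open>G\<close> already known. With \<open>d = \<mu>\<^sub>j - \<mu>\<^sub>i\<close> its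
  coefficients form a recursion \<open>x\<^sub>s = q\<^bsup>-s\<^esup> L x\<^sub>s\<^sub>+\<^sub>d + h\<^sub>s\<close> with \<open>L\<close> invertible. Since \<open>|q| > 1\<close> the
  recursion is strongly contracting for large \<open>s\<close>: it has exactly one solution of geometric growth
  at \<open>+\<infinity>\<close>, and exactly one that vanishes near \<open>-\<infinity>\<close>. Convergence of \<open>F\<^sub>i\<^sub>j\<close> asks the two to agree,
  which is one condition per residue class modulo \<open>d\<close>; it is met by a unique choice of the
  \<open>d\<close> consecutive coefficients of \<open>U\<^sub>i\<^sub>j\<close>.
\<close>

section \<open>Coefficients of convergent Laurent series\<close>

text \<open>The diagonal blocks are constant matrices times a power of \<open>z\<close>, so on
  coefficients each block equation links just two coefficient matrices, \<open>d\<close> places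
  apart, through an operator that does not depend on the place; only the scalar power of
  \<open>q\<close> varies. Convergence is the whole obstruction: solving upwards from -infinity
  always succeeds formally, so over formal Laurent series every block could be gauged away, and the
  entries of \<open>U\<close> measure how far this formal solution is from geometric growth. A
  window of \<open>d\<close> consecutive indices contains one representative of each residue class
  modulo \<open>d\<close>, wherever it starts; keeping its start as a parameter \<open>w\<close>
  treats both choices of the spaces of Laurent polynomials together. On the module side there is no
  dimension count: filtered modules are compared through the images of elements in the graded
  pieces, and a morphism compatible with these is bijective step by step along the filtration. This
  applies to modules carried by an arbitrary type.\<close>

definition cl_nth :: "conv_laurent \<Rightarrow> int \<Rightarrow> complex" where
  "cl_nth f = fls_nth (to_fls f)"

lemma cl_eqI: "(\<And>m. cl_nth f m = cl_nth g m) \<Longrightarrow> f = g"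
  unfolding cl_nth_def by transfer (auto intro: fls_eqI)

lemma cl_nth_0 [simp]: "cl_nth 0 m = 0"
  and cl_nth_add [simp]: "cl_nth (f + g) m = cl_nth f m + cl_nth g m"
  and cl_nth_diff [simp]: "cl_nth (f - g) m = cl_nth f m - cl_nth g m"
  and cl_nth_const_mult [simp]: "cl_nth (cl_const c * f) m = c * cl_nth f m"
  and cl_nth_mult_const [simp]: "cl_nth (f * cl_const c) m = cl_nth f m * c"
  unfolding cl_nth_def by (transfer; simp)+

lemma cl_nth_sum [simp]: "cl_nth (sum f A) m = (\<Sum>a\<in>A. cl_nth (f a) m)"
  by (induction A rule: infinite_finite_induct) auto

lemma cl_nth_sigma: "q \<noteq> 0 \<Longrightarrow> cl_nth (sigma_q q f) m = q powi m * cl_nth f m"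
  unfolding cl_nth_def by (rule sigma_nth)

lemma cl_nth_zvar_mult: "cl_nth (zvar * f) m = cl_nth f (m - 1)"
  unfolding cl_nth_def by transfer (simp add: fls_X_times_conv_shift)

lemma zvar_nonzero [simp]: "zvar \<noteq> 0"
  by transfer simp

lemma cl_nth_zvar_powi_mult [simp]: "cl_nth (zvar powi i * f) m = cl_nth f (m - i)"
proof (induction i arbitrary: m rule: int_induct[where k = 0])
  case base
  show ?case by simp
next
  case (step1 i)
  have "cl_nth (zvar powi (i + 1) * f) m = cl_nth (zvar * (zvar powi i * f)) m"
    by (simp add: power_int_add mult_ac)
  then show ?case by (simp add: cl_nth_zvar_mult step1.IH diff_diff_eq add.commute)
next
  case (step2 i)
  have "cl_nth (zvar powi i * f) (m + 1) = cl_nth (zvar * (zvar powi (i - 1) * f)) (m + 1)"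
    using power_int_add[of zvar "i - 1" 1] by (simp add: mult_ac)
  then show ?case by (simp add: cl_nth_zvar_mult step2.IH diff_diff_eq2 add.commute)
qed

lemma cl_nth_mult_zvar_powi [simp]: "cl_nth (f * zvar powi i) m = cl_nth f (m - i)"
  using cl_nth_zvar_powi_mult[of i f m] by (simp add: mult.commute)

lemma cl_nth_1: "cl_nth 1 m = (if m = 0 then 1 else 0)"
  unfolding cl_nth_def by transfer simp

lemma cl_nth_const: "cl_nth (cl_const c) m = (if m = 0 then c else 0)"
  unfolding cl_nth_def by transfer simp

text \<open>Convergence in terms of coefficients: by \<open>geo_bounded_cl_nth\<close> and
  \<open>cl_nth_surj\<close> these are exactly the coefficient sequences of elements of
  \<open>conv_laurent\<close>. The bound is asked at all indices; vanishing near -infinity makes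
  this no stronger than a bound on a tail.\<close>

definition geo_bounded :: "(int \<Rightarrow> complex) \<Rightarrow> bool" where
  "geo_bounded x \<longleftrightarrow> (\<exists>N. \<forall>s<N. x s = 0) \<and>
     (\<exists>C\<ge>0. \<exists>R\<ge>1. \<forall>s. norm (x s) \<le> C * R powi s)"

lemma geo_boundedI:
  fixes x :: "int \<Rightarrow> complex"
  assumes low: "\<And>s. s < N \<Longrightarrow> x s = 0" and R: "R > 0"
    and high: "\<And>s. s \<ge> M \<Longrightarrow> norm (x s) \<le> C * R powi s"
  shows "geo_bounded x"
proof -
  define R' where "R' = max 1 R"
  define M' where "M' = max 0 M"
  \<comment> \<open>Between \<open>N\<close> and \<open>M'\<close> only finitely many indices
    remain. \<open>D\<close> dominates the quotients there, and the inserted absolute value of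
    \<open>C\<close> covers the tail and keeps \<open>D\<close> nonnegative.\<close>
  define D where "D = Max (insert \<bar>C\<bar> ((\<lambda>s. norm (x s) / R' powi s) ` {N..M'}))"
  have R': "R' \<ge> 1" by (simp add: R'_def)
  have D: "\<bar>C\<bar> \<le> D" and D': "\<And>s. s \<in> {N..M'} \<Longrightarrow> norm (x s) / R' powi s \<le> D"
    unfolding D_def by (rule Max_ge; simp)+
  have "norm (x s) \<le> D * R' powi s" for s
  proof -
    have pos: "R' powi s > 0" using R' by simp
    consider "s < N" | "s \<in> {N..M'}" | "s > M'" by force
    then show ?thesis
    proof cases
      case 1
      then show ?thesis using low D pos by simp
    next
      case 2
      then show ?thesis using D'[OF 2] pos by (simp add: field_simps)
    next
      case 3
      then have "s \<ge> 0" "s \<ge> M" by (auto simp: M'_def)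
      then have "R powi s \<le> R' powi s"
        using R by (auto simp: power_int_def R'_def intro!: power_mono)
      have "norm (x s) \<le> C * R powi s" using high \<open>s \<ge> M\<close> by blast
      also have "\<dots> \<le> \<bar>C\<bar> * R powi s" using R by (intro mult_right_mono) auto
      also have "\<dots> \<le> D * R' powi s"
        using D \<open>R powi s \<le> R' powi s\<close> R by (intro mult_mono) auto
      finally show ?thesis .
    qed
  qed
  moreover have "D \<ge> 0" using D by linarith
  ultimately show ?thesis
    unfolding geo_bounded_def using low R' by blast
qed

text \<open>Inside the disc of convergence the series converges absolutely, so its terms are
  bounded; a radius \<open>r\<close> turns into the growth rate \<open>1 / r\<close>.\<close>

lemma geo_bounded_cl_nth: "geo_bounded (cl_nth f)"
proof -
  have pos: "fls_conv_radius (to_fls f) > 0" by (rule to_fls[simplified])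
  then obtain r where r: "r > 0" "ereal r < conv_radius (fps_nth (fls_regpart (to_fls f)))"
    unfolding fls_conv_radius_def fps_conv_radius_def
    using ereal_dense2[of 0] by force
  have "summable (\<lambda>n. norm (fps_nth (fls_regpart (to_fls f)) n * of_real r ^ n))"
    using r by (intro abs_summable_in_conv_radius) auto
  then have "Bseq (\<lambda>n. norm (fps_nth (fls_regpart (to_fls f)) n * of_real r ^ n))"
    by (rule summable_imp_Bseq)
  then obtain C where C: "\<And>n. norm (cl_nth f (int n)) * r ^ n \<le> C"
    unfolding Bseq_def cl_nth_def using r by (auto simp: norm_mult norm_power)
  show ?thesis
  proof (rule geo_boundedI)
    show "cl_nth f s = 0" if "s < fls_subdegree (to_fls f)" for s
      using that unfolding cl_nth_def by simp
    show "1 / r > 0" using r by simp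
    show "norm (cl_nth f s) \<le> C * (1 / r) powi s" if "s \<ge> 0" for s
      using C[of "nat s"] that r by (simp add: power_int_def field_simps)
  qed
qed

text \<open>The point \<open>1 / (2 * R)\<close> lies in the disc of convergence, the factor 2
  giving a geometric majorant of ratio 1/2. This turns solutions of the recursion back into elements
  of the field.\<close>

lemma cl_nth_surj:
  assumes "geo_bounded x"
  shows "\<exists>f. cl_nth f = x"
proof -
  from assms obtain N C R where low: "\<forall>s<N. x s = 0" and C: "C \<ge> 0" and R: "R \<ge> 1"
    and bd: "\<forall>s. norm (x s) \<le> C * R powi s"
    unfolding geo_bounded_def by blast
  \<comment> \<open>\<open>Abs_fls\<close> returns the given coefficients only if they vanish at
    almost all negative indices.\<close>
  define F where "F = Abs_fls x"
  have "\<forall>\<^sub>\<infinity>n. x (- int n) = 0"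
    unfolding MOST_nat using low by (intro exI[of _ "nat (- N)"]) auto
  then have F: "fls_nth F = x" unfolding F_def by (intro ext nth_Abs_fls)
  have "summable (\<lambda>n. fps_nth (fls_regpart F) n * of_real (1 / (2 * R)) ^ n)"
  proof (rule summable_comparison_test')
    show "summable (\<lambda>n. C * (1 / 2) ^ n)" by (intro summable_mult summable_geometric) simp
    fix n :: nat
    have "norm (fps_nth (fls_regpart F) n * of_real (1 / (2 * R)) ^ n) =
        norm (x (int n)) * (1 / (2 * R)) ^ n"
      using R by (simp add: F norm_mult norm_power norm_divide)
    also have "\<dots> \<le> C * R ^ n * (1 / (2 * R)) ^ n"
      using bd[rule_format, of "int n"] R by (intro mult_right_mono) auto
    also have "\<dots> = C * (1 / 2) ^ n"
      using R by (simp add: field_simps)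
    finally show "norm (fps_nth (fls_regpart F) n * of_real (1 / (2 * R)) ^ n) \<le> C * (1 / 2) ^ n" .
  qed
  from conv_radius_geI[OF this] have "fls_conv_radius F \<ge> ereal (1 / (2 * R))"
    using R by (simp add: fls_conv_radius_def fps_conv_radius_def norm_divide norm_mult)
  moreover have "ereal (1 / (2 * R)) > 0" using R by simp
  ultimately have "fls_conv_radius F > 0" by (meson less_le_trans)
  then have "to_fls (of_fls F) = F" by (intro of_fls_inverse) simp
  then show ?thesis unfolding cl_nth_def using F by metis
qed

section \<open>The contracting recursion\<close>

text \<open>Vectors are functions restricted to a finite index set \<open>I\<close>, so that pairs
  of matrix indices can serve as coordinates later. \<open>L'\<close> is the inverse of
  \<open>L\<close>, and \<open>w\<close> is the first index of the window of length
  \<open>d\<close>.\<close>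

locale backward_recursion =
  fixes I :: "'i set" and L L' :: "'i \<Rightarrow> 'i \<Rightarrow> complex" and q :: complex and d w :: int
  assumes fin: "finite I" and q: "norm q > 1" and d: "d > 0"
    and right_inv: "\<And>a c. a \<in> I \<Longrightarrow> c \<in> I \<Longrightarrow> (\<Sum>b\<in>I. L a b * L' b c) = (if a = c then 1 else 0)"
    and left_inv: "\<And>a c. a \<in> I \<Longrightarrow> c \<in> I \<Longrightarrow> (\<Sum>b\<in>I. L' a b * L b c) = (if a = c then 1 else 0)"
begin

lemma q_nonzero: "q \<noteq> 0"
  using q by auto

section \<open>Norm estimates and contraction\<close>

definition app :: "('i \<Rightarrow> 'i \<Rightarrow> complex) \<Rightarrow> ('i \<Rightarrow> complex) \<Rightarrow> 'i \<Rightarrow> complex" where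
  "app M v a = (\<Sum>b\<in>I. M a b * v b)"

definition nrm :: "('i \<Rightarrow> complex) \<Rightarrow> real" where
  "nrm v = (\<Sum>a\<in>I. norm (v a))"

text \<open>A crude bound for the operator norm of \<open>L\<close> with respect to
  \<open>nrm\<close>; the summand 1 keeps it positive also for empty \<open>I\<close>.\<close>

definition opn :: real where
  "opn = 1 + (\<Sum>a\<in>I. \<Sum>b\<in>I. norm (L a b))"

lemma opn_ge_1: "opn \<ge> 1"
  unfolding opn_def by (simp add: sum_nonneg)

lemma nrm_nonneg [simp]: "nrm v \<ge> 0"
  unfolding nrm_def by (simp add: sum_nonneg)

lemma norm_le_nrm: "a \<in> I \<Longrightarrow> norm (v a) \<le> nrm v"
  unfolding nrm_def using fin by (intro member_le_sum) auto

lemma nrm_app: "nrm (app L v) \<le> opn * nrm v"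
proof -
  have "nrm (app L v) \<le> (\<Sum>a\<in>I. \<Sum>b\<in>I. norm (L a b) * nrm v)"
    unfolding nrm_def[of "app L v"] app_def
    by (intro sum_mono order.trans[OF norm_sum]) (auto simp: norm_mult intro!: mult_left_mono norm_le_nrm)
  also have "\<dots> = (opn - 1) * nrm v"
    by (simp add: opn_def sum_distrib_right)
  also have "\<dots> \<le> opn * nrm v"
    by (intro mult_right_mono) auto
  finally show ?thesis .
qed

lemma nrm_cmult: "nrm (\<lambda>a. c * v a) = norm c * nrm v"
  by (simp add: nrm_def norm_mult sum_distrib_left)

lemma app_cong: "(\<And>b. b \<in> I \<Longrightarrow> v b = v' b) \<Longrightarrow> app M v = app M v'"
  unfolding app_def by (intro ext sum.cong) auto

lemma app_app:
  assumes "a \<in> I" and "\<And>a c. a \<in> I \<Longrightarrow> c \<in> I \<Longrightarrow> (\<Sum>b\<in>I. M a b * M' b c) = (if a = c then 1 else 0)"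
  shows "app M (app M' v) a = v a"
proof -
  have "app M (app M' v) a = (\<Sum>b\<in>I. \<Sum>c\<in>I. M a b * M' b c * v c)"
    unfolding app_def by (simp add: sum_distrib_left mult.assoc)
  also have "\<dots> = (\<Sum>c\<in>I. (\<Sum>b\<in>I. M a b * M' b c) * v c)"
    by (subst sum.swap) (simp add: sum_distrib_right)
  also have "\<dots> = (\<Sum>c\<in>I. (if a = c then 1 else 0) * v c)"
    using assms by (intro sum.cong) auto
  also have "\<dots> = v a"
    using assms(1) fin by (simp add: if_distrib[of "\<lambda>x. x * _"] cong: if_cong)
  finally show ?thesis .
qed

lemma app_right_inv: "a \<in> I \<Longrightarrow> app L (app L' v) a = v a"
  and app_left_inv: "a \<in> I \<Longrightarrow> app L' (app L v) a = v a"
  using right_inv left_inv by (simp_all add: app_app)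

definition solves :: "(int \<Rightarrow> 'i \<Rightarrow> complex) \<Rightarrow> (int \<Rightarrow> 'i \<Rightarrow> complex) \<Rightarrow> int \<Rightarrow> bool" where
  "solves x h s \<longleftrightarrow> (\<forall>a\<in>I. x s a = q powi (- s) * app L (x (s + d)) a + h s a)"

text \<open>The factor \<open>R powi d\<close> is the price of moving from \<open>s\<close> to
  \<open>s + d\<close> in a bound \<open>C * R powi s\<close>. It is constant, while the norm of
  \<open>q powi (- s)\<close> tends to zero. \<open>M\<close> lets the caller push the threshold
  further to the right.\<close>

lemma contraction_from:
  assumes "R \<ge> 1"
  obtains s1 where "\<And>s. s \<ge> s1 \<Longrightarrow> norm (q powi (- s)) * opn * R powi d \<le> 1 / 2" "s1 \<ge> (M::int)"
proof -
  \<comment> \<open>The inequality at \<open>s\<close> is equivalent to |q|^s being at least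
    \<open>c\<close>.\<close>
  define c where "c = 2 * opn * R powi d"
  have c: "c > 0" using opn_ge_1 assms by (simp add: c_def)
  obtain n where n: "c < norm q ^ n" using q real_arch_pow by blast
  show ?thesis
  proof (rule that[of "max M (int n)"])
    fix s assume s: "s \<ge> max M (int n)"
    then have "norm q ^ n \<le> norm q powi s"
      using q by (auto simp: power_int_def nat_le_iff intro!: power_increasing)
    then have le: "c \<le> norm q powi s" using n by simp
    have "norm (q powi (- s)) * opn * R powi d = c / (2 * norm q powi s)"
      by (simp add: c_def norm_power_int power_int_minus field_simps norm_inverse norm_divide)
    also have "\<dots> \<le> 1 / 2"
      using le c by (simp add: field_simps)
    finally show "norm (q powi (- s)) * opn * R powi d \<le> 1 / 2" .
  qed simp
qed

lemma contraction_step: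
  assumes "norm (q powi (- s)) * opn * R powi d \<le> 1 / 2" "R \<ge> 1" "C \<ge> 0"
    and "nrm v \<le> C * R powi (s + d)"
  shows "nrm (\<lambda>a. q powi (- s) * app L v a) \<le> (C / 2) * R powi s"
proof -
  have "nrm (\<lambda>a. q powi (- s) * app L v a) \<le> norm (q powi (- s)) * (opn * nrm v)"
    unfolding nrm_cmult by (intro mult_left_mono nrm_app) auto
  also have "\<dots> \<le> norm (q powi (- s)) * (opn * (C * R powi (s + d)))"
    using assms opn_ge_1 by (intro mult_left_mono) auto
  also have "\<dots> = (norm (q powi (- s)) * opn * R powi d) * (C * R powi s)"
    using assms by (simp add: power_int_add mult_ac)
  also have "\<dots> \<le> (1 / 2) * (C * R powi s)"
    using assms by (intro mult_right_mono) auto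
  finally show ?thesis by simp
qed

lemma uniform_bound:
  assumes "\<And>a. a \<in> I \<Longrightarrow> geo_bounded (\<lambda>s. x s a)"
  obtains C R N where "C \<ge> 0" "R \<ge> 1" "\<And>s a. a \<in> I \<Longrightarrow> s < N \<Longrightarrow> x s a = 0"
    "\<And>s. s \<ge> 0 \<Longrightarrow> nrm (x s) \<le> C * R powi s"
proof -
  from assms have "\<forall>a\<in>I. \<exists>N C R. C \<ge> 0 \<and> R \<ge> 1 \<and> (\<forall>s<N. x s a = 0) \<and>
      (\<forall>s. norm (x s a) \<le> C * R powi s)"
    unfolding geo_bounded_def by blast
  then obtain N C R where C: "\<And>a. a \<in> I \<Longrightarrow> C a \<ge> 0" and R: "\<And>a. a \<in> I \<Longrightarrow> R a \<ge> (1::real)"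
    and N: "\<And>a s. a \<in> I \<Longrightarrow> s < N a \<Longrightarrow> x s a = 0"
    and bd: "\<And>a s. a \<in> I \<Longrightarrow> norm (x s a) \<le> C a * R a powi s"
    by metis
  show ?thesis
  proof
    show "(\<Sum>a\<in>I. C a) \<ge> 0" using C by (simp add: sum_nonneg)
    \<comment> \<open>The inserted elements 1 and 0 provide a maximum and a minimum when
      \<open>I\<close> is empty. The final bound is restricted to \<open>s \<ge> 0\<close> because
      only there do powers increase with the base.\<close>
    show "Max (insert 1 (R ` I)) \<ge> 1" using fin by simp
    show "x s a = 0" if "a \<in> I" "s < Min (insert 0 (N ` I))" for s a
      using that fin N by simp
    fix s :: int assume s: "s \<ge> 0"
    have "norm (x s a) \<le> C a * Max (insert 1 (R ` I)) powi s" if "a \<in> I" for a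
    proof -
      have "R a powi s \<le> Max (insert 1 (R ` I)) powi s"
        using s that fin R[OF that] by (auto simp: power_int_def intro!: power_mono Max_ge)
      then have "C a * R a powi s \<le> C a * Max (insert 1 (R ` I)) powi s"
        using C that by (intro mult_left_mono) auto
      then show ?thesis using bd[OF that, of s] by linarith
    qed
    then show "nrm (x s) \<le> (\<Sum>a\<in>I. C a) * Max (insert 1 (R ` I)) powi s"
      unfolding nrm_def sum_distrib_right by (intro sum_mono) auto
  qed
qed

text \<open>Both ends force \<open>x\<close> to vanish: geometric growth at +infinity kills the part
  above the window by contraction, and the zeros near -infinity propagate upwards through the
  inverse of \<open>L\<close> to everything below \<open>w + d\<close>. Since the window has length
  \<open>d\<close>, an equation inside it links an index below \<open>w + d\<close> with one at or
  above it; both values of \<open>x\<close> are zero, hence so is \<open>u\<close>.\<close>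

lemma homogeneous_unique:
  assumes geo: "\<And>a. a \<in> I \<Longrightarrow> geo_bounded (\<lambda>s. x s a)"
    and sol: "\<And>s. solves x u s"
    and u: "\<And>s a. a \<in> I \<Longrightarrow> s \<notin> {w..<w + d} \<Longrightarrow> u s a = 0"
    and a: "a \<in> I"
  shows "x s a = 0" "u s a = 0"
proof -
  obtain N C R where CR: "C \<ge> 0" "R \<ge> 1" and N: "\<And>s a. a \<in> I \<Longrightarrow> s < N \<Longrightarrow> x s a = 0"
    and bd: "\<And>s. s \<ge> 0 \<Longrightarrow> nrm (x s) \<le> C * R powi s"
    using geo by (rule uniform_bound) blast+
  obtain s1 where s1: "\<And>s. s \<ge> s1 \<Longrightarrow> norm (q powi (- s)) * opn * R powi d \<le> 1 / 2"
    "s1 \<ge> max 0 (w + d)"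
    using CR(2) by (rule contraction_from[where M = "max 0 (w + d)"]) blast
  have hom: "x s a = q powi (- s) * app L (x (s + d)) a" if "a \<in> I" "s \<notin> {w..<w + d}" for s a
    using sol[of s] u[OF that] that unfolding solves_def by simp
  \<comment> \<open>Iterating the contraction \<open>t\<close> times improves the constant to
    \<open>C / 2 ^ t\<close>; \<open>high\<close> lets \<open>t\<close> tend to infinity.\<close>
  have decay: "nrm (x s) \<le> C / 2 ^ t * R powi s" if "s \<ge> s1" for s t
    using that
  proof (induction t arbitrary: s)
    case 0
    then show ?case using bd[of s] s1(2) by simp
  next
    case (Suc t)
    have "nrm (x (s + d)) \<le> C / 2 ^ t * R powi (s + d)"
      using Suc.IH[of "s + d"] Suc.prems d by simp
    from contraction_step[OF s1(1)[OF Suc.prems] CR(2) _ this]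
    have "nrm (\<lambda>a. q powi (- s) * app L (x (s + d)) a) \<le> C / 2 ^ t / 2 * R powi s"
      using CR by simp
    moreover have "nrm (x s) = nrm (\<lambda>a. q powi (- s) * app L (x (s + d)) a)"
      unfolding nrm_def using hom s1(2) Suc.prems by (intro sum.cong) auto
    ultimately show ?case by (simp add: mult.commute)
  qed
  have high: "x s a = 0" if "s \<ge> s1" "a \<in> I" for s a
  proof -
    have "(\<lambda>t. C * R powi s * (1 / 2) ^ t) \<longlonglongrightarrow> C * R powi s * 0"
      by (intro tendsto_mult tendsto_const LIMSEQ_power_zero) simp
    moreover have "nrm (x s) \<le> C * R powi s * (1 / 2) ^ t" for t
      using decay[OF that(1), of t] by (simp add: field_simps)
    ultimately have "nrm (x s) \<le> 0"
      using LIMSEQ_le_const[of _ _ "nrm (x s)"] by force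
    then show ?thesis using norm_le_nrm[OF that(2), of "x s"] by (metis norm_le_zero_iff order.trans)
  qed
  \<comment> \<open>Downwards from \<open>s1\<close> to the end of the window: there
    \<open>x (s + d)\<close> determines \<open>x s\<close>.\<close>
  have above: "x s a = 0" if "s \<ge> w + d" "a \<in> I" "s \<ge> s1 - int n" for s a n
    using that
  proof (induction n arbitrary: s a)
    case 0
    then show ?case using high by simp
  next
    case (Suc n)
    have "x (s + d) b = 0" if "b \<in> I" for b
      using Suc.prems d that by (intro Suc.IH) auto
    then have "app L (x (s + d)) a = 0" by (simp add: app_def)
    then show ?case using hom[of a s] Suc.prems by simp
  qed
  \<comment> \<open>Upwards from \<open>N\<close>: the equation at \<open>s - d\<close> lies to the
    left of the window and determines \<open>x s\<close>, because \<open>L\<close> is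
    injective.\<close>
  have below: "x s a = 0" if "s < w + d" "a \<in> I" "s < N + int n" for s a n
    using that
  proof (induction n arbitrary: s a)
    case 0
    then show ?case using N by simp
  next
    case (Suc n)
    have "x (s - d) b = 0" if "b \<in> I" for b
      using Suc.prems d that by (intro Suc.IH) auto
    moreover have "x (s - d) b = q powi (- (s - d)) * app L (x s) b" if "b \<in> I" for b
      using hom[of b "s - d"] that Suc.prems by simp
    ultimately have "app L (x s) b = 0" if "b \<in> I" for b
      using that q_nonzero by force
    then have "app L' (app L (x s)) a = 0"
      by (simp add: app_def[of L'])
    then show ?case using app_left_inv Suc.prems by simp
  qed
  have zero: "x s a = 0" if "a \<in> I" for s a
  proof (cases "s < w + d")
    case True
    then show ?thesis using below[of s a "nat (s - N + 1)"] that by simp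
  next
    case False
    then show ?thesis using above[of s a "nat (s1 - s)"] that by simp
  qed
  show "x s a = 0" using zero a by simp
  have "app L (x (s + d)) a = 0" using zero by (simp add: app_def)
  then show "u s a = 0"
    using sol[of s] zero a unfolding solves_def by auto
qed

text \<open>Read upwards, the recursion yields \<open>y (s + d)\<close> from \<open>y s\<close> by
  applying \<open>L'\<close>. This is the formal solution, without any control of its growth at
  +infinity.\<close>

lemma forward_solution:
  assumes "\<And>s a. a \<in> I \<Longrightarrow> s < N \<Longrightarrow> h s a = 0"
  obtains y where "\<And>s a. s < N \<Longrightarrow> y s a = 0" "\<And>s. solves y h s"
proof -
  \<comment> \<open>Zeros are prescribed up to \<open>N + d\<close> and not just up to
    \<open>N\<close>: for \<open>s < N\<close> the equation at \<open>s\<close> says that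
    \<open>app L (y (s + d))\<close> vanishes on \<open>I\<close>.\<close>
  define P where "P y s r \<longleftrightarrow> r = (if s < N + d then (\<lambda>_. 0) else
      app L' (\<lambda>a. q powi (s - d) * (y (s - d) a - h (s - d) a)))"
    for y :: "int \<Rightarrow> 'i \<Rightarrow> complex" and s r
  have "\<exists>y. \<forall>s. P y s (y s)"
  \<comment> \<open>The value at \<open>s\<close> refers only to \<open>s - d\<close>, and only for
    \<open>s \<ge> N + d\<close>, where the measure strictly decreases.\<close>
  proof (rule dependent_wf_choice[of "Wellfounded.measure (\<lambda>s. nat (s - N))"])
    fix f g :: "int \<Rightarrow> 'i \<Rightarrow> complex" and s r
    assume "\<And>z. (z, s) \<in> Wellfounded.measure (\<lambda>s. nat (s - N)) \<Longrightarrow> f z = g z"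
    then have "s \<ge> N + d \<Longrightarrow> f (s - d) = g (s - d)"
      using d by simp
    then show "P f s r = P g s r" unfolding P_def by auto
  qed (auto simp: P_def)
  then obtain y where y: "\<And>s. y s = (if s < N + d then (\<lambda>_. 0) else
      app L' (\<lambda>a. q powi (s - d) * (y (s - d) a - h (s - d) a)))"
    unfolding P_def by blast
  show ?thesis
  proof
    show "y s a = 0" if "s < N" for s a
      using that y[of s] d by simp
    show "solves y h s" for s
      unfolding solves_def
    proof
      fix a assume a: "a \<in> I"
      show "y s a = q powi - s * app L (y (s + d)) a + h s a"
      proof (cases "s < N")
        case True
        then show ?thesis using y[of s] y[of "s + d"] d assms[OF a True] by (simp add: app_def)
      next
        case False
        then have "y (s + d) = app L' (\<lambda>a. q powi s * (y s a - h s a))"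
          using y[of "s + d"] by simp
        then have "app L (y (s + d)) a = q powi s * (y s a - h s a)"
          using app_right_inv[OF a] by simp
        then show ?thesis using q_nonzero by (simp add: power_int_minus field_simps)
      qed
    qed
  qed
qed

text \<open>The \<open>t\<close>-th term of the Neumann series for x = T x + h, where T sends
  \<open>x\<close> to the sequence with value \<open>q powi (- s) * app L (x (s + d)) a\<close> at
  \<open>s\<close> and \<open>a\<close>.\<close>

primrec iter_term :: "(int \<Rightarrow> 'i \<Rightarrow> complex) \<Rightarrow> nat \<Rightarrow> int \<Rightarrow> 'i \<Rightarrow> complex" where
  "iter_term h 0 = h"
| "iter_term h (Suc t) = (\<lambda>s a. q powi (- s) * app L (iter_term h t (s + d)) a)"

text \<open>For large \<open>s\<close> the Neumann series is dominated by a geometric series of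
  ratio 1/2, and its sum inherits the growth rate of \<open>h\<close>; the factor 2 is the sum of
  that geometric series. Nothing makes this solution vanish near -infinity.\<close>

lemma backward_solution:
  assumes CR: "C \<ge> 0" "R \<ge> 1" and bd: "\<And>s. s \<ge> 0 \<Longrightarrow> nrm (h s) \<le> C * R powi s"
  obtains y s1 where "\<And>s. solves y h s" "\<And>s a. s \<ge> s1 \<Longrightarrow> a \<in> I \<Longrightarrow> norm (y s a) \<le> 2 * C * R powi s"
proof -
  obtain s1 where s1: "\<And>s. s \<ge> s1 \<Longrightarrow> norm (q powi (- s)) * opn * R powi d \<le> 1 / 2" "s1 \<ge> 0"
    using CR(2) by (rule contraction_from[where M = 0]) blast
  have decay: "nrm (iter_term h t s) \<le> C / 2 ^ t * R powi s" if "s \<ge> s1" for s t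
    using that
  proof (induction t arbitrary: s)
    case 0
    then show ?case using bd[of s] s1(2) by simp
  next
    case (Suc t)
    have "nrm (iter_term h t (s + d)) \<le> C / 2 ^ t * R powi (s + d)"
      using Suc.IH[of "s + d"] Suc.prems d by simp
    from contraction_step[OF s1(1)[OF Suc.prems] CR(2) _ this]
    show ?case using CR by (simp add: mult.commute)
  qed
  have geom: "(\<lambda>t. C * R powi s * (1 / 2) ^ t) sums (C * R powi s * 2)" for s
    using sums_mult[OF geometric_sums[of "1/2::real"], of "C * R powi s"] by simp
  have tbd: "norm (iter_term h t s a) \<le> C * R powi s * (1 / 2) ^ t" if "s \<ge> s1" "a \<in> I" for s t a
    using order.trans[OF norm_le_nrm[OF that(2)] decay[OF that(1), of t]]
    by (simp add: field_simps)
  \<comment> \<open>Left of \<open>s1\<close> the contraction is lost, but each term at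
    \<open>s\<close> is a linear image of the preceding term at \<open>s + d\<close>, so summability
    is passed downwards.\<close>
  have summ: "summable (\<lambda>t. iter_term h t s a)" if "s \<ge> s1 - int n" "a \<in> I" for s n a
    using that
  proof (induction n arbitrary: s a)
    case 0
    then show ?case
      using tbd by (intro summable_comparison_test'[OF sums_summable[OF geom[of s]], of 0]) simp
  next
    case (Suc n)
    have "summable (\<lambda>t. iter_term h t (s + d) b)" if "b \<in> I" for b
      using Suc.prems d that by (intro Suc.IH) auto
    then have "summable (\<lambda>t. q powi (- s) * (\<Sum>b\<in>I. L a b * iter_term h t (s + d) b))"
      by (intro summable_mult summable_sum)
    then have "summable (\<lambda>t. iter_term h (Suc t) s a)" by (simp add: app_def)
    then show ?case by (subst (asm) summable_Suc_iff)
  qed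
  have summable_iter: "summable (\<lambda>t. iter_term h t s a)" if "a \<in> I" for s a
    using that by (intro summ[of "nat (s1 - s)"]) auto
  define y where "y s a = (\<Sum>t. iter_term h t s a)" for s a
  show ?thesis
  proof
    show "solves y h s" for s
      unfolding solves_def
    proof
      fix a assume a: "a \<in> I"
      have "y s a = (\<Sum>t. iter_term h (Suc t) s a) + h s a"
        unfolding y_def using suminf_split_head[OF summable_iter[OF a]] by simp
      also have "(\<Sum>t. iter_term h (Suc t) s a) = q powi (- s) * (\<Sum>t. \<Sum>b\<in>I. L a b * iter_term h t (s + d) b)"
        unfolding iter_term.simps app_def using summable_iter
        by (intro suminf_mult summable_sum summable_mult) auto
      also have "(\<Sum>t. \<Sum>b\<in>I. L a b * iter_term h t (s + d) b) = app L (y (s + d)) a"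
        unfolding app_def y_def using summable_iter
        by (subst suminf_sum) (auto intro!: sum.cong suminf_mult[symmetric] suminf_mult)
      finally show "y s a = q powi (- s) * app L (y (s + d)) a + h s a" .
    qed
    show "norm (y s a) \<le> 2 * C * R powi s" if "s \<ge> s1" "a \<in> I" for s a
    proof -
      have "norm (y s a) \<le> (\<Sum>t. C * R powi s * (1 / 2) ^ t)"
        unfolding y_def using tbd[OF that] geom by (intro norm_suminf_le) (auto simp: sums_iff)
      then show ?thesis using geom[of s] by (simp add: sums_iff)
    qed
  qed
qed

text \<open>The solution that vanishes near \<open>-\<infinity>\<close> is used below the end of the window and the one
  with geometric growth near \<open>\<infinity>\<close> above it; \<open>u\<close> absorbs the discrepancy inside the window.\<close>

lemma inhomogeneous_exists:
  assumes geo: "\<And>a. a \<in> I \<Longrightarrow> geo_bounded (\<lambda>s. h s a)"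
  obtains x u where "\<And>a. a \<in> I \<Longrightarrow> geo_bounded (\<lambda>s. x s a)"
    "\<And>s a. s \<notin> {w..<w + d} \<Longrightarrow> u s a = 0" "\<And>s. solves x (\<lambda>s a. h s a - u s a) s"
proof -
  obtain N C R where CR: "C \<ge> 0" "R \<ge> 1" and N: "\<And>s a. a \<in> I \<Longrightarrow> s < N \<Longrightarrow> h s a = 0"
    and bd: "\<And>s. s \<ge> 0 \<Longrightarrow> nrm (h s) \<le> C * R powi s"
    using geo by (rule uniform_bound) blast+
  obtain y where y: "\<And>s a. s < N \<Longrightarrow> y s a = 0" "\<And>s. solves y h s"
    using N by (rule forward_solution) blast+
  obtain y' s1 where y': "\<And>s. solves y' h s"
    "\<And>s a. s \<ge> s1 \<Longrightarrow> a \<in> I \<Longrightarrow> norm (y' s a) \<le> 2 * C * R powi s"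
    using CR bd by (rule backward_solution) blast+
  define x where "x s = (if s < w + d then y s else y' s)" for s
  define u where "u s a = (if s \<in> {w..<w + d} then q powi (- s) * app L (y' (s + d)) a + h s a - y s a else 0)" for s a
  show ?thesis
  proof
    show "geo_bounded (\<lambda>s. x s a)" if "a \<in> I" for a
    proof (rule geo_boundedI)
      show "x s a = 0" if "s < min N (w + d)" for s
        using y(1) that by (simp add: x_def)
      show "R > 0" using CR by simp
      show "norm (x s a) \<le> 2 * C * R powi s" if "s \<ge> max s1 (w + d)" for s
        using y'(2)[of s a] \<open>a \<in> I\<close> that by (simp add: x_def)
    qed
    show "u s a = 0" if "s \<notin> {w..<w + d}" for s a
      using that by (auto simp: u_def)
    \<comment> \<open>\<open>s\<close> and \<open>s + d\<close> lie on the same side of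
      \<open>w + d\<close> unless \<open>s\<close> is in the window, where \<open>u\<close> is by
      construction the mismatch between \<open>y\<close> and the downward continuation of
      \<open>y'\<close>.\<close>
    show "solves x (\<lambda>s a. h s a - u s a) s" for s
      using y(2)[of s] y'(1)[of s] d unfolding solves_def x_def u_def by auto
  qed
qed

end

section \<open>Block equations\<close>

definition window :: "int \<Rightarrow> int \<Rightarrow> conv_laurent set" where
  "window w d = {f. \<forall>m. m \<notin> {w..<w + d} \<longrightarrow> cl_nth f m = 0}"

lemma window_diff: "f \<in> window w d \<Longrightarrow> g \<in> window w d \<Longrightarrow> f - g \<in> window w d"
  by (auto simp: window_def)

text \<open>Obtained without estimates: by \<open>cl_nth_surj\<close> the sequence comes from an
  element of the field, and the field is closed under the operation. The same device gives the two
  lemmas that follow.\<close>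

lemma geo_bounded_cmult:
  assumes "geo_bounded x" shows "geo_bounded (\<lambda>s. c * x s)"
proof -
  obtain f where "cl_nth f = x" using cl_nth_surj[OF assms] by blast
  then have "(\<lambda>s. c * x s) = cl_nth (cl_const c * f)" by auto
  then show ?thesis using geo_bounded_cl_nth by simp
qed

lemma geo_bounded_sum:
  assumes "\<And>a. a \<in> A \<Longrightarrow> geo_bounded (x a)"
  shows "geo_bounded (\<lambda>s. \<Sum>a\<in>A. x a s)"
proof -
  have "\<forall>a\<in>A. \<exists>f. cl_nth f = x a" using cl_nth_surj assms by blast
  then obtain f where "\<And>a. a \<in> A \<Longrightarrow> cl_nth (f a) = x a" by metis
  then have "(\<lambda>s. \<Sum>a\<in>A. x a s) = cl_nth (\<Sum>a\<in>A. f a)" by auto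
  then show ?thesis using geo_bounded_cl_nth by simp
qed

text \<open>These are the coefficients of the image of \<open>zvar powi (- m) * f\<close> under
  \<open>sigma_q (inverse q)\<close>.\<close>

lemma geo_bounded_scaled_coeff:
  assumes "q \<noteq> 0"
  shows "geo_bounded (\<lambda>s. q powi (- s) * cl_nth f (s + m))"
proof -
  have "cl_nth (sigma_q (inverse q) (zvar powi (- m) * f)) s = inverse q powi s * cl_nth f (s - (- m))" for s
    using assms by (simp only: cl_nth_sigma cl_nth_zvar_powi_mult inverse_nonzero_iff_nonzero not_False_eq_True)
  then have "(\<lambda>s. q powi (- s) * cl_nth f (s + m)) = cl_nth (sigma_q (inverse q) (zvar powi (- m) * f))"
    by (simp add: fun_eq_iff power_int_inverse power_int_minus[of q])
  then show ?thesis using geo_bounded_cl_nth by simp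
qed

section \<open>A single off-diagonal block of the gauge equation\<close>

locale block_equation =
  fixes I J :: "nat set" and P P' Q Q' :: "nat \<Rightarrow> nat \<Rightarrow> complex" and q :: complex
    and m m' w :: int
  assumes finI: "finite I" and finJ: "finite J" and q: "norm q > 1" and less: "m < m'"
    and PP': "\<And>a c. a \<in> I \<Longrightarrow> c \<in> I \<Longrightarrow> (\<Sum>b\<in>I. P a b * P' b c) = (if a = c then 1 else 0)"
    and P'P: "\<And>a c. a \<in> I \<Longrightarrow> c \<in> I \<Longrightarrow> (\<Sum>b\<in>I. P' a b * P b c) = (if a = c then 1 else 0)"
    and QQ': "\<And>a c. a \<in> J \<Longrightarrow> c \<in> J \<Longrightarrow> (\<Sum>b\<in>J. Q a b * Q' b c) = (if a = c then 1 else 0)"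
    and Q'Q: "\<And>a c. a \<in> J \<Longrightarrow> c \<in> J \<Longrightarrow> (\<Sum>b\<in>J. Q' a b * Q b c) = (if a = c then 1 else 0)"
begin

text \<open>Rows and columns are indexed by arbitrary finite sets \<open>I\<close> and
  \<open>J\<close>, so that blocks can later be addressed by their positions in the large matrix,
  without renumbering.\<close>

definition twist :: "(nat \<Rightarrow> nat \<Rightarrow> conv_laurent) \<Rightarrow> nat \<Rightarrow> nat \<Rightarrow> conv_laurent" where
  "twist F a b = (\<Sum>c\<in>I. (zvar powi m * cl_const (P a c)) * F c b)
     - (\<Sum>c\<in>J. sigma_q q (F a c) * (zvar powi m' * cl_const (Q c b)))"

lemma cl_nth_twist:
  "cl_nth (twist F a b) t = (\<Sum>c\<in>I. P a c * cl_nth (F c b) (t - m))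
     - q powi (t - m') * (\<Sum>c\<in>J. cl_nth (F a c) (t - m') * Q c b)"
proof -
  have q0: "q \<noteq> 0" using q by auto
  have "cl_nth (sigma_q q (F a c) * (zvar powi m' * cl_const (Q c b))) t
      = q powi (t - m') * (cl_nth (F a c) (t - m') * Q c b)" for c
    using q0 by (simp add: mult.assoc[symmetric] cl_nth_sigma)
  then show ?thesis
    by (simp add: twist_def mult.assoc sum_distrib_left)
qed

text \<open>The operator X -> P X Q^(-1) as a matrix on pairs of indices; \<open>Q'\<close> acts
  from the right, whence the exchanged order of its arguments.\<close>

definition coeff_op :: "nat \<times> nat \<Rightarrow> nat \<times> nat \<Rightarrow> complex" where
  "coeff_op p p' = P (fst p) (fst p') * Q' (snd p') (snd p)"

definition coeff_op_inv :: "nat \<times> nat \<Rightarrow> nat \<times> nat \<Rightarrow> complex" where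
  "coeff_op_inv p p' = P' (fst p) (fst p') * Q (snd p') (snd p)"

text \<open>The sum over pairs is a product of two sums, the second being an entry of T T', since
  right multiplication reverses the order of the factors.\<close>

lemma tensor_inverse:
  assumes "a \<in> I \<times> J" "c \<in> I \<times> J"
    and S: "\<And>a c. a \<in> I \<Longrightarrow> c \<in> I \<Longrightarrow> (\<Sum>b\<in>I. S a b * S' b c) = (if a = c then 1 else (0::complex))"
    and T: "\<And>a c. a \<in> J \<Longrightarrow> c \<in> J \<Longrightarrow> (\<Sum>b\<in>J. T a b * T' b c) = (if a = c then 1 else (0::complex))"
  shows "(\<Sum>b\<in>I \<times> J. (S (fst a) (fst b) * T' (snd b) (snd a)) * (S' (fst b) (fst c) * T (snd c) (snd b)))
    = (if a = c then 1 else 0)"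
proof -
  have "(\<Sum>b\<in>I \<times> J. (S (fst a) (fst b) * T' (snd b) (snd a)) * (S' (fst b) (fst c) * T (snd c) (snd b)))
    = (\<Sum>x\<in>I. \<Sum>y\<in>J. (S (fst a) x * S' x (fst c)) * (T (snd c) y * T' y (snd a)))"
    by (simp add: sum.cartesian_product case_prod_unfold mult_ac)
  also have "\<dots> = (\<Sum>x\<in>I. S (fst a) x * S' x (fst c)) * (\<Sum>y\<in>J. T (snd c) y * T' y (snd a))"
    by (simp add: sum_product)
  also have "\<dots> = (if a = c then 1 else 0)"
  proof -
    have "(\<Sum>x\<in>I. S (fst a) x * S' x (fst c)) = (if fst a = fst c then 1 else 0)"
      "(\<Sum>y\<in>J. T (snd c) y * T' y (snd a)) = (if snd c = snd a then 1 else 0)"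
      using assms(1,2) by (simp_all add: S T mem_Times_iff)
    then show ?thesis by (auto simp: prod_eq_iff)
  qed
  finally show ?thesis .
qed

text \<open>The coefficient of index \<open>t\<close> of the block equation becomes the recursion at
  \<open>t - m'\<close>; hence the shifted start of the window.\<close>

sublocale recursion: backward_recursion "I \<times> J" coeff_op coeff_op_inv q "m' - m" "w - m'"
proof
  show "finite (I \<times> J)" using finI finJ by simp
  show "norm q > 1" by (rule q)
  show "m' - m > 0" using less by simp
  fix a c assume "a \<in> I \<times> J" "c \<in> I \<times> J"
  then show "(\<Sum>b\<in>I \<times> J. coeff_op a b * coeff_op_inv b c) = (if a = c then 1 else 0)"
    unfolding coeff_op_def coeff_op_inv_def by (rule tensor_inverse[OF _ _ PP' QQ'])
  from \<open>a \<in> I \<times> J\<close> \<open>c \<in> I \<times> J\<close>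
  show "(\<Sum>b\<in>I \<times> J. coeff_op_inv a b * coeff_op b c) = (if a = c then 1 else 0)"
    unfolding coeff_op_def coeff_op_inv_def by (rule tensor_inverse[OF _ _ P'P Q'Q])
qed

text \<open>Up to sign the inhomogeneous term of the recursion: solving twist F = H for the
  coefficient of F multiplied by a power of \<open>q\<close> moves \<open>H\<close> to the other
  side, so that \<open>- mult_Q' H\<close> appears below.\<close>

definition mult_Q' :: "(nat \<Rightarrow> nat \<Rightarrow> conv_laurent) \<Rightarrow> int \<Rightarrow> nat \<times> nat \<Rightarrow> complex" where
  "mult_Q' H s p = q powi (- s) * (\<Sum>b\<in>J. cl_nth (H (fst p) b) (s + m') * Q' b (snd p))"

lemma right_mult_inverse:
  assumes "b \<in> J"
    and T: "\<And>a c. a \<in> J \<Longrightarrow> c \<in> J \<Longrightarrow> (\<Sum>b\<in>J. T a b * T' b c) = (if a = c then 1 else (0::complex))"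
  shows "(\<Sum>c\<in>J. (\<Sum>b\<in>J. f b * T b c) * T' c b) = f b"
proof -
  have "(\<Sum>c\<in>J. (\<Sum>b\<in>J. f b * T b c) * T' c b) = (\<Sum>b'\<in>J. \<Sum>c\<in>J. f b' * (T b' c * T' c b))"
    by (subst sum.swap) (simp add: sum_distrib_right mult.assoc)
  also have "\<dots> = (\<Sum>b'\<in>J. f b' * (if b' = b then 1 else 0))"
    using assms by (intro sum.cong) (simp_all add: sum_distrib_left[symmetric])
  also have "\<dots> = f b" using assms(1) finJ by (simp add: if_distrib[of "\<lambda>x. _ * x"] cong: if_cong)
  finally show ?thesis .
qed

text \<open>Multiplying the coefficient of \<open>z\<^sup>t\<close> in the equation on the right by \<open>Q\<^sup>-\<^sup>1\<close> turns it into
  the recursion at \<open>s = t - m'\<close>.\<close>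

lemma twist_iff_solves:
  "(\<forall>a\<in>I. \<forall>b\<in>J. twist F a b = H a b) \<longleftrightarrow>
     (\<forall>s. recursion.solves (\<lambda>s p. cl_nth (F (fst p) (snd p)) s) (\<lambda>s p. - mult_Q' H s p) s)"
    (is "?L \<longleftrightarrow> ?R")
proof -
  have q0: "q \<noteq> 0" using q by auto
  \<comment> \<open>\<open>X\<close> is F Q, and \<open>Y\<close> is P F minus the right-hand side.
    The equation at index \<open>s + m'\<close> says
    \<open>X s a b = q powi (- s) * Y (s + (m' - m)) a b\<close>; multiplication by
    \<open>Q'\<close> gives the recursion and is undone by \<open>Q\<close>.\<close>
  define X where "X s a b = (\<Sum>c\<in>J. cl_nth (F a c) s * Q c b)" for s a b
  define Y where "Y s a b = (\<Sum>c\<in>I. P a c * cl_nth (F c b) s) - cl_nth (H a b) (s - (m' - m) + m')" for s a b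
  have L: "?L \<longleftrightarrow> (\<forall>s. \<forall>a\<in>I. \<forall>b\<in>J. X s a b = q powi (- s) * Y (s + (m' - m)) a b)"
  proof
    assume l: ?L
    show "\<forall>s. \<forall>a\<in>I. \<forall>b\<in>J. X s a b = q powi (- s) * Y (s + (m' - m)) a b"
    proof (intro allI ballI)
      fix s a b assume ab: "a \<in> I" "b \<in> J"
      from l ab have "cl_nth (twist F a b) (s + m') = cl_nth (H a b) (s + m')" by simp
      then have "Y (s + (m' - m)) a b = q powi s * X s a b"
        by (simp add: cl_nth_twist X_def Y_def algebra_simps)
      then show "X s a b = q powi (- s) * Y (s + (m' - m)) a b"
        using q0 by (simp add: power_int_minus)
    qed
  next
    assume r: "\<forall>s. \<forall>a\<in>I. \<forall>b\<in>J. X s a b = q powi (- s) * Y (s + (m' - m)) a b"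
    show ?L
    proof (intro ballI cl_eqI)
      fix t a b assume ab: "a \<in> I" "b \<in> J"
      from r ab have "X (t - m') a b = q powi (- (t - m')) * Y (t - m) a b" by simp
      then have "q powi (t - m') * X (t - m') a b = Y (t - m) a b"
        using q0 by (simp only: power_int_minus) simp
      then show "cl_nth (twist F a b) t = cl_nth (H a b) t"
        by (simp add: cl_nth_twist X_def Y_def)
    qed
  qed
  have app: "recursion.app coeff_op (\<lambda>p. cl_nth (F (fst p) (snd p)) s) (a, b') =
      (\<Sum>b\<in>J. (\<Sum>c\<in>I. P a c * cl_nth (F c b) s) * Q' b b')" for s a b'
  proof -
    have "recursion.app coeff_op (\<lambda>p. cl_nth (F (fst p) (snd p)) s) (a, b') =
        (\<Sum>x\<in>I. \<Sum>y\<in>J. P a x * cl_nth (F x y) s * Q' y b')"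
      by (simp add: recursion.app_def coeff_op_def sum.cartesian_product case_prod_unfold mult_ac)
    then show ?thesis by (subst (asm) sum.swap) (simp add: sum_distrib_right)
  qed
  have rec: "q powi (- s) * recursion.app coeff_op (\<lambda>p. cl_nth (F (fst p) (snd p)) (s + (m' - m))) (a, b')
      + - mult_Q' H s (a, b') = (\<Sum>b\<in>J. (q powi (- s) * Y (s + (m' - m)) a b) * Q' b b')" for s a b'
    by (simp add: app mult_Q'_def Y_def sum_distrib_left algebra_simps sum_subtractf sum.distrib)
  have R: "?R \<longleftrightarrow> (\<forall>s. \<forall>a\<in>I. \<forall>b'\<in>J. cl_nth (F a b') s =
      (\<Sum>b\<in>J. (q powi (- s) * Y (s + (m' - m)) a b) * Q' b b'))"
    unfolding recursion.solves_def rec[symmetric] by (simp add: split_paired_Ball_Sigma)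
  have "(\<forall>b\<in>J. X s a b = q powi (- s) * Y (s + (m' - m)) a b) \<longleftrightarrow> (\<forall>b'\<in>J. cl_nth (F a b') s =
      (\<Sum>b\<in>J. (q powi (- s) * Y (s + (m' - m)) a b) * Q' b b'))" (is "?L' \<longleftrightarrow> ?R'") for s a
    proof
      assume l: ?L'
      show ?R'
      proof
        fix b' assume b': "b' \<in> J"
        have "cl_nth (F a b') s = (\<Sum>b\<in>J. X s a b * Q' b b')"
          unfolding X_def using b' by (rule right_mult_inverse[symmetric]) (rule QQ')
        then show "cl_nth (F a b') s = (\<Sum>b\<in>J. (q powi (- s) * Y (s + (m' - m)) a b) * Q' b b')"
          using l by simp
      qed
    next
      assume r: ?R'
      show ?L'
      proof
        fix b assume b: "b \<in> J"
        have "X s a b = (\<Sum>c\<in>J. (\<Sum>b\<in>J. (q powi (- s) * Y (s + (m' - m)) a b) * Q' b c) * Q c b)"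
          unfolding X_def using r by simp
        also have "\<dots> = q powi (- s) * Y (s + (m' - m)) a b"
          using b by (rule right_mult_inverse) (rule Q'Q)
        finally show "X s a b = q powi (- s) * Y (s + (m' - m)) a b" .
      qed
    qed
  then show ?thesis unfolding L R by simp
qed

text \<open>Together with \<open>block_unique\<close> this says that (F, U) -> twist F + U is
  bijective: the matrices with entries in the window form a complement of the image of the injective
  operator \<open>twist\<close>, for any start \<open>w\<close>.\<close>

lemma block_exists:
  shows "\<exists>F U. (\<forall>a\<in>I. \<forall>b\<in>J. twist F a b + U a b = G a b \<and> U a b \<in> window w (m' - m))"
proof -
  have q0: "q \<noteq> 0" using q by auto
  have geo: "geo_bounded (\<lambda>s. - mult_Q' G s p)" for p
  proof -
    have "geo_bounded (\<lambda>s. \<Sum>b\<in>J. (- Q' b (snd p)) * (q powi (- s) * cl_nth (G (fst p) b) (s + m')))"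
      using q0 by (intro geo_bounded_sum geo_bounded_cmult geo_bounded_scaled_coeff)
    also have "(\<lambda>s. \<Sum>b\<in>J. (- Q' b (snd p)) * (q powi (- s) * cl_nth (G (fst p) b) (s + m')))
       = (\<lambda>s. - mult_Q' G s p)"
      by (simp add: mult_Q'_def sum_distrib_left sum_negf[symmetric] mult_ac)
    finally show ?thesis .
  qed
  obtain x u where x: "\<And>p. p \<in> I \<times> J \<Longrightarrow> geo_bounded (\<lambda>s. x s p)"
    and u: "\<And>s p. s \<notin> {w - m'..<w - m' + (m' - m)} \<Longrightarrow> u s p = 0"
    and sol: "\<And>s. recursion.solves x (\<lambda>s p. - mult_Q' G s p - u s p) s"
    using geo by (rule recursion.inhomogeneous_exists[where h = "\<lambda>s p. - mult_Q' G s p"]) blast+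
  have "\<forall>p\<in>I \<times> J. \<exists>f. cl_nth f = (\<lambda>s. x s p)" using x cl_nth_surj by blast
  then obtain f where f: "\<And>p. p \<in> I \<times> J \<Longrightarrow> cl_nth (f p) = (\<lambda>s. x s p)" by metis
  define F where "F a b = f (a, b)" for a b
  \<comment> \<open>Determined by the requirement \<open>mult_Q' U = - u\<close>: the right
    multiplication by \<open>Q'\<close>, the power of \<open>q\<close> and the index shift are
    undone.\<close>
  define v where "v a b t = - (q powi (t - m') * (\<Sum>c\<in>J. u (t - m') (a, c) * Q c b))" for a b t
  have v0: "v a b t = 0" if "t \<notin> {w..<w + (m' - m)}" for a b t
    using that by (auto simp: v_def intro!: sum.neutral u)
  have "\<forall>a b. \<exists>g. cl_nth g = v a b"
  \<comment> \<open>Beyond the window \<open>v\<close> is zero, so the tail bound holds with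
    constant 0.\<close>
  proof (intro allI cl_nth_surj geo_boundedI[where R = 1 and C = 0])
    show "v a b t = 0" if "t < w" for a b t using that by (intro v0) auto
    show "norm (v a b t) \<le> 0 * 1 powi t" if "t \<ge> w + (m' - m)" for a b t
      using v0[of t a b] that by auto
  qed simp
  then obtain U where U: "\<And>a b. cl_nth (U a b) = v a b" by metis
  have "\<forall>a\<in>I. \<forall>b\<in>J. twist F a b = G a b - U a b"
    unfolding twist_iff_solves
  proof
    fix s
    have "- mult_Q' (\<lambda>a b. G a b - U a b) s p = - mult_Q' G s p - u s p" if p: "p \<in> I \<times> J" for p
    proof -
      have "mult_Q' U s p = - (\<Sum>b\<in>J. (\<Sum>c\<in>J. u s (fst p, c) * Q c b) * Q' b (snd p))"
        using q0 by (simp add: mult_Q'_def U v_def power_int_minus sum_negf mult.assoc sum_distrib_left[symmetric])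
      also have "(\<Sum>b\<in>J. (\<Sum>c\<in>J. u s (fst p, c) * Q c b) * Q' b (snd p)) = u s p"
        using p by (subst right_mult_inverse[where T = Q and T' = Q']) (auto simp: QQ')
      finally have "mult_Q' U s p = - u s p" .
      moreover have "mult_Q' (\<lambda>a b. G a b - U a b) s p = mult_Q' G s p - mult_Q' U s p"
        by (simp add: mult_Q'_def algebra_simps sum_subtractf)
      ultimately show ?thesis by simp
    qed
    moreover have "cl_nth (F (fst p) (snd p)) s = x s p" if "p \<in> I \<times> J" for s p
      using f[OF that] by (simp add: F_def)
    moreover have "recursion.app coeff_op (\<lambda>p. cl_nth (F (fst p) (snd p)) (s + (m' - m)))
        = recursion.app coeff_op (x (s + (m' - m)))"
      by (rule recursion.app_cong) (simp add: f F_def)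
    ultimately show "recursion.solves (\<lambda>s p. cl_nth (F (fst p) (snd p)) s)
        (\<lambda>s p. - mult_Q' (\<lambda>a b. G a b - U a b) s p) s"
      using sol[of s] unfolding recursion.solves_def by simp
  qed
  moreover have "U a b \<in> window w (m' - m)" for a b
    using v0 by (simp add: window_def U)
  ultimately show ?thesis
    by (intro exI[of _ F] exI[of _ U]) auto
qed

text \<open>Right multiplication by \<open>Q'\<close> acts on each coefficient separately. A
  \<open>U\<close> supported in the window thus gives an inhomogeneous term supported in the shifted
  window, and \<open>homogeneous_unique\<close> applies.\<close>

lemma block_unique:
  assumes "\<And>a b. a \<in> I \<Longrightarrow> b \<in> J \<Longrightarrow> twist F a b + U a b = 0"
    and "\<And>a b. a \<in> I \<Longrightarrow> b \<in> J \<Longrightarrow> U a b \<in> window w (m' - m)"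
    and ab: "a \<in> I" "b \<in> J"
  shows "F a b = 0" "U a b = 0"
proof -
  have tw: "\<forall>a\<in>I. \<forall>b\<in>J. twist F a b = - U a b"
    using assms(1) by (simp add: eq_neg_iff_add_eq_0)
  have F0: "F a b = 0" if "a \<in> I" "b \<in> J" for a b
  proof (rule cl_eqI)
    fix s
    have "cl_nth (F (fst (a, b)) (snd (a, b))) s = 0"
    proof (rule recursion.homogeneous_unique(1))
      show "recursion.solves (\<lambda>s p. cl_nth (F (fst p) (snd p)) s) (\<lambda>s p. - mult_Q' (\<lambda>a b. - U a b) s p) s" for s
        using tw twist_iff_solves[of F "\<lambda>a b. - U a b"] by blast
      show "(a, b) \<in> I \<times> J" using that by simp
      show "- mult_Q' (\<lambda>a b. - U a b) s p = 0"
        if "p \<in> I \<times> J" "s \<notin> {w - m'..<w - m' + (m' - m)}" for s p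
      proof -
        have "cl_nth (- U (fst p) b) (s + m') = 0" if "b \<in> J" for b
          using assms(2)[of "fst p" b] \<open>p \<in> I \<times> J\<close> that \<open>s \<notin> _\<close> cl_nth_diff[of 0 "U (fst p) b"]
          by (auto simp: window_def)
        then show ?thesis by (simp add: mult_Q'_def)
      qed
    qed (rule geo_bounded_cl_nth)
    then show "cl_nth (F a b) s = cl_nth 0 s" by simp
  qed
  then have "F a b = 0" using ab by simp
  have "twist F a b = 0"
    by (rule cl_eqI) (use F0 ab in \<open>simp add: cl_nth_twist\<close>)
  then show "U a b = 0" using assms(1)[OF ab] by simp
  show "F a b = 0" by fact
qed

end

text \<open>Square matrices of size \<open>n\<close> are functions of two indices; \<open>bi\<close> sends an index to the number of
  its block, and \<open>P\<close>, \<open>P'\<close> are block diagonal and inverse to each other.\<close>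

locale block_system =
  fixes n :: nat and bi :: "nat \<Rightarrow> nat" and P P' :: "nat \<Rightarrow> nat \<Rightarrow> complex" and q :: complex
    and \<mu> w :: "nat \<Rightarrow> int"
  assumes q: "norm q > 1"
    and mu_less: "\<And>a b. a < n \<Longrightarrow> b < n \<Longrightarrow> bi a < bi b \<Longrightarrow> \<mu> (bi a) < \<mu> (bi b)"
    and PP': "\<And>a c. a < n \<Longrightarrow> c < n \<Longrightarrow> bi a = bi c \<Longrightarrow>
      (\<Sum>b | b < n \<and> bi b = bi c. P a b * P' b c) = (if a = c then 1 else 0)"
    and P'P: "\<And>a c. a < n \<Longrightarrow> c < n \<Longrightarrow> bi a = bi c \<Longrightarrow>
      (\<Sum>b | b < n \<and> bi b = bi c. P' a b * P b c) = (if a = c then 1 else 0)"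
begin

section \<open>Block triangular matrices and the gauge equation\<close>

definition blk :: "nat \<Rightarrow> nat set" where
  "blk i = {a. a < n \<and> bi a = i}"

definition D :: "nat \<Rightarrow> nat \<Rightarrow> conv_laurent" where
  "D a b = zvar powi \<mu> (bi a) * cl_const (P a b)"

definition unit_entry :: "nat \<Rightarrow> nat \<Rightarrow> conv_laurent" where
  "unit_entry a b = (if a = b then 1 else 0)"

text \<open>\<open>E\<close> and \<open>X\<close> may take any values outside their blocks, as
  \<open>tri\<close> cuts out what it uses; two functions thus stand for a whole block triangular
  matrix.\<close>

definition tri :: "(nat \<Rightarrow> nat \<Rightarrow> conv_laurent) \<Rightarrow> (nat \<Rightarrow> nat \<Rightarrow> conv_laurent) \<Rightarrow> nat \<Rightarrow> nat \<Rightarrow> conv_laurent" where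
  "tri E X a b = (if bi a = bi b then E a b else if bi a < bi b then X a b else 0)"

lemma finite_blk [simp]: "finite (blk i)"
  by (simp add: blk_def)

text \<open>Splitting the middle index by its block separates the two extreme blocks, which carry
  the unknown block of F in the gauge equation, from those strictly in between, which involve only
  blocks closer to the diagonal.\<close>

lemma tri_product:
  assumes a: "a < n" and b: "b < n"
  shows "(\<Sum>c<n. tri E X a c * tri E' X' c b) =
    (if bi a = bi b then (\<Sum>c\<in>blk (bi a). E a c * E' c b)
     else if bi a < bi b then
       (\<Sum>c\<in>blk (bi a). E a c * X' c b) + (\<Sum>c\<in>blk (bi b). X a c * E' c b)
       + (\<Sum>c | c < n \<and> bi a < bi c \<and> bi c < bi b. X a c * X' c b)
     else 0)"
proof -
  let ?t = "\<lambda>c. tri E X a c * tri E' X' c b"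
  consider "bi a = bi b" | "bi a < bi b" | "bi a > bi b" by linarith
  then show ?thesis
  proof cases
    case 1
    have "(\<Sum>c<n. ?t c) = (\<Sum>c\<in>blk (bi a). ?t c)"
      using 1 by (intro sum.mono_neutral_right) (auto simp: blk_def tri_def)
    also have "\<dots> = (\<Sum>c\<in>blk (bi a). E a c * E' c b)"
      using 1 by (intro sum.cong) (auto simp: blk_def tri_def)
    finally show ?thesis using 1 by simp
  next
    case 2
    let ?M = "{c. c < n \<and> bi a < bi c \<and> bi c < bi b}"
    have "(\<Sum>c<n. ?t c) = (\<Sum>c\<in>(blk (bi a) \<union> blk (bi b)) \<union> ?M. ?t c)"
      using 2 by (intro sum.mono_neutral_right) (auto simp: blk_def tri_def)
    also have "\<dots> = (\<Sum>c\<in>blk (bi a) \<union> blk (bi b). ?t c) + (\<Sum>c\<in>?M. ?t c)"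
      by (intro sum.union_disjoint) (auto simp: blk_def)
    also have "(\<Sum>c\<in>blk (bi a) \<union> blk (bi b). ?t c) = (\<Sum>c\<in>blk (bi a). ?t c) + (\<Sum>c\<in>blk (bi b). ?t c)"
      using 2 by (intro sum.union_disjoint) (auto simp: blk_def)
    also have "(\<Sum>c\<in>blk (bi a). ?t c) = (\<Sum>c\<in>blk (bi a). E a c * X' c b)"
      using 2 by (intro sum.cong) (auto simp: blk_def tri_def)
    also have "(\<Sum>c\<in>blk (bi b). ?t c) = (\<Sum>c\<in>blk (bi b). X a c * E' c b)"
      using 2 by (intro sum.cong) (auto simp: blk_def tri_def)
    also have "(\<Sum>c\<in>?M. ?t c) = (\<Sum>c\<in>?M. X a c * X' c b)"
      using 2 by (intro sum.cong) (auto simp: tri_def)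
    finally show ?thesis using 2 by simp
  next
    case 3
    then have "(\<Sum>c<n. ?t c) = 0"
      by (intro sum.neutral) (auto simp: tri_def)
    then show ?thesis using 3 by simp
  qed
qed

lemma sum_unit_left: "a < n \<Longrightarrow> (\<Sum>c\<in>blk (bi a). unit_entry a c * f c) = f a"
  and sum_unit_right: "b < n \<Longrightarrow> (\<Sum>c\<in>blk (bi b). f c * unit_entry c b) = f b"
  by (auto simp: unit_entry_def blk_def if_distrib[of "\<lambda>x. x * _"] if_distrib[of "\<lambda>x. _ * x"] cong: if_cong)

lemma sigma_0 [simp]: "sigma_q q 0 = 0" and sigma_1 [simp]: "sigma_q q 1 = 1"
proof -
  have "q \<noteq> 0" using q by auto
  then show "sigma_q q 0 = 0" "sigma_q q 1 = 1"
    by (auto intro!: cl_eqI simp: cl_nth_sigma cl_nth_1)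
qed

lemma sigma_tri: "sigma_q q (tri unit_entry F a b) = tri unit_entry (\<lambda>a b. sigma_q q (F a b)) a b"
  by (simp add: tri_def unit_entry_def)

lemma block_equation:
  assumes "a < n" "b < n" "bi a < bi b"
  shows "block_equation (blk (bi a)) (blk (bi b)) P P' P P' q (\<mu> (bi a)) (\<mu> (bi b))"
proof -
  have *: "(\<Sum>b\<in>blk i. P a b * P' b c) = (if a = c then 1 else 0)"
    "(\<Sum>b\<in>blk i. P' a b * P b c) = (if a = c then 1 else 0)"
    if "a \<in> blk i" "c \<in> blk i" for a c i
    using PP'[of a c] P'P[of a c] that unfolding blk_def by simp_all
  show ?thesis
    using assms by unfold_locales (simp_all only: q mu_less finite_blk *)
qed

lemma twist_eq:
  assumes ij: "a0 < n" "b0 < n" "bi a0 < bi b0" and a: "a \<in> blk (bi a0)" and b: "b \<in> blk (bi b0)"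
  shows "block_equation.twist (blk (bi a0)) (blk (bi b0)) P P q (\<mu> (bi a0)) (\<mu> (bi b0)) F a b =
    (\<Sum>c\<in>blk (bi a). D a c * F c b) - (\<Sum>c\<in>blk (bi b). sigma_q q (F a c) * D c b)"
  using a b unfolding block_equation.twist_def[OF block_equation[OF ij]] D_def
  by (auto simp: blk_def intro!: arg_cong2[of _ _ _ _ "(-)"] sum.cong)

text \<open>For \<open>bi a < bi b\<close> the \<open>(a, b)\<close> entry of \<open>\<sigma>\<^sub>q(F) V = U F\<close> reads
  \<open>D F - \<sigma>\<^sub>q(F) D + U = rest F U V a b\<close>, where \<open>rest\<close> only involves blocks closer to the diagonal.\<close>

definition rest :: "(nat \<Rightarrow> nat \<Rightarrow> conv_laurent) \<Rightarrow> (nat \<Rightarrow> nat \<Rightarrow> conv_laurent) \<Rightarrow>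
    (nat \<Rightarrow> nat \<Rightarrow> conv_laurent) \<Rightarrow> nat \<Rightarrow> nat \<Rightarrow> conv_laurent" where
  "rest F U V a b = V a b + (\<Sum>c | c < n \<and> bi a < bi c \<and> bi c < bi b.
     sigma_q q (F a c) * V c b - U a c * F c b)"

text \<open>On the diagonal blocks both sides equal \<open>D\<close> and below them both vanish, so
  the equation has content only above the diagonal. There the extreme sums of
  \<open>tri_product\<close> give the left-hand side, and the sums in between are collected in
  \<open>rest\<close>.\<close>

lemma gauge_entry_iff:
  assumes "a < n" "b < n"
  shows "(\<Sum>c<n. sigma_q q (tri unit_entry F a c) * tri D V c b) = (\<Sum>c<n. tri D U a c * tri unit_entry F c b)
    \<longleftrightarrow> (bi a < bi b \<longrightarrow>
      (\<Sum>c\<in>blk (bi a). D a c * F c b) - (\<Sum>c\<in>blk (bi b). sigma_q q (F a c) * D c b) + U a b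
        = rest F U V a b)"
proof (cases "bi a < bi b")
  case True
  have "(\<Sum>c<n. sigma_q q (tri unit_entry F a c) * tri D V c b) = V a b
      + (\<Sum>c\<in>blk (bi b). sigma_q q (F a c) * D c b)
      + (\<Sum>c | c < n \<and> bi a < bi c \<and> bi c < bi b. sigma_q q (F a c) * V c b)"
    using True assms by (simp add: sigma_tri tri_product[OF assms] sum_unit_left)
  moreover have "(\<Sum>c<n. tri D U a c * tri unit_entry F c b) = (\<Sum>c\<in>blk (bi a). D a c * F c b)
      + U a b + (\<Sum>c | c < n \<and> bi a < bi c \<and> bi c < bi b. U a c * F c b)"
    using True assms by (simp add: tri_product[OF assms] sum_unit_right)
  ultimately show ?thesis
    using True unfolding rest_def by (simp only: sum_subtractf) (auto simp: algebra_simps)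
next
  case False
  then show ?thesis
    using assms sum_unit_left[of a "\<lambda>c. D c b"] sum_unit_right[of b "\<lambda>c. D a c"]
    by (cases "bi a = bi b") (simp_all add: sigma_tri tri_product[OF assms])
qed

text \<open>\<open>rest\<close> refers only to blocks at smaller distance from the diagonal, so the
  blocks are chosen by recursion on this distance, each by
  \<open>block_equation.block_exists\<close>.\<close>

theorem normal_form_exists:
  "\<exists>F U. (\<forall>a<n. \<forall>b<n. bi a < bi b \<longrightarrow> U a b \<in> window (w (bi a)) (\<mu> (bi b) - \<mu> (bi a))) \<and>
     (\<forall>a<n. \<forall>b<n. (\<Sum>c<n. sigma_q q (tri unit_entry F a c) * tri D V c b) =
        (\<Sum>c<n. tri D U a c * tri unit_entry F c b))"
proof -
  \<comment> \<open>\<open>f\<close> assigns to a pair of block numbers a whole pair of matrix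
    functions; \<open>FF\<close> and \<open>UU\<close> glue these, reading each one only on its own
    block.\<close>
  define FF where "FF f a b = fst (f (bi a, bi b)) a b" for f :: "nat \<times> nat \<Rightarrow> (nat \<Rightarrow> nat \<Rightarrow> conv_laurent) \<times> (nat \<Rightarrow> nat \<Rightarrow> conv_laurent)" and a b
  define UU where "UU f a b = snd (f (bi a, bi b)) a b" for f :: "nat \<times> nat \<Rightarrow> (nat \<Rightarrow> nat \<Rightarrow> conv_laurent) \<times> (nat \<Rightarrow> nat \<Rightarrow> conv_laurent)" and a b
  define Q where "Q f p r \<longleftrightarrow> (\<forall>a\<in>blk (fst p). \<forall>b\<in>blk (snd p). bi a < bi b \<longrightarrow>
      (\<Sum>c\<in>blk (bi a). D a c * fst r c b) - (\<Sum>c\<in>blk (bi b). sigma_q q (fst r a c) * D c b) + snd r a b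
        = rest (FF f) (UU f) V a b \<and> snd r a b \<in> window (w (bi a)) (\<mu> (bi b) - \<mu> (bi a)))" for f p r
  have "\<exists>f. \<forall>p. Q f p (f p)"
  proof (rule dependent_wf_choice[of "Wellfounded.measure (\<lambda>p. snd p - fst p)"])
    fix f g :: "nat \<times> nat \<Rightarrow> (nat \<Rightarrow> nat \<Rightarrow> conv_laurent) \<times> (nat \<Rightarrow> nat \<Rightarrow> conv_laurent)" and p r
    assume eq: "\<And>z. (z, p) \<in> Wellfounded.measure (\<lambda>p. snd p - fst p) \<Longrightarrow> f z = g z"
    have "rest (FF f) (UU f) V a b = rest (FF g) (UU g) V a b"
      if ab: "a \<in> blk (fst p)" "b \<in> blk (snd p)" for a b
    proof -
      have "f (bi a, bi c) = g (bi a, bi c)" "f (bi c, bi b) = g (bi c, bi b)"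
        if "bi a < bi c" "bi c < bi b" for c
        using that ab by (auto intro!: eq simp: blk_def)
      then show ?thesis
        unfolding rest_def FF_def UU_def by (intro arg_cong2[of _ _ _ _ "(+)"] refl sum.cong) auto
    qed
    then show "Q f p r = Q g p r" unfolding Q_def by auto
  next
    fix p f
    show "\<exists>r. Q f p r"
    proof (cases "\<exists>a b. a \<in> blk (fst p) \<and> b \<in> blk (snd p) \<and> bi a < bi b")
      case True
      then obtain a0 b0 where p: "a0 < n" "b0 < n" "bi a0 < bi b0" "p = (bi a0, bi b0)"
        by (cases p) (auto simp: blk_def)
      obtain F U where FU: "\<And>a b. a \<in> blk (bi a0) \<Longrightarrow> b \<in> blk (bi b0) \<Longrightarrow>
          block_equation.twist (blk (bi a0)) (blk (bi b0)) P P q (\<mu> (bi a0)) (\<mu> (bi b0)) F a b + U a b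
            = rest (FF f) (UU f) V a b \<and> U a b \<in> window (w (bi a0)) (\<mu> (bi b0) - \<mu> (bi a0))"
        using block_equation.block_exists[OF block_equation[OF p(1-3)],
            of "rest (FF f) (UU f) V" "w (bi a0)"] by blast
      have "Q f p (F, U)"
        unfolding Q_def using FU p twist_eq[OF p(1-3)] by (auto simp: blk_def)
      then show ?thesis by blast
    qed (auto simp: Q_def)
  qed simp
  then obtain f where f: "\<And>p. Q f p (f p)" by blast
  have "(\<Sum>c\<in>blk (bi a). D a c * FF f c b) - (\<Sum>c\<in>blk (bi b). sigma_q q (FF f a c) * D c b) + UU f a b
        = rest (FF f) (UU f) V a b \<and> UU f a b \<in> window (w (bi a)) (\<mu> (bi b) - \<mu> (bi a))"
    if "a < n" "b < n" "bi a < bi b" for a b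
  proof -
    have "(\<Sum>c\<in>blk (bi a). D a c * fst (f (bi a, bi b)) c b) = (\<Sum>c\<in>blk (bi a). D a c * FF f c b)"
      "(\<Sum>c\<in>blk (bi b). sigma_q q (fst (f (bi a, bi b)) a c) * D c b) = (\<Sum>c\<in>blk (bi b). sigma_q q (FF f a c) * D c b)"
      unfolding FF_def by (auto intro!: sum.cong simp: blk_def)
    moreover have "a \<in> blk (bi a)" "b \<in> blk (bi b)" using that by (auto simp: blk_def)
    note mp[OF bspec[OF bspec[OF f[of "(bi a, bi b)", unfolded Q_def fst_conv snd_conv] this(1)] this(2)] that(3)]
    ultimately show ?thesis
      unfolding UU_def by simp
  qed
  then show ?thesis
    by (intro exI[of _ "FF f"] exI[of _ "UU f"]) (simp add: gauge_entry_iff)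
qed

text \<open>Induction on the distance from the diagonal, with the vanishing of \<open>F\<close>
  carried along: once the closer blocks of \<open>F\<close> are zero, the equation is homogeneous in
  the block of \<open>F\<close> and the difference of the two normal forms, which still lies in the
  window. So the only gauge transformation between normal forms is the identity.\<close>

theorem normal_form_unique:
  assumes U: "\<And>a b. a < n \<Longrightarrow> b < n \<Longrightarrow> bi a < bi b \<Longrightarrow> U a b \<in> window (w (bi a)) (\<mu> (bi b) - \<mu> (bi a))"
    and U': "\<And>a b. a < n \<Longrightarrow> b < n \<Longrightarrow> bi a < bi b \<Longrightarrow> U' a b \<in> window (w (bi a)) (\<mu> (bi b) - \<mu> (bi a))"
    and eq: "\<And>a b. a < n \<Longrightarrow> b < n \<Longrightarrow> (\<Sum>c<n. sigma_q q (tri unit_entry F a c) * tri D U c b) =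
        (\<Sum>c<n. tri D U' a c * tri unit_entry F c b)"
    and ab: "a < n" "b < n" "bi a < bi b"
  shows "U a b = U' a b"
proof -
  have "F a b = 0 \<and> U a b = U' a b" if "a < n" "b < n" "bi a < bi b" for a b
    using that
  proof (induction "bi b - bi a" arbitrary: a b rule: less_induct)
    case less
    note ij = less.prems
    have tw: "block_equation.twist (blk (bi a)) (blk (bi b)) P P q (\<mu> (bi a)) (\<mu> (bi b)) F a' b'
        + (U' a' b' - U a' b') = 0" if "a' \<in> blk (bi a)" "b' \<in> blk (bi b)" for a' b'
    proof -
      have a'b': "a' < n" "b' < n" "bi a' = bi a" "bi b' = bi b" using that by (auto simp: blk_def)
      have "rest F U' U a' b' = U a' b'"
      proof -
        have "F a' c = 0" "F c b' = 0" if "c < n" "bi a' < bi c" "bi c < bi b'" for c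
          using that a'b' less.hyps[of c a'] less.hyps[of b' c] by auto
        then show ?thesis unfolding rest_def by (auto intro!: sum.neutral)
      qed
      then have "(\<Sum>c\<in>blk (bi a'). D a' c * F c b') - (\<Sum>c\<in>blk (bi b'). sigma_q q (F a' c) * D c b')
          + U' a' b' = U a' b'"
        using gauge_entry_iff[of a' b' F U U'] eq[of a' b'] a'b' ij by simp
      then show ?thesis
        unfolding twist_eq[OF ij that] by (simp only: add_diff_eq) simp
    qed
    have win: "U' a' b' - U a' b' \<in> window (w (bi a)) (\<mu> (bi b) - \<mu> (bi a))"
      if "a' \<in> blk (bi a)" "b' \<in> blk (bi b)" for a' b'
      using that ij U[of a' b'] U'[of a' b'] by (intro window_diff) (auto simp: blk_def)
    have "a \<in> blk (bi a)" "b \<in> blk (bi b)" using ij by (auto simp: blk_def)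
    from block_equation.block_unique[OF block_equation[OF ij], of F "\<lambda>a b. U' a b - U a b", OF tw win this]
    show ?case by auto
  qed
  then show ?thesis using ab by blast
qed

end

section \<open>Filtered modules and symbols\<close>

text \<open>The composite of the projection of step \<open>i\<close> to the graded piece with the
  isomorphism to \<open>P i\<close>. It allows arguments on elements instead of cosets.\<close>

definition symb :: "('e, 'p) filt_qdiff \<Rightarrow> nat \<Rightarrow> 'e \<Rightarrow> 'p" where
  "symb X i x = filt_iso X i (filt_sub X (i - 1) +>\<^bsub>filt_mod X\<^esub> x)"

lemma filt_step_sel [simp]:
  "carrier (filt_step X i) = filt_sub X i" "zero (filt_step X i) = zero (filt_mod X)"
  "add (filt_step X i) = add (filt_mod X)" "smult (filt_step X i) = smult (filt_mod X)"
  "Phi (filt_step X i) = Phi (filt_mod X)"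
  by (simp_all add: filt_step_def)

lemma a_r_coset_filt_step [simp]: "N +>\<^bsub>filt_step X i\<^esub> x = N +>\<^bsub>filt_mod X\<^esub> x"
  by (simp add: a_r_coset_def')

lemma filt_gr_sel:
  "carrier (filt_gr X i) = (\<lambda>x. filt_sub X (i - 1) +>\<^bsub>filt_mod X\<^esub> x) ` filt_sub X i"
  "add (filt_gr X i) C C' = C <+>\<^bsub>filt_mod X\<^esub> C'"
  "smult (filt_gr X i) a C = filt_sub X (i - 1) <+>\<^bsub>filt_mod X\<^esub> ((\<lambda>x. a \<odot>\<^bsub>filt_mod X\<^esub> x) ` C)"
  "Phi (filt_gr X i) C = Phi (filt_mod X) ` C"
  unfolding filt_gr_def qdiff_quot_def by (auto simp: A_RCOSETS_def' set_add_def')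

lemma qdiff_hom_iff:
  "f \<in> qdiff_hom E E' \<longleftrightarrow> (\<forall>x\<in>carrier E. f x \<in> carrier E') \<and>
     (\<forall>x\<in>carrier E. \<forall>y\<in>carrier E. f (x \<oplus>\<^bsub>E\<^esub> y) = f x \<oplus>\<^bsub>E'\<^esub> f y) \<and>
     (\<forall>a. \<forall>x\<in>carrier E. f (a \<odot>\<^bsub>E\<^esub> x) = a \<odot>\<^bsub>E'\<^esub> f x) \<and>
     (\<forall>x\<in>carrier E. f (Phi E x) = Phi E' (f x))"
  by (auto simp: qdiff_hom_def module_hom_def)

text \<open>\<open>filtered\<close> without the isomorphisms of the graded pieces: the calculus of
  cosets has to be available before these are verified for the modules
  \<open>M_filt\<close>.\<close>

locale filtered_steps =
  fixes q :: complex and k :: nat and X :: "('e, 'p) filt_qdiff"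
  assumes whole_module: "qdiff_module q (filt_mod X)"
    and S_0: "filt_sub X 0 = {\<zero>\<^bsub>filt_mod X\<^esub>}" and S_k: "filt_sub X k = carrier (filt_mod X)"
    and S_mono_1: "\<And>i. i \<in> {1..k} \<Longrightarrow> filt_sub X (i - 1) \<subseteq> filt_sub X i"
    and step_module: "\<And>i. i \<le> k \<Longrightarrow> qdiff_module q (filt_step X i)"
begin

abbreviation M where "M \<equiv> filt_mod X"
abbreviation S where "S \<equiv> filt_sub X"

sublocale vectorspace class_ring M
  using whole_module by (simp add: qdiff_module_def)

lemma Phi_add: "x \<in> carrier M \<Longrightarrow> y \<in> carrier M \<Longrightarrow> Phi M (x \<oplus>\<^bsub>M\<^esub> y) = Phi M x \<oplus>\<^bsub>M\<^esub> Phi M y"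
  and Phi_smult: "x \<in> carrier M \<Longrightarrow> Phi M (a \<odot>\<^bsub>M\<^esub> x) = sigma_q q a \<odot>\<^bsub>M\<^esub> Phi M x"
  and Phi_bij: "bij_betw (Phi M) (carrier M) (carrier M)"
  using whole_module by (simp_all add: qdiff_module_def)

lemma step_vectorspace: "i \<le> k \<Longrightarrow> vectorspace class_ring (filt_step X i)"
  using step_module by (simp add: qdiff_module_def)

lemma S_mono: "i \<le> j \<Longrightarrow> j \<le> k \<Longrightarrow> S i \<subseteq> S j"
proof (induction j rule: dec_induct)
  case (step j)
  then show ?case using S_mono_1[of "Suc j"] by auto
qed simp

lemma S_carrier: "i \<le> k \<Longrightarrow> S i \<subseteq> carrier M"
  using S_mono[of i k] S_k by simp

lemma S_closed:
  assumes "i \<le> k"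
  shows "\<zero>\<^bsub>M\<^esub> \<in> S i" "x \<in> S i \<Longrightarrow> y \<in> S i \<Longrightarrow> x \<oplus>\<^bsub>M\<^esub> y \<in> S i" "x \<in> S i \<Longrightarrow> a \<odot>\<^bsub>M\<^esub> x \<in> S i"
proof -
  interpret step: vectorspace class_ring "filt_step X i"
    using step_vectorspace assms .
  show "\<zero>\<^bsub>M\<^esub> \<in> S i" "x \<in> S i \<Longrightarrow> y \<in> S i \<Longrightarrow> x \<oplus>\<^bsub>M\<^esub> y \<in> S i" "x \<in> S i \<Longrightarrow> a \<odot>\<^bsub>M\<^esub> x \<in> S i"
    using step.M.zero_closed step.M.a_closed[of x y] step.smult_closed[of a x] by simp_all
qed

lemma Phi_S_bij: "i \<le> k \<Longrightarrow> bij_betw (Phi M) (S i) (S i)"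
  using step_module by (simp add: qdiff_module_def)

lemma Phi_S: "i \<le> k \<Longrightarrow> Phi M ` S i = S i"
  using Phi_S_bij by (simp add: bij_betw_def)

lemma Phi_S_mem: "i \<le> k \<Longrightarrow> x \<in> S i \<Longrightarrow> Phi M x \<in> S i"
  using Phi_S by blast

lemma minus_eq_smult: "x \<in> carrier M \<Longrightarrow> \<ominus>\<^bsub>M\<^esub> x = (- 1) \<odot>\<^bsub>M\<^esub> x"
  using smult_minus_1[of x] by (simp add: class_ring_simps)

lemma S_minus: "i \<le> k \<Longrightarrow> x \<in> S i \<Longrightarrow> y \<in> S i \<Longrightarrow> x \<ominus>\<^bsub>M\<^esub> y \<in> S i"
  unfolding a_minus_def using S_carrier[of i] by (auto simp: minus_eq_smult S_closed)

lemma mem_coset: "y \<in> N +>\<^bsub>M\<^esub> x \<longleftrightarrow> (\<exists>n\<in>N. y = n \<oplus>\<^bsub>M\<^esub> x)"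
  by (auto simp: a_r_coset_def')

lemma coset_self: "i \<le> k \<Longrightarrow> x \<in> carrier M \<Longrightarrow> x \<in> S i +>\<^bsub>M\<^esub> x"
  unfolding mem_coset using S_closed(1) by (intro bexI[of _ "\<zero>\<^bsub>M\<^esub>"]) auto

lemma minus_add_cancel: "x \<in> carrier M \<Longrightarrow> y \<in> carrier M \<Longrightarrow> (x \<ominus>\<^bsub>M\<^esub> y) \<oplus>\<^bsub>M\<^esub> y = x"
  by (simp add: a_minus_def M.a_assoc M.l_neg)

lemma coset_eq_iff:
  assumes "i \<le> k" "x \<in> carrier M" "y \<in> carrier M"
  shows "S i +>\<^bsub>M\<^esub> x = S i +>\<^bsub>M\<^esub> y \<longleftrightarrow> x \<ominus>\<^bsub>M\<^esub> y \<in> S i"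
proof -
  have c: "n \<in> S i \<Longrightarrow> n \<in> carrier M" for n using S_carrier[OF assms(1)] by blast
  have sub: "S i +>\<^bsub>M\<^esub> x \<subseteq> S i +>\<^bsub>M\<^esub> y" if "x \<ominus>\<^bsub>M\<^esub> y \<in> S i" "x \<in> carrier M" "y \<in> carrier M" for x y
  proof
    fix z assume "z \<in> S i +>\<^bsub>M\<^esub> x"
    then obtain n where n: "n \<in> S i" "z = n \<oplus>\<^bsub>M\<^esub> x" by (auto simp: mem_coset)
    have "z = (n \<oplus>\<^bsub>M\<^esub> (x \<ominus>\<^bsub>M\<^esub> y)) \<oplus>\<^bsub>M\<^esub> y"
      using c[OF n(1)] that n(2) by (simp add: a_minus_def M.a_assoc M.l_neg)
    then show "z \<in> S i +>\<^bsub>M\<^esub> y"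
      using S_closed(2)[OF assms(1) n(1) that(1)] by (auto simp: mem_coset)
  qed
  show ?thesis
  proof
    assume eq: "S i +>\<^bsub>M\<^esub> x = S i +>\<^bsub>M\<^esub> y"
    have "x \<in> S i +>\<^bsub>M\<^esub> x"
      using assms by (simp add: coset_self)
    then obtain n where n: "n \<in> S i" "x = n \<oplus>\<^bsub>M\<^esub> y" unfolding eq by (auto simp: mem_coset)
    then have "x \<ominus>\<^bsub>M\<^esub> y = n"
      using c[OF n(1)] assms(3) by (simp add: a_minus_def M.a_assoc M.r_neg)
    then show "x \<ominus>\<^bsub>M\<^esub> y \<in> S i" using n by simp
  next
    assume d: "x \<ominus>\<^bsub>M\<^esub> y \<in> S i"
    have "y \<ominus>\<^bsub>M\<^esub> x = \<ominus>\<^bsub>M\<^esub> (x \<ominus>\<^bsub>M\<^esub> y)"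
      using assms by (simp add: a_minus_def M.minus_add M.a_comm)
    then have "y \<ominus>\<^bsub>M\<^esub> x \<in> S i"
      using d c[OF d] assms(1) by (simp add: minus_eq_smult S_closed)
    then show "S i +>\<^bsub>M\<^esub> x = S i +>\<^bsub>M\<^esub> y"
      using sub d assms by blast
  qed
qed

lemma coset_add:
  assumes "i \<le> k" "x \<in> carrier M" "y \<in> carrier M"
  shows "(S i +>\<^bsub>M\<^esub> x) <+>\<^bsub>M\<^esub> (S i +>\<^bsub>M\<^esub> y) = S i +>\<^bsub>M\<^esub> (x \<oplus>\<^bsub>M\<^esub> y)"
proof -
  have c: "n \<in> S i \<Longrightarrow> n \<in> carrier M" for n using S_carrier[OF assms(1)] by blast
  have eq: "(n \<oplus>\<^bsub>M\<^esub> x) \<oplus>\<^bsub>M\<^esub> (n' \<oplus>\<^bsub>M\<^esub> y) = (n \<oplus>\<^bsub>M\<^esub> n') \<oplus>\<^bsub>M\<^esub> (x \<oplus>\<^bsub>M\<^esub> y)"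
    if "n \<in> S i" "n' \<in> S i" for n n'
    using c that assms by (simp add: M.a_ac)
  show ?thesis
  proof (intro equalityI subsetI)
    fix z assume "z \<in> (S i +>\<^bsub>M\<^esub> x) <+>\<^bsub>M\<^esub> (S i +>\<^bsub>M\<^esub> y)"
    then obtain n n' where n: "n \<in> S i" "n' \<in> S i" "z = (n \<oplus>\<^bsub>M\<^esub> x) \<oplus>\<^bsub>M\<^esub> (n' \<oplus>\<^bsub>M\<^esub> y)"
      by (auto simp: set_add_def' a_r_coset_def')
    then show "z \<in> S i +>\<^bsub>M\<^esub> (x \<oplus>\<^bsub>M\<^esub> y)"
      using eq[OF n(1,2)] S_closed(2)[OF assms(1) n(1,2)] by (auto simp: mem_coset)
  next
    fix z assume "z \<in> S i +>\<^bsub>M\<^esub> (x \<oplus>\<^bsub>M\<^esub> y)"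
    then obtain n where n: "n \<in> S i" "z = n \<oplus>\<^bsub>M\<^esub> (x \<oplus>\<^bsub>M\<^esub> y)" by (auto simp: mem_coset)
    then have "z = (n \<oplus>\<^bsub>M\<^esub> x) \<oplus>\<^bsub>M\<^esub> (\<zero>\<^bsub>M\<^esub> \<oplus>\<^bsub>M\<^esub> y)"
      using c[OF n(1)] assms by (simp add: M.a_assoc)
    then show "z \<in> (S i +>\<^bsub>M\<^esub> x) <+>\<^bsub>M\<^esub> (S i +>\<^bsub>M\<^esub> y)"
      using n(1) S_closed(1)[OF assms(1)] unfolding set_add_def' a_r_coset_def' by blast
  qed
qed

lemma coset_smult:
  assumes "i \<le> k" "x \<in> carrier M"
  shows "S i <+>\<^bsub>M\<^esub> ((\<lambda>x. a \<odot>\<^bsub>M\<^esub> x) ` (S i +>\<^bsub>M\<^esub> x)) = S i +>\<^bsub>M\<^esub> (a \<odot>\<^bsub>M\<^esub> x)"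
proof -
  have c: "n \<in> S i \<Longrightarrow> n \<in> carrier M" for n using S_carrier[OF assms(1)] by blast
  have eq: "n \<oplus>\<^bsub>M\<^esub> a \<odot>\<^bsub>M\<^esub> (n' \<oplus>\<^bsub>M\<^esub> x) = (n \<oplus>\<^bsub>M\<^esub> a \<odot>\<^bsub>M\<^esub> n') \<oplus>\<^bsub>M\<^esub> a \<odot>\<^bsub>M\<^esub> x"
    if "n \<in> S i" "n' \<in> S i" for n n'
    using c that assms by (simp add: smult_r_distr M.a_assoc)
  show ?thesis
  proof (intro equalityI subsetI)
    fix z assume "z \<in> S i <+>\<^bsub>M\<^esub> ((\<lambda>x. a \<odot>\<^bsub>M\<^esub> x) ` (S i +>\<^bsub>M\<^esub> x))"
    then obtain n n' where n: "n \<in> S i" "n' \<in> S i" "z = n \<oplus>\<^bsub>M\<^esub> a \<odot>\<^bsub>M\<^esub> (n' \<oplus>\<^bsub>M\<^esub> x)"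
      by (auto simp: set_add_def' a_r_coset_def')
    then show "z \<in> S i +>\<^bsub>M\<^esub> (a \<odot>\<^bsub>M\<^esub> x)"
      using eq[OF n(1,2)] S_closed(2,3)[OF assms(1)] by (auto simp: mem_coset)
  next
    fix z assume "z \<in> S i +>\<^bsub>M\<^esub> (a \<odot>\<^bsub>M\<^esub> x)"
    then obtain n where n: "n \<in> S i" "z = n \<oplus>\<^bsub>M\<^esub> (a \<odot>\<^bsub>M\<^esub> x)" by (auto simp: mem_coset)
    then have "z = n \<oplus>\<^bsub>M\<^esub> a \<odot>\<^bsub>M\<^esub> (\<zero>\<^bsub>M\<^esub> \<oplus>\<^bsub>M\<^esub> x)"
      using assms by simp
    then show "z \<in> S i <+>\<^bsub>M\<^esub> ((\<lambda>x. a \<odot>\<^bsub>M\<^esub> x) ` (S i +>\<^bsub>M\<^esub> x))"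
      using n(1) S_closed(1)[OF assms(1)] unfolding set_add_def' a_r_coset_def' by blast
  qed
qed

text \<open>The image is the full coset because \<open>Phi M\<close> maps each step onto
  itself.\<close>

lemma coset_Phi:
  assumes "i \<le> k" "x \<in> carrier M"
  shows "Phi M ` (S i +>\<^bsub>M\<^esub> x) = S i +>\<^bsub>M\<^esub> Phi M x"
proof -
  have c: "n \<in> S i \<Longrightarrow> n \<in> carrier M" for n using S_carrier[OF assms(1)] by blast
  have "Phi M ` (S i +>\<^bsub>M\<^esub> x) = (\<lambda>n. Phi M n \<oplus>\<^bsub>M\<^esub> Phi M x) ` S i"
    using c assms(2) by (auto simp: a_r_coset_def' Phi_add image_iff)
  also have "\<dots> = (\<lambda>n. n \<oplus>\<^bsub>M\<^esub> Phi M x) ` (Phi M ` S i)"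
    by (simp add: image_image)
  also have "\<dots> = S i +>\<^bsub>M\<^esub> Phi M x"
    unfolding Phi_S[OF assms(1)] by (auto simp: a_r_coset_def')
  finally show ?thesis .
qed

text \<open>Reduces a condition on cosets to statements on elements, with \<open>s\<close> in the
  role of the symbol; \<open>eq\<close> says that its kernel is no larger than the previous
  step.\<close>

lemma qdiff_isoI:
  assumes i: "i \<in> {1..k}"
    and s: "\<And>x. x \<in> S i \<Longrightarrow> filt_iso X i (S (i - 1) +>\<^bsub>M\<^esub> x) = s x"
    and image: "s ` S i = carrier P"
    and eq: "\<And>x y. x \<in> S i \<Longrightarrow> y \<in> S i \<Longrightarrow> s x = s y \<Longrightarrow> x \<ominus>\<^bsub>M\<^esub> y \<in> S (i - 1)"
    and add: "\<And>x y. x \<in> S i \<Longrightarrow> y \<in> S i \<Longrightarrow> s (x \<oplus>\<^bsub>M\<^esub> y) = s x \<oplus>\<^bsub>P\<^esub> s y"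
    and smult: "\<And>a x. x \<in> S i \<Longrightarrow> s (a \<odot>\<^bsub>M\<^esub> x) = a \<odot>\<^bsub>P\<^esub> s x"
    and Phi: "\<And>x. x \<in> S i \<Longrightarrow> s (Phi M x) = Phi P (s x)"
  shows "filt_iso X i \<in> qdiff_iso (filt_gr X i) P"
proof -
  have i': "i \<le> k" "i - 1 \<le> k" using i by auto
  have car: "x \<in> S i \<Longrightarrow> x \<in> carrier M" for x using S_carrier i' by blast
  have "filt_iso X i \<in> qdiff_hom (filt_gr X i) P"
    unfolding qdiff_hom_iff
  proof (intro conjI ballI allI)
    fix C C' a assume "C \<in> carrier (filt_gr X i)"
    then obtain x where x: "x \<in> S i" and C: "C = S (i - 1) +>\<^bsub>M\<^esub> x" by (auto simp: filt_gr_sel(1))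
    show "filt_iso X i C \<in> carrier P" unfolding C s[OF x] using image x by blast
    show "filt_iso X i (a \<odot>\<^bsub>filt_gr X i\<^esub> C) = a \<odot>\<^bsub>P\<^esub> filt_iso X i C"
      using x i' car by (simp add: C filt_gr_sel coset_smult s smult S_closed del: One_nat_def)
    show "filt_iso X i (Phi (filt_gr X i) C) = Phi P (filt_iso X i C)"
      using x i' car by (simp add: C filt_gr_sel coset_Phi s Phi Phi_S_mem del: One_nat_def)
    assume "C' \<in> carrier (filt_gr X i)"
    then obtain y where y: "y \<in> S i" and C': "C' = S (i - 1) +>\<^bsub>M\<^esub> y" by (auto simp: filt_gr_sel(1))
    show "filt_iso X i (C \<oplus>\<^bsub>filt_gr X i\<^esub> C') = filt_iso X i C \<oplus>\<^bsub>P\<^esub> filt_iso X i C'"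
      using x y i' car by (simp add: C C' filt_gr_sel coset_add s add S_closed del: One_nat_def)
  qed
  moreover have "inj_on (filt_iso X i) (carrier (filt_gr X i))"
  proof (rule inj_onI)
    fix C C' assume CC': "C \<in> carrier (filt_gr X i)" "C' \<in> carrier (filt_gr X i)" "filt_iso X i C = filt_iso X i C'"
    then obtain x y where x: "x \<in> S i" "C = S (i - 1) +>\<^bsub>M\<^esub> x" and y: "y \<in> S i" "C' = S (i - 1) +>\<^bsub>M\<^esub> y"
      by (auto simp: filt_gr_sel(1))
    then show "C = C'"
      using eq[OF x(1) y(1)] CC'(3) coset_eq_iff[OF i'(2)] car by (simp add: s del: One_nat_def)
  qed
  moreover have "filt_iso X i ` carrier (filt_gr X i) = carrier P"
    unfolding filt_gr_sel(1) image_image image[symmetric] by (intro image_cong refl s)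
  ultimately show ?thesis by (simp add: qdiff_iso_def bij_betw_def)
qed

end

locale filtered_module =
  fixes q :: complex and k :: nat and P :: "nat \<Rightarrow> 'p qdiff" and X :: "('e, 'p) filt_qdiff"
  assumes filtered: "filtered q k P X"
begin

sublocale filtered_steps q k X
  using filtered by unfold_locales (simp_all add: filtered_def)

context
  fixes i assumes i: "i \<in> {1..k}"
begin

lemma iso: "filt_iso X i \<in> qdiff_iso (filt_gr X i) (P i)"
  using filtered i by (simp add: filtered_def)

lemma i': "i \<le> k" "i - 1 \<le> k" using i by auto

lemma S_car: "x \<in> S i \<Longrightarrow> x \<in> carrier M" using S_carrier i' by blast

lemma coset_gr: "x \<in> S i \<Longrightarrow> S (i - 1) +>\<^bsub>M\<^esub> x \<in> carrier (filt_gr X i)"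
  by (simp add: filt_gr_sel)

lemma symb_image: "symb X i ` S i = carrier (P i)"
proof -
  have "filt_iso X i ` carrier (filt_gr X i) = carrier (P i)"
    using iso by (simp add: qdiff_iso_def bij_betw_def)
  then show ?thesis by (simp add: filt_gr_sel image_image symb_def)
qed

lemma symb_eq_iff:
  assumes "x \<in> S i" "y \<in> S i"
  shows "symb X i x = symb X i y \<longleftrightarrow> x \<ominus>\<^bsub>M\<^esub> y \<in> S (i - 1)"
proof -
  have "inj_on (filt_iso X i) (carrier (filt_gr X i))"
    using iso by (simp add: qdiff_iso_def bij_betw_def)
  then have "symb X i x = symb X i y \<longleftrightarrow> S (i - 1) +>\<^bsub>M\<^esub> x = S (i - 1) +>\<^bsub>M\<^esub> y"
    unfolding symb_def using coset_gr assms by (simp add: inj_on_eq_iff)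
  then show ?thesis using coset_eq_iff[OF i'(2)] assms S_car by simp
qed

lemma symb_add:
  assumes "x \<in> S i" "y \<in> S i"
  shows "symb X i (x \<oplus>\<^bsub>M\<^esub> y) = symb X i x \<oplus>\<^bsub>P i\<^esub> symb X i y"
proof -
  have "filt_iso X i ((S (i - 1) +>\<^bsub>M\<^esub> x) \<oplus>\<^bsub>filt_gr X i\<^esub> (S (i - 1) +>\<^bsub>M\<^esub> y)) = symb X i x \<oplus>\<^bsub>P i\<^esub> symb X i y"
    unfolding symb_def
    using iso coset_gr assms by (intro module_hom_add[of _ class_ring]) (auto simp: qdiff_iso_def qdiff_hom_def)
  then show ?thesis using assms S_car i' by (simp add: filt_gr_sel coset_add symb_def)
qed

lemma symb_smult:
  assumes "x \<in> S i"
  shows "symb X i (a \<odot>\<^bsub>M\<^esub> x) = a \<odot>\<^bsub>P i\<^esub> symb X i x"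
proof -
  have "filt_iso X i (a \<odot>\<^bsub>filt_gr X i\<^esub> (S (i - 1) +>\<^bsub>M\<^esub> x)) = a \<odot>\<^bsub>P i\<^esub> symb X i x"
    unfolding symb_def
    using iso coset_gr assms by (intro module_hom_smult[of _ class_ring]) (auto simp: qdiff_iso_def qdiff_hom_def)
  then show ?thesis using assms S_car i' by (simp add: filt_gr_sel coset_smult symb_def)
qed

lemma symb_Phi:
  assumes "x \<in> S i"
  shows "symb X i (Phi M x) = Phi (P i) (symb X i x)"
proof -
  have "filt_iso X i (Phi (filt_gr X i) (S (i - 1) +>\<^bsub>M\<^esub> x)) = Phi (P i) (symb X i x)"
    unfolding symb_def
    using iso coset_gr assms by (auto simp: qdiff_iso_def qdiff_hom_def)
  then show ?thesis using assms S_car i' by (simp add: filt_gr_sel coset_Phi symb_def)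
qed

end

end

section \<open>Morphisms of filtered modules and their equivalence\<close>

definition filt_morph :: "nat \<Rightarrow> ('e, 'p) filt_qdiff \<Rightarrow> ('f, 'p) filt_qdiff \<Rightarrow> ('e \<Rightarrow> 'f) \<Rightarrow> bool" where
  "filt_morph k X Y f \<longleftrightarrow> f \<in> qdiff_hom (filt_mod X) (filt_mod Y) \<and>
     (\<forall>i\<le>k. f ` filt_sub X i \<subseteq> filt_sub Y i) \<and>
     (\<forall>i\<in>{1..k}. \<forall>x\<in>filt_sub X i. symb Y i (f x) = symb X i x)"

locale filt_pair = X: filtered_module q k P X + Y: filtered_module q k P Y
  for q :: complex and k P and X :: "('e, 'p) filt_qdiff" and Y :: "('f, 'p) filt_qdiff"
begin

lemma hom_minus:
  assumes "f \<in> qdiff_hom X.M Y.M" "x \<in> carrier X.M" "y \<in> carrier X.M"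
  shows "f (x \<ominus>\<^bsub>X.M\<^esub> y) = f x \<ominus>\<^bsub>Y.M\<^esub> f y"
  using assms unfolding qdiff_hom_iff by (simp add: a_minus_def X.minus_eq_smult Y.minus_eq_smult)

lemma hom_zero:
  assumes "f \<in> qdiff_hom X.M Y.M"
  shows "f \<zero>\<^bsub>X.M\<^esub> = \<zero>\<^bsub>Y.M\<^esub>"
  using hom_minus[OF assms X.M.zero_closed X.M.zero_closed] assms
  by (simp add: qdiff_hom_iff a_minus_def X.M.r_neg Y.M.r_neg)

text \<open>The induced map sends the coset of \<open>x\<close> to the coset of \<open>f x\<close>,
  so compatibility with the isomorphisms of the graded pieces is equality of symbols.\<close>

lemma filt_equiv_iff: "filt_equiv k X Y \<longleftrightarrow> (\<exists>f. filt_morph k X Y f)"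
proof -
  have key: "(\<forall>i\<in>{1..k}. \<forall>C\<in>carrier (filt_gr X i).
           filt_iso X i C = filt_iso Y i (induced_map (filt_step Y i) (filt_sub Y (i - 1)) f C))
    \<longleftrightarrow> (\<forall>i\<in>{1..k}. \<forall>x\<in>filt_sub X i. symb Y i (f x) = symb X i x)"
    if f: "f \<in> qdiff_hom X.M Y.M" and sub: "\<forall>i\<le>k. f ` filt_sub X i \<subseteq> filt_sub Y i" for f
  proof -
    have ind: "induced_map (filt_step Y i) (filt_sub Y (i - 1)) f (X.S (i - 1) +>\<^bsub>X.M\<^esub> x) = Y.S (i - 1) +>\<^bsub>Y.M\<^esub> f x"
      if i: "i \<in> {1..k}" and x: "x \<in> X.S i" for i x
    proof -
      have i': "i - 1 \<le> k" "i \<le> k" using i by auto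
      have xc: "x \<in> carrier X.M" using X.S_carrier[OF i'(2)] x by blast
      have "Y.S (i - 1) +>\<^bsub>Y.M\<^esub> f y = Y.S (i - 1) +>\<^bsub>Y.M\<^esub> f x" if "y \<in> X.S (i - 1) +>\<^bsub>X.M\<^esub> x" for y
      proof -
        obtain n where n: "n \<in> X.S (i - 1)" "y = n \<oplus>\<^bsub>X.M\<^esub> x" using \<open>y \<in> X.S (i - 1) +>\<^bsub>X.M\<^esub> x\<close> unfolding X.mem_coset by blast
        have nc: "n \<in> carrier X.M" using X.S_carrier[OF i'(1)] n by blast
        have fc: "f n \<in> carrier Y.M" "f x \<in> carrier Y.M" "f y = f n \<oplus>\<^bsub>Y.M\<^esub> f x"
          using f nc xc n unfolding qdiff_hom_iff by auto
        then have "f y \<ominus>\<^bsub>Y.M\<^esub> f x = f n"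
          by (simp add: a_minus_def Y.M.a_assoc Y.M.r_neg)
        moreover have "f n \<in> Y.S (i - 1)" using sub i'(1) n by blast
        ultimately show ?thesis using Y.coset_eq_iff[OF i'(1)] fc by simp
      qed
      then show ?thesis
        unfolding induced_map_def a_r_coset_filt_step
        using X.coset_self[OF i'(1) xc] by (intro UN_constant_eq) blast+
    qed
    have "(\<forall>C\<in>carrier (filt_gr X i).
           filt_iso X i C = filt_iso Y i (induced_map (filt_step Y i) (filt_sub Y (i - 1)) f C))
      \<longleftrightarrow> (\<forall>x\<in>filt_sub X i. symb Y i (f x) = symb X i x)" (is "?L \<longleftrightarrow> ?R") if i: "i \<in> {1..k}" for i
    proof
      assume L: ?L
      show ?R
      proof
        fix x assume x: "x \<in> X.S i"
        then have "X.S (i - 1) +>\<^bsub>X.M\<^esub> x \<in> carrier (filt_gr X i)" by (simp add: filt_gr_sel(1))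
        from bspec[OF L this] show "symb Y i (f x) = symb X i x"
          unfolding ind[OF i x] symb_def by (rule sym)
      qed
    next
      assume R: ?R
      show ?L
      proof
        fix C assume "C \<in> carrier (filt_gr X i)"
        then obtain x where x: "x \<in> X.S i" and C: "C = X.S (i - 1) +>\<^bsub>X.M\<^esub> x"
          by (auto simp: filt_gr_sel(1))
        from bspec[OF R x]
        show "filt_iso X i C = filt_iso Y i (induced_map (filt_step Y i) (filt_sub Y (i - 1)) f C)"
          unfolding C ind[OF i x] symb_def by (rule sym)
      qed
    qed
    then show ?thesis by (intro ball_cong refl)
  qed
  show ?thesis
    unfolding filt_equiv_def filt_morph_def Bex_def by (intro ex_cong1 conj_cong refl key)
qed

text \<open>Induction along the filtration, as in the five lemma: elements with equal images have
  equal symbols, so their difference lies in the previous step, where \<open>f\<close> is injective;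
  a given \<open>y\<close> is first matched in its symbol, and the remaining error is lifted from
  the previous step. This is the source of the symmetry of \<open>filt_equiv\<close>.\<close>

lemma filt_morph_bij:
  assumes f: "filt_morph k X Y f" and "i \<le> k"
  shows "bij_betw f (X.S i) (Y.S i)"
  using assms(2)
proof (induction i)
  case 0
  have "f \<zero>\<^bsub>X.M\<^esub> = \<zero>\<^bsub>Y.M\<^esub>" using hom_zero f by (simp add: filt_morph_def)
  then show ?case unfolding X.S_0 Y.S_0 by (simp add: bij_betw_def)
next
  case (Suc i)
  then have i: "Suc i \<in> {1..k}" and IH: "bij_betw f (X.S i) (Y.S i)" and ik: "i \<le> k" by auto
  have hom: "f \<in> qdiff_hom X.M Y.M" and sub: "f ` X.S (Suc i) \<subseteq> Y.S (Suc i)" "f ` X.S i \<subseteq> Y.S i"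
    and sy: "\<And>x. x \<in> X.S (Suc i) \<Longrightarrow> symb Y (Suc i) (f x) = symb X (Suc i) x"
    using f i ik by (auto simp: filt_morph_def)
  have car: "\<And>x. x \<in> X.S (Suc i) \<Longrightarrow> x \<in> carrier X.M" "\<And>y. y \<in> Y.S (Suc i) \<Longrightarrow> y \<in> carrier Y.M"
    using X.S_carrier[of "Suc i"] Y.S_carrier[of "Suc i"] i by auto
  have mono: "X.S i \<subseteq> X.S (Suc i)" using X.S_mono_1[OF i] by simp
  show ?case
    unfolding bij_betw_def
  proof
    show "inj_on f (X.S (Suc i))"
    proof (rule inj_onI)
      fix x y assume xy: "x \<in> X.S (Suc i)" "y \<in> X.S (Suc i)" "f x = f y"
      then have "symb X (Suc i) x = symb X (Suc i) y" using sy by metis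
      then have d: "x \<ominus>\<^bsub>X.M\<^esub> y \<in> X.S i" using X.symb_eq_iff[OF i] xy by simp
      have "f (x \<ominus>\<^bsub>X.M\<^esub> y) = f \<zero>\<^bsub>X.M\<^esub>"
        using hom_minus[OF hom] hom_zero[OF hom] car xy sub by (simp add: a_minus_def Y.M.r_neg image_subset_iff)
      then have "x \<ominus>\<^bsub>X.M\<^esub> y = \<zero>\<^bsub>X.M\<^esub>"
        using IH d X.S_closed(1)[OF ik] by (auto simp: bij_betw_def dest: inj_onD)
      then show "x = y" using X.minus_add_cancel[of x y] car xy by simp
    qed
    have "y \<in> f ` X.S (Suc i)" if y: "y \<in> Y.S (Suc i)" for y
    proof -
      have "symb Y (Suc i) y \<in> symb X (Suc i) ` X.S (Suc i)"
        using X.symb_image[OF i] Y.symb_image[OF i] y by blast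
      then obtain x where x: "x \<in> X.S (Suc i)" "symb Y (Suc i) y = symb Y (Suc i) (f x)"
        using sy by force
      then have fx: "f x \<in> Y.S (Suc i)" using sub by blast
      have "y \<ominus>\<^bsub>Y.M\<^esub> f x \<in> Y.S i"
        using Y.symb_eq_iff[OF i y fx] x by simp
      then obtain x' where x': "x' \<in> X.S i" "f x' = y \<ominus>\<^bsub>Y.M\<^esub> f x"
        using IH unfolding bij_betw_def by force
      have x'': "x' \<in> X.S (Suc i)" using x' mono by blast
      have "f (x' \<oplus>\<^bsub>X.M\<^esub> x) = f x' \<oplus>\<^bsub>Y.M\<^esub> f x"
        using hom car x x'' unfolding qdiff_hom_iff by blast
      also have "\<dots> = y"
        using x'(2) car y fx by (simp add: a_minus_def Y.M.a_assoc Y.M.l_neg)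
      finally show ?thesis using X.S_closed(2)[OF _ x'' x(1)] i by force
    qed
    then show "f ` X.S (Suc i) = Y.S (Suc i)" using sub by blast
  qed
qed

lemma filt_morph_inverse:
  assumes f: "filt_morph k X Y f"
  shows "filt_morph k Y X (inv_into (carrier X.M) f)"
proof -
  let ?g = "inv_into (carrier X.M) f"
  have bij: "bij_betw f (carrier X.M) (carrier Y.M)"
    using filt_morph_bij[OF f, of k] by (simp add: X.S_k Y.S_k)
  have hom: "f \<in> qdiff_hom X.M Y.M" using f by (simp add: filt_morph_def)
  have gf: "?g (f x) = x" if "x \<in> carrier X.M" for x
    using bij that by (simp add: bij_betw_def)
  have g: "?g y \<in> carrier X.M" "f (?g y) = y" if "y \<in> carrier Y.M" for y
    using bij that by (auto simp: bij_betw_def inv_into_into f_inv_into_f)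
  have eqI: "?g y = x" if "x \<in> carrier X.M" "f x = y" for x y
    using gf that by blast
  have ghom: "?g \<in> qdiff_hom Y.M X.M"
    unfolding qdiff_hom_iff
  proof (intro conjI ballI allI)
    fix x y a assume x: "x \<in> carrier Y.M"
    show "?g x \<in> carrier X.M" using g x by blast
    show "?g (a \<odot>\<^bsub>Y.M\<^esub> x) = a \<odot>\<^bsub>X.M\<^esub> ?g x"
      using g[OF x] hom unfolding qdiff_hom_iff by (intro eqI) auto
    show "?g (Phi Y.M x) = Phi X.M (?g x)"
      using g[OF x] hom X.Phi_bij unfolding qdiff_hom_iff by (intro eqI) (auto simp: bij_betw_def)
    assume y: "y \<in> carrier Y.M"
    show "?g (x \<oplus>\<^bsub>Y.M\<^esub> y) = ?g x \<oplus>\<^bsub>X.M\<^esub> ?g y"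
      using g[OF x] g[OF y] hom unfolding qdiff_hom_iff by (intro eqI) auto
  qed
  have S: "?g y \<in> X.S i" if i: "i \<le> k" and y: "y \<in> Y.S i" for i y
  proof -
    obtain x where "x \<in> X.S i" "f x = y"
      using filt_morph_bij[OF f i] y unfolding bij_betw_def by force
    then show ?thesis using eqI X.S_carrier[OF i] by (metis subsetD)
  qed
  have "symb X i (?g y) = symb Y i y" if "i \<in> {1..k}" "y \<in> Y.S i" for i y
  proof -
    have "symb X i (?g y) = symb Y i (f (?g y))"
      using f that S[of i y] by (simp add: filt_morph_def)
    then show ?thesis using g(2) Y.S_carrier[of i] that by auto
  qed
  then show ?thesis
    unfolding filt_morph_def using ghom S by auto
qed

end

lemma filt_pairI: "filtered q k P X \<Longrightarrow> filtered q k P Y \<Longrightarrow> filt_pair q k P X Y"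
  by (simp add: filt_pair_def filtered_module_def)

lemma filt_equiv_sym:
  assumes "filtered q k P X" "filtered q k P Y" "filt_equiv k X Y"
  shows "filt_equiv k Y X"
proof -
  interpret XY: filt_pair q k P X Y by (rule filt_pairI) fact+
  interpret YX: filt_pair q k P Y X by (rule filt_pairI) fact+
  show ?thesis using assms(3) XY.filt_morph_inverse unfolding XY.filt_equiv_iff YX.filt_equiv_iff by blast
qed

lemma filt_equiv_trans:
  assumes "filtered q k P X" "filtered q k P Y" "filtered q k P Z" "filt_equiv k X Y" "filt_equiv k Y Z"
  shows "filt_equiv k X Z"
proof -
  interpret XY: filt_pair q k P X Y by (rule filt_pairI) fact+
  interpret YZ: filt_pair q k P Y Z by (rule filt_pairI) fact+
  interpret XZ: filt_pair q k P X Z by (rule filt_pairI) fact+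
  obtain f g where f: "filt_morph k X Y f" and g: "filt_morph k Y Z g"
    using assms(4,5) unfolding XY.filt_equiv_iff YZ.filt_equiv_iff by blast
  have "filt_morph k X Z (\<lambda>x. g (f x))"
    unfolding filt_morph_def
  proof (intro conjI allI ballI impI)
    show "(\<lambda>x. g (f x)) \<in> qdiff_hom (filt_mod X) (filt_mod Z)"
      using f g unfolding filt_morph_def qdiff_hom_iff by simp
    show "(\<lambda>x. g (f x)) ` filt_sub X i \<subseteq> filt_sub Z i" if "i \<le> k" for i
      using f g that unfolding filt_morph_def by fast
    show "symb Z i (g (f x)) = symb X i x" if "i \<in> {1..k}" "x \<in> filt_sub X i" for i x
    proof -
      have "f x \<in> filt_sub Y i" using f that unfolding filt_morph_def by fastforce
      then show ?thesis using f g that unfolding filt_morph_def by simp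
    qed
  qed
  then show ?thesis unfolding XZ.filt_equiv_iff by blast
qed

lemma filt_equiv_refl:
  assumes "filtered q k P X"
  shows "filt_equiv k X X"
proof -
  interpret XX: filt_pair q k P X X by (rule filt_pairI) fact+
  have "filt_morph k X X (\<lambda>x. x)" unfolding filt_morph_def qdiff_hom_iff by simp
  then show ?thesis unfolding XX.filt_equiv_iff by blast
qed

lemma equiv_filt_rel: "equiv {X. filtered q k P X} (filt_rel q k P)"
  by (intro equivI refl_onI symI transI)
    (auto simp: filt_rel_def intro: filt_equiv_refl filt_equiv_sym filt_equiv_trans)

section \<open>Modules of column vectors\<close>

lemma sigma_add [simp]: "q \<noteq> 0 \<Longrightarrow> sigma_q q (f + g) = sigma_q q f + sigma_q q g"
  by (rule cl_eqI) (simp add: cl_nth_sigma algebra_simps)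

lemma sigma_zero [simp]: "q \<noteq> 0 \<Longrightarrow> sigma_q q 0 = 0"
  by (rule cl_eqI) (simp add: cl_nth_sigma)

lemma sigma_mult [simp]: "q \<noteq> 0 \<Longrightarrow> sigma_q q (f * g) = sigma_q q f * sigma_q q g"
  by transfer (intro fls_compose_fps_mult, auto)

lemma sigma_sum [simp]: "q \<noteq> 0 \<Longrightarrow> sigma_q q (sum f A) = (\<Sum>a\<in>A. sigma_q q (f a))"
  by (induction A rule: infinite_finite_induct) auto

lemma sigma_inverse [simp]: "q \<noteq> 0 \<Longrightarrow> sigma_q q (sigma_q (inverse q) f) = f"
  "q \<noteq> 0 \<Longrightarrow> sigma_q (inverse q) (sigma_q q f) = f"
  by (rule cl_eqI, simp add: cl_nth_sigma power_int_inverse)+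

lemma sigma_eq_iff [simp]: "q \<noteq> 0 \<Longrightarrow> sigma_q q f = sigma_q q g \<longleftrightarrow> f = g"
  by (metis sigma_inverse(2))

lemma sigma_eq_0_iff [simp]: "q \<noteq> 0 \<Longrightarrow> sigma_q q f = 0 \<longleftrightarrow> f = 0"
  by (metis sigma_eq_iff sigma_zero)

text \<open>Presenting the subspace as the image of a linear \<open>T\<close> makes it finite
  dimensional as a quotient of the space of all column vectors.\<close>

lemma vectorspace_vec_image:
  fixes T :: "conv_laurent vec \<Rightarrow> conv_laurent vec" and E :: "conv_laurent vec qdiff"
  assumes E: "add E = (+)" "zero E = 0\<^sub>v n" "smult E = (\<cdot>\<^sub>v)" "carrier E = T ` carrier_vec n"
    and sub: "T ` carrier_vec n \<subseteq> carrier_vec n"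
    and add: "\<And>x y. x \<in> carrier_vec n \<Longrightarrow> y \<in> carrier_vec n \<Longrightarrow> T (x + y) = T x + T y"
    and smult: "\<And>a x. x \<in> carrier_vec n \<Longrightarrow> T (a \<cdot>\<^sub>v x) = a \<cdot>\<^sub>v T x"
  shows "vectorspace class_ring E" "vectorspace.fin_dim class_ring E"
proof -
  have T: "T x \<in> carrier_vec n" if "x \<in> carrier_vec n" for x using sub that by blast
  have c: "x \<in> carrier_vec n" if "x \<in> carrier E" for x using that T by (auto simp: E)
  have closed: "x + y \<in> carrier E" if xy: "x \<in> carrier E" "y \<in> carrier E" for x y
  proof -
    obtain u v where "u \<in> carrier_vec n" "v \<in> carrier_vec n" "x = T u" "y = T v" using xy unfolding E by blast
    then show ?thesis using add[of u v] by (metis E(4) add_carrier_vec image_eqI)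
  qed
  have sclosed: "a \<cdot>\<^sub>v x \<in> carrier E" if x: "x \<in> carrier E" for a x
  proof -
    obtain u where "u \<in> carrier_vec n" "x = T u" using x unfolding E by blast
    then show ?thesis using smult[of u a] by (metis E(4) smult_carrier_vec image_eqI)
  qed
  have zero: "0\<^sub>v n \<in> carrier E"
  proof -
    have "T (0 \<cdot>\<^sub>v 0\<^sub>v n) = 0 \<cdot>\<^sub>v T (0\<^sub>v n)" by (rule smult) simp
    also have "\<dots> = 0\<^sub>v n" using T[of "0\<^sub>v n"] by auto
    finally show ?thesis unfolding E by (metis image_eqI smult_carrier_vec zero_carrier_vec)
  qed
  show vs: "vectorspace class_ring E"
  proof (rule vs_criteria)
    show "\<forall>v\<in>carrier E. \<exists>neg_v\<in>carrier E. v \<oplus>\<^bsub>E\<^esub> neg_v = \<zero>\<^bsub>E\<^esub>"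
    proof
      fix v assume v: "v \<in> carrier E"
      have "v + (- 1) \<cdot>\<^sub>v v = 0\<^sub>v n" using c[OF v] by auto
      then show "\<exists>neg_v\<in>carrier E. v \<oplus>\<^bsub>E\<^esub> neg_v = \<zero>\<^bsub>E\<^esub>"
        using sclosed[OF v, of "- 1"] by (auto simp: E)
    qed
  qed (use c closed sclosed zero class_field.field_axioms in
      \<open>auto simp: E(1-3) class_ring_simps add_smult_distrib_vec smult_add_distrib_vec smult_smult_assoc
        intro: comm_add_vec assoc_add_vec smult_add_distrib_vec\<close>)
  interpret V: vec_space "TYPE(conv_laurent)" n .
  have "linear_map class_ring V.V E T"
    unfolding linear_map_def mod_hom_def mod_hom_axioms_def
    using vs V.vectorspace_axioms
    by (auto simp: vectorspace_def module_hom_def module_vec_simps add smult E)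
  from linear_map.surj_fin_dim[OF this] show "vectorspace.fin_dim class_ring E"
    by (simp add: E module_vec_simps)
qed

lemma GL_iff: "A \<in> GL n \<longleftrightarrow> A \<in> carrier_mat n n \<and> (\<exists>B\<in>carrier_mat n n. B * A = 1\<^sub>m n \<and> A * B = 1\<^sub>m n)"
  by (auto simp: Units_def ring_mat_simps)

lemma GL_iff_kernel:
  fixes A :: "'a :: field mat"
  assumes "A \<in> carrier_mat n n" "\<And>v. v \<in> carrier_vec n \<Longrightarrow> A *\<^sub>v v = 0\<^sub>v n \<Longrightarrow> v = 0\<^sub>v n"
  shows "A \<in> GL n"
  using assms det_0_iff_vec_prod_zero[OF assms(1)] by (intro det_non_zero_imp_unit) auto

lemma mult_mat_vec_nth:
  "A \<in> carrier_mat n m \<Longrightarrow> x \<in> carrier_vec m \<Longrightarrow> a < n \<Longrightarrow> (A *\<^sub>v x) $ a = (\<Sum>b<m. A $$ (a, b) * x $ b)"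
  by (simp add: scalar_prod_def lessThan_atLeast0)

lemma std_qdiff_sel [simp]:
  "carrier (std_qdiff q n A) = carrier_vec n" "zero (std_qdiff q n A) = 0\<^sub>v n"
  "add (std_qdiff q n A) = (+)" "smult (std_qdiff q n A) = (\<cdot>\<^sub>v)"
  by (simp_all add: std_qdiff_def)

text \<open>Eliminates the inverse matrix: from here on \<Phi> is handled through the relation A y =
  sigma_q(x).\<close>

lemma std_Phi_iff:
  assumes A: "A \<in> GL n" and "x \<in> carrier_vec n" "y \<in> carrier_vec n"
  shows "Phi (std_qdiff q n A) x = y \<longleftrightarrow> A *\<^sub>v y = map_vec (sigma_q q) x"
proof -
  interpret R: ring "ring_mat TYPE(conv_laurent) n ()" by (rule ring_mat)
  let ?B = "inv\<^bsub>ring_mat TYPE(conv_laurent) n ()\<^esub> A"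
  have Ac: "A \<in> carrier_mat n n" using A by (simp add: GL_iff)
  have B: "?B \<in> carrier_mat n n" "A * ?B = 1\<^sub>m n" "?B * A = 1\<^sub>m n"
    using R.Units_inv_closed[OF A] R.Units_r_inv[OF A] R.Units_l_inv[OF A] by (simp_all add: ring_mat_simps)
  have s: "map_vec (sigma_q q) x \<in> carrier_vec n" using assms by simp
  have "A *\<^sub>v (?B *\<^sub>v map_vec (sigma_q q) x) = map_vec (sigma_q q) x"
    using B s by (simp add: assoc_mult_mat_vec[symmetric, OF Ac B(1) s])
  moreover have "?B *\<^sub>v (A *\<^sub>v y) = y"
    using B assms(3) by (simp add: assoc_mult_mat_vec[symmetric, OF B(1) Ac assms(3)])
  ultimately show ?thesis by (auto simp: std_qdiff_def)
qed

lemma std_Phi_closed: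
  assumes A: "A \<in> GL n" and "x \<in> carrier_vec n"
  shows "Phi (std_qdiff q n A) x \<in> carrier_vec n"
proof -
  interpret R: ring "ring_mat TYPE(conv_laurent) n ()" by (rule ring_mat)
  have "inv\<^bsub>ring_mat TYPE(conv_laurent) n ()\<^esub> A \<in> carrier_mat n n"
    using R.Units_inv_closed[OF A] by (simp add: ring_mat_simps)
  then show ?thesis using assms by (simp add: std_qdiff_def)
qed

lemma std_Phi_eq:
  assumes "A \<in> GL n" "x \<in> carrier_vec n"
  shows "A *\<^sub>v Phi (std_qdiff q n A) x = map_vec (sigma_q q) x"
  using std_Phi_iff[OF assms, of "Phi (std_qdiff q n A) x" q] std_Phi_closed[OF assms, of q] by simp

lemma map_sigma_add:
  "q \<noteq> 0 \<Longrightarrow> x \<in> carrier_vec n \<Longrightarrow> y \<in> carrier_vec n \<Longrightarrow>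
    map_vec (sigma_q q) (x + y) = map_vec (sigma_q q) x + map_vec (sigma_q q) y"
  by (intro eq_vecI) auto

lemma map_sigma_smult: "q \<noteq> 0 \<Longrightarrow> map_vec (sigma_q q) (a \<cdot>\<^sub>v x) = sigma_q q a \<cdot>\<^sub>v map_vec (sigma_q q) x"
  by (intro eq_vecI) auto

lemma std_Phi_bij:
  assumes A: "A \<in> GL n" and q: "q \<noteq> 0"
  shows "bij_betw (Phi (std_qdiff q n A)) (carrier_vec n) (carrier_vec n)"
proof (rule bij_betwI[of _ _ _ "\<lambda>y. map_vec (sigma_q (inverse q)) (A *\<^sub>v y)"])
  have Ac: "A \<in> carrier_mat n n" using A by (simp add: GL_iff)
  show "Phi (std_qdiff q n A) \<in> carrier_vec n \<rightarrow> carrier_vec n"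
    using std_Phi_closed[OF A] by simp
  show "(\<lambda>y. map_vec (sigma_q (inverse q)) (A *\<^sub>v y)) \<in> carrier_vec n \<rightarrow> carrier_vec n"
    using Ac by simp
  fix x :: "conv_laurent vec" assume x: "x \<in> carrier_vec n"
  show "map_vec (sigma_q (inverse q)) (A *\<^sub>v Phi (std_qdiff q n A) x) = x"
    unfolding std_Phi_eq[OF A x] using x q by (intro eq_vecI) auto
  have "map_vec (sigma_q (inverse q)) (A *\<^sub>v x) \<in> carrier_vec n" using Ac x by simp
  moreover have "A *\<^sub>v x = map_vec (sigma_q q) (map_vec (sigma_q (inverse q)) (A *\<^sub>v x))"
    using q by (intro eq_vecI) auto
  ultimately show "Phi (std_qdiff q n A) (map_vec (sigma_q (inverse q)) (A *\<^sub>v x)) = x"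
    using std_Phi_iff[OF A _ x] by blast
qed

text \<open>The equivalence in the last hypothesis gives stability of \<open>N\<close> in one
  direction and, with the bijectivity of \<Phi> on the whole space, surjectivity on \<open>N\<close>
  in the other.\<close>

lemma std_sub_qdiff_module:
  assumes A: "A \<in> GL n" and q: "q \<noteq> 0"
    and N: "N = T ` carrier_vec n" "N \<subseteq> carrier_vec n"
    and add: "\<And>x y. x \<in> carrier_vec n \<Longrightarrow> y \<in> carrier_vec n \<Longrightarrow> T (x + y) = T x + T y"
    and smult: "\<And>a x. x \<in> carrier_vec n \<Longrightarrow> T (a \<cdot>\<^sub>v x) = a \<cdot>\<^sub>v T x"
    and Phi: "\<And>x. x \<in> carrier_vec n \<Longrightarrow> Phi (std_qdiff q n A) x \<in> N \<longleftrightarrow> x \<in> N"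
  shows "qdiff_module q ((std_qdiff q n A)\<lparr>carrier := N\<rparr>)"
proof -
  let ?E = "(std_qdiff q n A)\<lparr>carrier := N\<rparr>"
  let ?Phi = "Phi (std_qdiff q n A)"
  have Ac: "A \<in> carrier_mat n n" using A by (simp add: GL_iff)
  have c: "x \<in> carrier_vec n" if "x \<in> N" for x using N(2) that by blast
  note closed = std_Phi_closed[OF A c]
  have bij: "bij_betw ?Phi N N"
    unfolding bij_betw_def
  proof (intro conjI equalityI subsetI)
    show "inj_on ?Phi N"
      using std_Phi_bij[OF A q] N(2) by (auto simp: bij_betw_def intro: inj_on_subset)
    show "y \<in> N" if "y \<in> ?Phi ` N" for y using that Phi c by auto
    show "y \<in> ?Phi ` N" if y: "y \<in> N" for y
    proof -
      obtain x where x: "x \<in> carrier_vec n" "y = ?Phi x"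
        using std_Phi_bij[OF A q] c[OF y] unfolding bij_betw_def by blast
      then show ?thesis using Phi[OF x(1)] y by blast
    qed
  qed
  have add': "?Phi (x + y) = ?Phi x + ?Phi y" if "x \<in> N" "y \<in> N" for x y
    using c[OF that(1)] c[OF that(2)] closed[OF that(1)] closed[OF that(2)] q
    by (subst std_Phi_iff[OF A])
      (simp_all add: mult_add_distrib_mat_vec[OF Ac] std_Phi_eq[OF A] map_sigma_add)
  have smult': "?Phi (a \<cdot>\<^sub>v x) = sigma_q q a \<cdot>\<^sub>v ?Phi x" if "x \<in> N" for a x
    using c[OF that] closed[OF that] q
    by (subst std_Phi_iff[OF A])
      (simp_all add: mult_mat_vec[OF Ac] std_Phi_eq[OF A] map_sigma_smult)
  have "vectorspace class_ring ?E" "vectorspace.fin_dim class_ring ?E"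
    by (rule vectorspace_vec_image[where T = T and n = n]; use N add smult in simp)+
  then show ?thesis
    unfolding qdiff_module_def using bij add' smult' by simp
qed

section \<open>The filtered modules \<open>M\<^sub>U\<close>\<close>

lemma block_start_eq: "i \<ge> 1 \<Longrightarrow> block_start r i = block_end r (i - 1)"
  unfolding block_start_def block_end_def by (intro sum.cong) auto

lemma block_end_mono: "i \<le> j \<Longrightarrow> block_end r i \<le> block_end r j"
  unfolding block_end_def by (intro sum_mono2) auto

lemma block_index_bounds:
  assumes "a < block_end r k"
  shows "block_index r a \<in> {1..k}" "block_start r (block_index r a) \<le> a"
    "a < block_start r (block_index r a) + r (block_index r a)"
proof -
  have le: "block_index r a \<le> k" unfolding block_index_def using assms by (rule Least_le)
  have lt: "a < block_end r (block_index r a)"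
    unfolding block_index_def using assms by (rule LeastI)
  have pos: "block_index r a \<ge> 1"
    using lt by (cases "block_index r a") (auto simp: block_end_def)
  then have "\<not> a < block_end r (block_index r a - 1)"
    using not_less_Least[of "block_index r a - 1" "\<lambda>i. a < block_end r i"] unfolding block_index_def by simp
  then show "block_start r (block_index r a) \<le> a" using pos by (simp add: block_start_eq)
  show "block_index r a \<in> {1..k}" using pos le by simp
  show "a < block_start r (block_index r a) + r (block_index r a)"
    using lt pos by (simp add: block_end_eq)
qed

text \<open>Turns the coordinate bound in \<open>M_filt\<close> into a condition on block
  numbers.\<close>

lemma block_end_le_iff:
  assumes "a < block_end r k"
  shows "block_end r i \<le> a \<longleftrightarrow> i < block_index r a"
proof
  assume le: "block_end r i \<le> a"
  have "a < block_end r (block_index r a)"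
    using block_index_bounds[OF assms] by (simp add: block_end_eq)
  then show "i < block_index r a"
    using le block_end_mono[of "block_index r a" i r] by linarith
next
  assume "i < block_index r a"
  then have "\<not> a < block_end r i"
    unfolding block_index_def by (rule not_less_Least)
  then show "block_end r i \<le> a" by simp
qed

lemma block_offset:
  assumes "i \<in> {1..k}" "\<alpha> < r i"
  shows "block_start r i + \<alpha> < block_end r k" "block_index r (block_start r i + \<alpha>) = i"
  using assms block_end_mono[of i k r] by (auto simp: block_end_eq block_index_eq)

lemma block_bij:
  assumes "i \<in> {1..k}"
  shows "bij_betw (\<lambda>\<alpha>. block_start r i + \<alpha>) {..<r i} {a. a < block_end r k \<and> block_index r a = i}"
proof (rule bij_betwI[where g = "\<lambda>a. a - block_start r i"])
  show "(\<lambda>a. a - block_start r i) \<in> {a. a < block_end r k \<and> block_index r a = i} \<rightarrow> {..<r i}"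
    using block_index_bounds[of _ r k] by fastforce
qed (use assms block_offset[of i k _ r] block_index_bounds[of _ r k] in auto)

lemma sum_block:
  "i \<in> {1..k} \<Longrightarrow> (\<Sum>a | a < block_end r k \<and> block_index r a = i. f a) = (\<Sum>\<alpha><r i. f (block_start r i + \<alpha>))"
  using sum.reindex_bij_betw[OF block_bij, of i k f r] by simp

lemma mult_mat_nth:
  "A \<in> carrier_mat m n \<Longrightarrow> B \<in> carrier_mat n p \<Longrightarrow> a < m \<Longrightarrow> b < p \<Longrightarrow>
    (A * B) $$ (a, b) = (\<Sum>c<n. A $$ (a, c) * B $$ (c, b))"
  by (simp add: scalar_prod_def lessThan_atLeast0)

text \<open>Covers both admissible spaces of Laurent polynomials, which become windows of the same
  length with different starts.\<close>

lemma laurent_polynomials_eq_window: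
  "{\<Sum>i\<in>{a..b}. cl_const (c i) * zvar powi i | c. True} = window a (b + 1 - a)"
proof -
  have nth: "cl_nth (\<Sum>i\<in>{a..b}. cl_const (c i) * zvar powi i) m = (if m \<in> {a..b} then c m else 0)" for c m
  proof -
    have "cl_nth (cl_const (c i) * zvar powi i) m = (if m = i then c i else 0)" for i
      by (simp add: cl_nth_const)
    then show ?thesis by simp
  qed
  show ?thesis
  proof (intro equalityI subsetI)
    fix f assume "f \<in> {\<Sum>i\<in>{a..b}. cl_const (c i) * zvar powi i | c. True}"
    then obtain c where "f = (\<Sum>i\<in>{a..b}. cl_const (c i) * zvar powi i)" by blast
    then show "f \<in> window a (b + 1 - a)" by (auto simp: window_def nth simp del: cl_nth_sum)
  next
    fix f assume f: "f \<in> window a (b + 1 - a)"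
    have "f = (\<Sum>i\<in>{a..b}. cl_const (cl_nth f i) * zvar powi i)"
      by (rule cl_eqI) (use f in \<open>auto simp: nth window_def simp del: cl_nth_sum\<close>)
    then show "f \<in> {\<Sum>i\<in>{a..b}. cl_const (c i) * zvar powi i | c. True}" by blast
  qed
qed

lemma K_low_eq_window: "K_low m m' = window 0 (m' - m)"
  unfolding K_low_def laurent_polynomials_eq_window by simp

lemma K_window_eq_window: "K_window m m' = window m (m' - m)"
  unfolding K_window_def laurent_polynomials_eq_window by simp

section \<open>The data of the theorem in global indices\<close>

locale slope_data =
  fixes q :: complex and k :: nat and r :: "nat \<Rightarrow> nat" and \<mu> :: "nat \<Rightarrow> int"
    and A :: "nat \<Rightarrow> complex mat"
  assumes q: "norm q > 1" and mono: "strict_mono_on {1..k} \<mu>"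
    and GL: "\<And>i. i \<in> {1..k} \<Longrightarrow> A i \<in> GL (r i)"
begin

abbreviation n where "n \<equiv> block_end r k"
abbreviation bi where "bi \<equiv> block_index r"
abbreviation st where "st \<equiv> block_start r"

lemma n_offset [simp]: "i \<in> {1..k} \<Longrightarrow> \<alpha> < r i \<Longrightarrow> st i + \<alpha> < n"
  and bi_offset [simp]: "i \<in> {1..k} \<Longrightarrow> \<alpha> < r i \<Longrightarrow> bi (st i + \<alpha>) = i"
  by (rule block_offset; assumption)+

lemma q0: "q \<noteq> 0" using q by auto

definition A_inv :: "nat \<Rightarrow> complex mat" where
  "A_inv i = (SOME B. B \<in> carrier_mat (r i) (r i) \<and> B * A i = 1\<^sub>m (r i) \<and> A i * B = 1\<^sub>m (r i))"

lemma A_carrier: "i \<in> {1..k} \<Longrightarrow> A i \<in> carrier_mat (r i) (r i)"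
  using GL by (simp add: GL_iff)

lemma A_inv:
  assumes "i \<in> {1..k}"
  shows "A_inv i \<in> carrier_mat (r i) (r i)" "A_inv i * A i = 1\<^sub>m (r i)" "A i * A_inv i = 1\<^sub>m (r i)"
proof -
  have "\<exists>B. B \<in> carrier_mat (r i) (r i) \<and> B * A i = 1\<^sub>m (r i) \<and> A i * B = 1\<^sub>m (r i)"
    using GL[OF assms] by (auto simp: GL_iff)
  from someI_ex[OF this]
  show "A_inv i \<in> carrier_mat (r i) (r i)" "A_inv i * A i = 1\<^sub>m (r i)" "A i * A_inv i = 1\<^sub>m (r i)"
    by (simp_all add: A_inv_def)
qed

text \<open>The block diagonal matrix with blocks \<open>B i\<close>, read in global indices;
  meaningful only for two indices in the same block.\<close>

definition entry :: "(nat \<Rightarrow> complex mat) \<Rightarrow> nat \<Rightarrow> nat \<Rightarrow> complex" where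
  "entry B a b = B (bi a) $$ (a - st (bi a), b - st (bi b))"

lemma entry_offset:
  assumes "i \<in> {1..k}" "\<alpha> < r i" "\<beta> < r i"
  shows "entry B (st i + \<alpha>) (st i + \<beta>) = B i $$ (\<alpha>, \<beta>)"
  using assms by (simp add: entry_def)

lemma entry_mult:
  assumes "a < n" "c < n" "bi a = bi c"
    and BC: "B (bi c) \<in> carrier_mat (r (bi c)) (r (bi c))" "C (bi c) \<in> carrier_mat (r (bi c)) (r (bi c))"
      "B (bi c) * C (bi c) = 1\<^sub>m (r (bi c))"
  shows "(\<Sum>b | b < n \<and> bi b = bi c. entry B a b * entry C b c) = (if a = c then 1 else 0)"
proof -
  define i where "i = bi c"
  have i: "i \<in> {1..k}" using block_index_bounds[OF assms(2)] by (simp add: i_def)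
  obtain \<alpha> \<gamma> where \<alpha>: "\<alpha> < r i" "a = st i + \<alpha>" and \<gamma>: "\<gamma> < r i" "c = st i + \<gamma>"
    using block_index_bounds[OF assms(1)] block_index_bounds[OF assms(2)] assms(3)
    by (metis i_def le_Suc_ex nat_add_left_cancel_less)
  have "(\<Sum>b | b < n \<and> bi b = i. entry B a b * entry C b c) = (\<Sum>\<beta><r i. B i $$ (\<alpha>, \<beta>) * C i $$ (\<beta>, \<gamma>))"
    unfolding sum_block[OF i] using \<alpha> \<gamma> i by (intro sum.cong) (simp_all add: entry_offset)
  also have "\<dots> = (B i * C i) $$ (\<alpha>, \<gamma>)"
    using mult_mat_nth[of "B i" "r i" "r i" "C i" "r i" \<alpha> \<gamma>] BC(1,2)[folded i_def] \<alpha>(1) \<gamma>(1) by simp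
  also have "\<dots> = (if a = c then 1 else 0)"
    using BC(3)[folded i_def] \<alpha> \<gamma> by simp
  finally show ?thesis by (simp add: i_def)
qed

sublocale block_system n bi "entry A" "entry A_inv" q \<mu> w for w :: "nat \<Rightarrow> int"
proof
  show "norm q > 1" by (rule q)
  show "\<mu> (bi a) < \<mu> (bi b)" if "a < n" "b < n" "bi a < bi b" for a b
    using that block_index_bounds[of a r k] block_index_bounds[of b r k]
    by (intro strict_mono_onD[OF mono]) auto
  show "(\<Sum>b | b < n \<and> bi b = bi c. entry A a b * entry A_inv b c) = (if a = c then 1 else 0)"
    if "a < n" "c < n" "bi a = bi c" for a c
    using that block_index_bounds[OF that(2)] by (intro entry_mult A_inv A_carrier) auto
  show "(\<Sum>b | b < n \<and> bi b = bi c. entry A_inv a b * entry A b c) = (if a = c then 1 else 0)"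
    if "a < n" "c < n" "bi a = bi c" for a c
    using that block_index_bounds[OF that(2)] by (intro entry_mult A_inv A_carrier) auto
qed

definition flat :: "(nat \<times> nat \<Rightarrow> conv_laurent mat) \<Rightarrow> nat \<Rightarrow> nat \<Rightarrow> conv_laurent" where
  "flat U a b = U (bi a, bi b) $$ (a - st (bi a), b - st (bi b))"

abbreviation AM where "AM U \<equiv> A_mat k r \<mu> A U"

lemma AM_carrier [simp]: "AM U \<in> carrier_mat n n"
  by (simp add: A_mat_def block_mat_def)

lemma offset_less: "a < n \<Longrightarrow> a - st (bi a) < r (bi a)"
  using block_index_bounds[of a r k] by linarith

lemma AM_nth:
  assumes "a < n" "b < n"
  shows "AM U $$ (a, b) = tri D (flat U) a b"
proof -
  have "bi a \<in> {1..k}" "bi b \<in> {1..k}" using block_index_bounds assms by blast+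
  then show ?thesis
    using assms A_carrier[of "bi b"] offset_less[OF assms(1)] offset_less[OF assms(2)]
    by (auto simp: A_mat_def block_mat_def Let_def tri_def flat_def D_def diag_block_def entry_def)
qed

lemma AM_mult_nth:
  "x \<in> carrier_vec n \<Longrightarrow> a < n \<Longrightarrow> (AM U *\<^sub>v x) $ a = (\<Sum>b<n. tri D (flat U) a b * x $ b)"
  by (simp add: mult_mat_vec_nth[OF AM_carrier] AM_nth)

text \<open>Entries left of the diagonal block are zero by triangularity, and those to its right
  meet zero values of \<open>x\<close>.\<close>

lemma tri_row:
  assumes "\<And>b. b < n \<Longrightarrow> bi a < bi b \<Longrightarrow> x b = 0"
  shows "(\<Sum>b<n. tri E X a b * x b) = (\<Sum>b\<in>blk (bi a). E a b * x b)"
proof -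
  have "(\<Sum>b<n. tri E X a b * x b) = (\<Sum>b\<in>blk (bi a). tri E X a b * x b)"
    using assms by (intro sum.mono_neutral_right) (auto simp: blk_def tri_def)
  also have "\<dots> = (\<Sum>b\<in>blk (bi a). E a b * x b)"
    by (intro sum.cong) (auto simp: blk_def tri_def)
  finally show ?thesis .
qed

text \<open>Comparing coefficients removes the power of \<open>zvar\<close>, which merely shifts
  indices, and leaves a linear system with a constant invertible block.\<close>

lemma D_injective:
  assumes zero: "\<And>a. a \<in> blk i \<Longrightarrow> (\<Sum>b\<in>blk i. D a b * x b) = 0" and c: "c \<in> blk i"
  shows "x c = 0"
proof (rule cl_eqI)
  fix t
  have row: "(\<Sum>b\<in>blk i. entry A a b * cl_nth (x b) t) = 0" if a: "a \<in> blk i" for a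
  proof -
    have "cl_nth (\<Sum>b\<in>blk i. D a b * x b) (t + \<mu> i) = 0" using zero[OF a] by simp
    then show ?thesis using a by (simp add: D_def blk_def mult.assoc)
  qed
  have "(\<Sum>a\<in>blk i. entry A_inv c a * (\<Sum>b\<in>blk i. entry A a b * cl_nth (x b) t)) =
      (\<Sum>b\<in>blk i. (\<Sum>a\<in>blk i. entry A_inv c a * entry A a b) * cl_nth (x b) t)"
    by (simp add: sum_distrib_left sum_distrib_right mult.assoc) (rule sum.swap)
  also have "\<dots> = (\<Sum>b\<in>blk i. (if c = b then 1 else 0) * cl_nth (x b) t)"
  proof (intro sum.cong refl arg_cong2[of _ _ _ _ "(*)"])
    fix b assume "b \<in> blk i"
    then show "(\<Sum>a\<in>blk i. entry A_inv c a * entry A a b) = (if c = b then 1 else 0)"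
      using c P'P[of c b] unfolding blk_def by simp
  qed
  also have "\<dots> = cl_nth (x c) t"
    using c by (simp add: if_distrib[of "\<lambda>x. x * _"] cong: if_cong)
  finally show "cl_nth (x c) t = cl_nth 0 t" using row by simp
qed

text \<open>Back substitution from the last block. Stopping at block \<open>i\<close> serves both
  the invertibility of the whole matrix (\<open>i = 0\<close>) and the stability of the filtration
  under \<Phi>.\<close>

lemma tri_D_upper_zero:
  assumes "\<And>a. a < n \<Longrightarrow> i < bi a \<Longrightarrow> (\<Sum>b<n. tri D X a b * x b) = 0"
    and "a < n" "i < bi a"
  shows "x a = 0"
  using assms(2,3)
proof (induction "k - bi a" arbitrary: a rule: less_induct)
  case less
  have "(\<Sum>b\<in>blk (bi a). D a' b * x b) = 0" if a': "a' \<in> blk (bi a)" for a'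
  proof -
    have "x b = 0" if "b < n" "bi a' < bi b" for b
      using that a' less.prems block_index_bounds[of b r k] by (intro less.hyps) (auto simp: blk_def)
    then show ?thesis
      using tri_row[of a' x D X] assms(1)[of a'] a' less.prems by (simp add: blk_def)
  qed
  from D_injective[of "bi a" x a, OF this] show ?case using less.prems by (simp add: blk_def)
qed

lemma AM_GL: "AM U \<in> GL n"
proof (rule GL_iff_kernel)
  fix v assume v: "v \<in> carrier_vec n" "AM U *\<^sub>v v = 0\<^sub>v n"
  have "(\<Sum>b<n. tri D (flat U) a b * v $ b) = 0" if "a < n" for a
    using AM_mult_nth[OF v(1) that, of U] v(2) that by simp
  then have "v $ a = 0" if "a < n" for a
    using tri_D_upper_zero[of 0 "flat U" "\<lambda>a. v $ a" a] that block_index_bounds[OF that] by auto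
  then show "v = 0\<^sub>v n" using v(1) by auto
qed simp

abbreviation MF where "MF U \<equiv> M_filt q k r \<mu> A U"
abbreviation PP where "PP \<equiv> pure_piece q r \<mu> A"

section \<open>Filtration and graded pieces of the modules M_U\<close>

definition FS :: "nat \<Rightarrow> conv_laurent vec set" where
  "FS i = {x \<in> carrier_vec n. \<forall>a<n. i < bi a \<longrightarrow> x $ a = 0}"

definition proj :: "nat \<Rightarrow> conv_laurent vec \<Rightarrow> conv_laurent vec" where
  "proj i x = vec (r i) (\<lambda>\<alpha>. x $ (st i + \<alpha>))"

lemma MF_sel [simp]: "filt_mod (MF U) = std_qdiff q n (AM U)" "filt_sub (MF U) i = FS i"
  by (auto simp: M_filt_def FS_def block_end_le_iff[of _ r k])

lemma FS_carrier: "x \<in> FS i \<Longrightarrow> x \<in> carrier_vec n"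
  by (simp add: FS_def)

lemma diag_block_mult_nth:
  assumes i: "i \<in> {1..k}" and v: "v \<in> carrier_vec (r i)" and a: "a \<in> blk i"
  shows "(diag_block \<mu> A i *\<^sub>v v) $ (a - st i) = (\<Sum>b\<in>blk i. D a b * v $ (b - st i))"
proof -
  have c: "diag_block \<mu> A i \<in> carrier_mat (r i) (r i)"
    using A_carrier[OF i] by (simp add: diag_block_def)
  have a': "a < n" "bi a = i" using a by (auto simp: blk_def)
  have "(\<Sum>b\<in>blk i. D a b * v $ (b - st i)) = (\<Sum>\<beta><r i. diag_block \<mu> A i $$ (a - st i, \<beta>) * v $ \<beta>)"
    unfolding blk_def sum_block[OF i]
    using i a' A_carrier[OF i] offset_less[OF a'(1)]
    by (intro sum.cong) (auto simp: D_def entry_def diag_block_def)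
  then show ?thesis
    using offset_less[OF a'(1)] a' by (simp add: mult_mat_vec_nth[OF c v])
qed

lemma diag_block_GL:
  assumes i: "i \<in> {1..k}"
  shows "diag_block \<mu> A i \<in> GL (r i)"
proof (rule GL_iff_kernel)
  show "diag_block \<mu> A i \<in> carrier_mat (r i) (r i)"
    using A_carrier[OF i] by (simp add: diag_block_def)
  fix v assume v: "v \<in> carrier_vec (r i)" "diag_block \<mu> A i *\<^sub>v v = 0\<^sub>v (r i)"
  have *: "(\<Sum>b\<in>blk i. D a b * v $ (b - st i)) = 0" if a: "a \<in> blk i" for a
    using diag_block_mult_nth[OF i v(1) a] v(2) a offset_less[of a] by (simp add: blk_def)
  have "v $ \<alpha> = 0" if "\<alpha> < r i" for \<alpha>
    using D_injective[of i "\<lambda>b. v $ (b - st i)" "st i + \<alpha>", OF *] i that by (simp add: blk_def)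
  then show "v = 0\<^sub>v (r i)" using v(1) by auto
qed

text \<open>For \<open>y\<close> in step \<open>i\<close> the rows of block \<open>i\<close> see
  only the diagonal block, so the relation A y = sigma_q(x) restricts to the coordinates of that
  block.\<close>

lemma proj_Phi:
  assumes i: "i \<in> {1..k}" and x: "x \<in> FS i" and y: "y \<in> FS i" "y = Phi (std_qdiff q n (AM U)) x"
  shows "proj i y = Phi (PP i) (proj i x)"
proof -
  have e: "AM U *\<^sub>v y = map_vec (sigma_q q) x"
    unfolding y(2) by (rule std_Phi_eq[OF AM_GL FS_carrier[OF x]])
  have pc: "proj i z \<in> carrier_vec (r i)" for z by (simp add: proj_def)
  have "diag_block \<mu> A i *\<^sub>v proj i y = map_vec (sigma_q q) (proj i x)"
  proof (rule eq_vecI)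
    show "dim_vec (diag_block \<mu> A i *\<^sub>v proj i y) = dim_vec (map_vec (sigma_q q) (proj i x))"
      using A_carrier[OF i] by (simp add: proj_def diag_block_def)
    fix \<alpha> assume "\<alpha> < dim_vec (map_vec (sigma_q q) (proj i x))"
    then have \<alpha>: "\<alpha> < r i" by (simp add: proj_def)
    have a: "st i + \<alpha> \<in> blk i" using block_offset[OF i, of \<alpha> r] \<alpha> by (simp add: blk_def)
    have "(diag_block \<mu> A i *\<^sub>v proj i y) $ \<alpha> = (\<Sum>b\<in>blk i. D (st i + \<alpha>) b * proj i y $ (b - st i))"
      using diag_block_mult_nth[OF i pc a] by simp
    also have "\<dots> = (\<Sum>b\<in>blk i. D (st i + \<alpha>) b * y $ b)"
      using offset_less block_index_bounds(2) by (intro sum.cong) (auto simp: blk_def proj_def)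
    also have "\<dots> = (\<Sum>b<n. tri D (flat U) (st i + \<alpha>) b * y $ b)"
      using a y(1) by (subst tri_row) (auto simp: blk_def FS_def)
    also have "\<dots> = (AM U *\<^sub>v y) $ (st i + \<alpha>)"
      using a FS_carrier[OF y(1)] by (simp add: AM_mult_nth blk_def)
    also have "\<dots> = map_vec (sigma_q q) (proj i x) $ \<alpha>"
      unfolding e using \<alpha> a FS_carrier[OF x] by (simp add: proj_def blk_def)
    finally show "(diag_block \<mu> A i *\<^sub>v proj i y) $ \<alpha> = map_vec (sigma_q q) (proj i x) $ \<alpha>" .
  qed
  then show ?thesis
    unfolding pure_piece_def using std_Phi_iff[OF diag_block_GL[OF i] pc pc] by metis
qed

text \<open>Triangularity of A in A y = sigma_q(x) carries zeros of \<open>y\<close> beyond block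
  \<open>i\<close> over to \<open>x\<close>; the converse is back substitution.\<close>

lemma Phi_FS:
  assumes x: "x \<in> carrier_vec n"
  shows "Phi (std_qdiff q n (AM U)) x \<in> FS i \<longleftrightarrow> x \<in> FS i"
proof -
  let ?y = "Phi (std_qdiff q n (AM U)) x"
  have y: "?y \<in> carrier_vec n" by (rule std_Phi_closed[OF AM_GL x])
  have e: "(\<Sum>b<n. tri D (flat U) a b * ?y $ b) = sigma_q q (x $ a)" if "a < n" for a
  proof -
    have "(AM U *\<^sub>v ?y) $ a = map_vec (sigma_q q) x $ a"
      using std_Phi_eq[OF AM_GL x] by simp
    then show ?thesis using that x y by (simp add: AM_mult_nth)
  qed
  show ?thesis
  proof
    assume yF: "?y \<in> FS i"
    have "sigma_q q (x $ a) = 0" if "a < n" "i < bi a" for a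
      unfolding e[OF that(1), symmetric] using yF that
      by (intro sum.neutral) (auto simp: FS_def tri_def)
    then show "x \<in> FS i" using x q0 by (simp add: FS_def)
  next
    assume xF: "x \<in> FS i"
    have "?y $ a = 0" if "a < n" "i < bi a" for a
      using e xF that q0 by (intro tri_D_upper_zero[of i "flat U" "\<lambda>a. ?y $ a"]) (auto simp: FS_def)
    then show "?y \<in> FS i" using y by (simp add: FS_def)
  qed
qed

lemma step_MF_module: "qdiff_module q (filt_step (MF U) i)"
  unfolding filt_step_def MF_sel
proof (rule std_sub_qdiff_module[OF AM_GL q0])
  \<comment> \<open>The projection that sets all coordinates beyond block \<open>i\<close> to
    zero.\<close>
  define T :: "conv_laurent vec \<Rightarrow> conv_laurent vec" where
    "T x = vec n (\<lambda>a. if i < bi a then 0 else x $ a)" for x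
  show "FS i = T ` carrier_vec n"
  proof (intro equalityI subsetI)
    fix x assume x: "x \<in> FS i"
    then have "x = T x" by (intro eq_vecI) (auto simp: FS_def T_def)
    then show "x \<in> T ` carrier_vec n" using FS_carrier[OF x] by blast
  qed (auto simp: FS_def T_def)
  show "FS i \<subseteq> carrier_vec n" by (auto simp: FS_def)
  show "T (x + y) = T x + T y" if "x \<in> carrier_vec n" "y \<in> carrier_vec n" for x y
    using that by (intro eq_vecI) (auto simp: T_def)
  show "T (a \<cdot>\<^sub>v x) = a \<cdot>\<^sub>v T x" if "x \<in> carrier_vec n" for a x
    using that by (intro eq_vecI) (auto simp: T_def)
  show "Phi (std_qdiff q n (AM U)) x \<in> FS i \<longleftrightarrow> x \<in> FS i" if "x \<in> carrier_vec n" for x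
    by (rule Phi_FS[OF that])
qed

lemma FS_0: "FS 0 = {0\<^sub>v n}"
proof (intro equalityI subsetI)
  fix x assume x: "x \<in> FS 0"
  have "x = 0\<^sub>v n"
  proof (rule eq_vecI)
    show "x $ a = 0\<^sub>v n $ a" if "a < dim_vec (0\<^sub>v n :: conv_laurent vec)" for a
      using that x block_index_bounds(1)[of a r k] by (auto simp: FS_def)
  qed (use x in \<open>simp add: FS_def\<close>)
  then show "x \<in> {0\<^sub>v n}" by simp
qed (auto simp: FS_def)

lemma FS_k: "FS k = carrier_vec n"
proof -
  have "\<not> k < bi a" if "a < n" for a
    using block_index_bounds(1)[OF that] by simp
  then show ?thesis by (auto simp: FS_def)
qed

lemma FS_mono: "i \<le> j \<Longrightarrow> FS i \<subseteq> FS j"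
  by (auto simp: FS_def)

lemma steps_MF: "filtered_steps q k (MF U)"
proof
  have "std_qdiff q n (AM U) = filt_step (MF U) k"
    by (simp add: filt_step_def FS_k std_qdiff_def)
  then show "qdiff_module q (filt_mod (MF U))" using step_MF_module[of U k] by simp
  show "filt_sub (MF U) 0 = {\<zero>\<^bsub>filt_mod (MF U)\<^esub>}" by (simp add: FS_0)
  show "filt_sub (MF U) k = carrier (filt_mod (MF U))" by (simp add: FS_k)
  show "filt_sub (MF U) (i - 1) \<subseteq> filt_sub (MF U) i" for i by (simp add: FS_mono)
  show "qdiff_module q (filt_step (MF U) i)" for i by (rule step_MF_module)
qed

text \<open>\<open>M_filt\<close> takes \<open>the_elem\<close> of the set of block coordinates over
  a coset. Elements of step \<open>i - 1\<close> have zero coordinates in block \<open>i\<close>, so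
  this set is a singleton.\<close>

lemma symb_MF:
  assumes i: "i \<in> {1..k}" and x: "x \<in> FS i"
  shows "symb (MF U) i x = proj i x"
proof -
  have "proj i (v + x) = proj i x" if "v \<in> FS (i - 1)" for v
  proof (rule eq_vecI)
    fix \<alpha> assume "\<alpha> < dim_vec (proj i x)"
    then have \<alpha>: "\<alpha> < r i" by (simp add: proj_def)
    then have "v $ (st i + \<alpha>) = 0"
      using that block_offset[OF i, of \<alpha> r] i by (auto simp: FS_def)
    then show "proj i (v + x) $ \<alpha> = proj i x $ \<alpha>"
      using \<alpha> FS_carrier[OF x] FS_carrier[OF that] block_offset[OF i, of \<alpha> r] by (simp add: proj_def)
  qed (simp add: proj_def)
  moreover have "0\<^sub>v n \<in> FS (i - 1)" by (simp add: FS_def)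
  ultimately have "proj i ` (FS (i - 1) +>\<^bsub>std_qdiff q n (AM U)\<^esub> x) = {proj i x}"
    unfolding a_r_coset_def' by (auto simp: image_UN)
  then show ?thesis
    unfolding symb_def MF_sel by (simp add: M_filt_def proj_def[abs_def])
qed

lemma filtered_MF: "filtered q k PP (MF U)"
proof -
  interpret filtered_steps q k "MF U" by (rule steps_MF)
  have "filt_iso (MF U) i \<in> qdiff_iso (filt_gr (MF U) i) (PP i)" if i: "i \<in> {1..k}" for i
  proof (rule qdiff_isoI[OF i])
    show "filt_iso (MF U) i (S (i - 1) +>\<^bsub>M\<^esub> x) = proj i x" if "x \<in> S i" for x
      using symb_MF[OF i, of x U] that by (simp add: symb_def del: One_nat_def)
    show "proj i ` S i = carrier (PP i)"
    proof (intro equalityI subsetI)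
      fix v :: "conv_laurent vec" assume v: "v \<in> carrier (PP i)"
      define x where "x = vec n (\<lambda>a. if bi a = i then v $ (a - st i) else 0)"
      have "x \<in> FS i" by (auto simp: x_def FS_def)
      moreover have "proj i x = v"
        using v i by (intro eq_vecI) (auto simp: proj_def x_def pure_piece_def)
      ultimately show "v \<in> proj i ` S i" by auto
    qed (auto simp: proj_def pure_piece_def)
    fix x y a assume x: "x \<in> S i"
    then have xF: "x \<in> FS i" by simp
    note xc = FS_carrier[OF xF]
    have st: "st i + \<alpha> < n" if "\<alpha> < r i" for \<alpha> using i that by (rule n_offset)
    show "proj i (a \<odot>\<^bsub>M\<^esub> x) = a \<odot>\<^bsub>PP i\<^esub> proj i x"
      using xc st by (intro eq_vecI) (auto simp: proj_def pure_piece_def)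
    show "proj i (Phi M x) = Phi (PP i) (proj i x)"
      using xF Phi_FS[OF xc, of U i] by (intro proj_Phi[OF i, of _ _ U]) auto
    assume y: "y \<in> S i"
    then have yF: "y \<in> FS i" by simp
    note yc = FS_carrier[OF yF]
    show "proj i (x \<oplus>\<^bsub>M\<^esub> y) = proj i x \<oplus>\<^bsub>PP i\<^esub> proj i y"
      using xc yc st by (intro eq_vecI) (auto simp: proj_def pure_piece_def)
    assume eq: "proj i x = proj i y"
    have "x \<ominus>\<^bsub>M\<^esub> y = x + (- 1) \<cdot>\<^sub>v y"
      using minus_eq_smult[of y] yc by (simp add: a_minus_def)
    moreover have "x $ a - y $ a = 0" if "a < n" "i - 1 < bi a" for a
    proof (cases "bi a = i")
      case True
      have "proj i x $ (a - st i) = proj i y $ (a - st i)" using eq by simp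
      then show ?thesis
        using offset_less[OF that(1)] block_index_bounds(2)[OF that(1)] True by (simp add: proj_def)
    next
      case False
      then show ?thesis using that xF yF by (auto simp: FS_def)
    qed
    ultimately show "x \<ominus>\<^bsub>M\<^esub> y \<in> S (i - 1)"
      using xc yc by (simp add: FS_def)
  qed
  then show ?thesis
    unfolding filtered_def using whole_module S_0 S_k S_mono_1 step_module by blast
qed

end

section \<open>Matrix form of filtered modules\<close>

context filtered_steps
begin

text \<open>Linear combinations as initial partial sums: recursion on the length supports inductions
  that add one vector of an adapted basis at a time.\<close>

primrec comb :: "(nat \<Rightarrow> 'e) \<Rightarrow> (nat \<Rightarrow> conv_laurent) \<Rightarrow> nat \<Rightarrow> 'e" where
  "comb e v 0 = \<zero>\<^bsub>M\<^esub>"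
| "comb e v (Suc m) = comb e v m \<oplus>\<^bsub>M\<^esub> v m \<odot>\<^bsub>M\<^esub> e m"

lemma smult_zero_left: "x \<in> carrier M \<Longrightarrow> 0 \<odot>\<^bsub>M\<^esub> x = \<zero>\<^bsub>M\<^esub>"
  using smult_l_null[of x] by (simp add: class_ring_simps)

lemma smult_add_left: "x \<in> carrier M \<Longrightarrow> (a + b) \<odot>\<^bsub>M\<^esub> x = a \<odot>\<^bsub>M\<^esub> x \<oplus>\<^bsub>M\<^esub> b \<odot>\<^bsub>M\<^esub> x"
  using smult_l_distr[of a b x] by (simp add: class_ring_simps)

lemma smult_mult: "x \<in> carrier M \<Longrightarrow> (a * b) \<odot>\<^bsub>M\<^esub> x = a \<odot>\<^bsub>M\<^esub> (b \<odot>\<^bsub>M\<^esub> x)"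
  using smult_assoc1[of a b x] by (simp add: class_ring_simps)

lemma smult_carrier: "x \<in> carrier M \<Longrightarrow> a \<odot>\<^bsub>M\<^esub> x \<in> carrier M"
  by (intro smult_closed) (simp_all add: class_ring_simps)

lemma smult_add_right: "x \<in> carrier M \<Longrightarrow> y \<in> carrier M \<Longrightarrow> a \<odot>\<^bsub>M\<^esub> (x \<oplus>\<^bsub>M\<^esub> y) = a \<odot>\<^bsub>M\<^esub> x \<oplus>\<^bsub>M\<^esub> a \<odot>\<^bsub>M\<^esub> y"
  by (intro smult_r_distr) (simp_all add: class_ring_simps)

lemma smult_zero_right: "a \<odot>\<^bsub>M\<^esub> \<zero>\<^bsub>M\<^esub> = \<zero>\<^bsub>M\<^esub>"
  by (intro smult_r_null) (simp_all add: class_ring_simps)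

lemma comb_mem:
  assumes "i \<le> k" "\<And>a. a < m \<Longrightarrow> e a \<in> carrier M" "\<And>a. a < m \<Longrightarrow> v a = 0 \<or> e a \<in> S i"
  shows "comb e v m \<in> S i"
  using assms(2,3)
proof (induction m)
  case 0
  show ?case using S_closed(1)[OF assms(1)] by simp
next
  case (Suc m)
  have "v m \<odot>\<^bsub>M\<^esub> e m \<in> S i"
    using Suc.prems(1)[of m] Suc.prems(2)[of m] S_closed[OF assms(1)] by (auto simp: smult_zero_left)
  moreover have "comb e v m \<in> S i" using Suc by simp
  ultimately show ?case using S_closed(2)[OF assms(1)] by simp
qed

lemma comb_carrier: "(\<And>a. a < m \<Longrightarrow> e a \<in> carrier M) \<Longrightarrow> comb e v m \<in> carrier M"
  using comb_mem[of k m e v] by (simp add: S_k)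

lemma comb_cong:
  "(\<And>a. a < m \<Longrightarrow> e a = e' a) \<Longrightarrow> (\<And>a. a < m \<Longrightarrow> v a = v' a) \<Longrightarrow> comb e v m = comb e' v' m"
  by (induction m) auto

lemma comb_add:
  "(\<And>a. a < m \<Longrightarrow> e a \<in> carrier M) \<Longrightarrow> comb e (\<lambda>a. v a + w a) m = comb e v m \<oplus>\<^bsub>M\<^esub> comb e w m"
proof (induction m)
  case (Suc m)
  have c: "comb e v m \<in> carrier M" "comb e w m \<in> carrier M" "e m \<in> carrier M"
    using Suc.prems by (auto intro!: comb_carrier)
  then show ?case using Suc by (simp add: smult_add_left smult_carrier M.a_ac)
qed simp

lemma comb_smult:
  "(\<And>a. a < m \<Longrightarrow> e a \<in> carrier M) \<Longrightarrow> comb e (\<lambda>a. c * v a) m = c \<odot>\<^bsub>M\<^esub> comb e v m"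
proof (induction m)
  case (Suc m)
  have c: "comb e v m \<in> carrier M" "e m \<in> carrier M"
    using Suc.prems by (auto intro!: comb_carrier)
  then show ?case using Suc by (simp add: smult_mult smult_carrier smult_add_right)
qed (simp add: smult_zero_right)

lemma comb_zero: "(\<And>a. a < m \<Longrightarrow> e a \<in> carrier M) \<Longrightarrow> comb e (\<lambda>a. 0) m = \<zero>\<^bsub>M\<^esub>"
  using comb_smult[of m e 0 "\<lambda>_. 0"] comb_carrier[of m e] by (simp add: smult_zero_left)

lemma comb_Phi:
  assumes "q \<noteq> 0"
  shows "(\<And>a. a < m \<Longrightarrow> e a \<in> carrier M) \<Longrightarrow>
    Phi M (comb e v m) = comb (\<lambda>a. Phi M (e a)) (\<lambda>a. sigma_q q (v a)) m"
proof (induction m)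
  case 0
  have "Phi M \<zero>\<^bsub>M\<^esub> \<in> carrier M" using Phi_bij by (auto simp: bij_betw_def)
  then show ?case
    using Phi_smult[of "\<zero>\<^bsub>M\<^esub>" 0] assms by (simp add: smult_zero_left)
next
  case (Suc m)
  have c: "comb e v m \<in> carrier M" "e m \<in> carrier M"
    using Suc.prems by (auto intro!: comb_carrier)
  then show ?case using Suc by (simp add: Phi_add Phi_smult smult_carrier)
qed

lemma comb_comb:
  assumes "\<And>a. a < n \<Longrightarrow> e a \<in> carrier M"
  shows "comb e (\<lambda>a. \<Sum>b<m. C a b * y b) n = comb (\<lambda>b. comb e (\<lambda>a. C a b) n) y m"
proof (induction m)
  case 0
  show ?case using comb_zero[OF assms] by simp
next
  case (Suc m)
  have "comb e (\<lambda>a. \<Sum>b<Suc m. C a b * y b) n = comb e (\<lambda>a. (\<Sum>b<m. C a b * y b) + y m * C a m) n"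
    by (intro comb_cong) (simp_all add: mult.commute)
  then show ?case using Suc assms by (simp add: comb_add comb_smult)
qed

end

section \<open>Equivalences between the modules M_U as gauge transformations\<close>

context slope_data
begin

text \<open>Goes back from global indices to a family of blocks; the restricted abstraction supplies
  the default value that membership in \<open>block_params\<close> demands elsewhere.\<close>

definition unflat :: "(nat \<Rightarrow> nat \<Rightarrow> conv_laurent) \<Rightarrow> nat \<times> nat \<Rightarrow> conv_laurent mat" where
  "unflat X = (\<lambda>p\<in>{(i, j). 1 \<le> i \<and> i < j \<and> j \<le> k}.
     mat (r (fst p)) (r (snd p)) (\<lambda>(\<alpha>, \<beta>). X (st (fst p) + \<alpha>) (st (snd p) + \<beta>)))"

lemma flat_unflat:
  assumes "a < n" "b < n" "bi a < bi b"
  shows "flat (unflat X) a b = X a b"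
  using assms block_index_bounds[OF assms(1)] block_index_bounds[OF assms(2)]
    offset_less[OF assms(1)] offset_less[OF assms(2)]
  by (simp add: flat_def unflat_def)

lemma tri_unflat: "a < n \<Longrightarrow> b < n \<Longrightarrow> tri D (flat (unflat X)) a b = tri D X a b"
  by (simp add: tri_def flat_unflat)

text \<open>Multiplication by the block unipotent matrix is the morphism: the gauge equation is its
  compatibility with \<Phi>, triangularity preserves the filtration, and the unit diagonal blocks
  preserve the symbols.\<close>

lemma gauge_equiv:
  assumes gauge: "\<And>a b. a < n \<Longrightarrow> b < n \<Longrightarrow>
    (\<Sum>c<n. sigma_q q (tri unit_entry F a c) * tri D (flat V) c b) = (\<Sum>c<n. tri D (flat U) a c * tri unit_entry F c b)"
  shows "filt_equiv k (MF V) (MF U)"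
proof -
  interpret filt_pair q k PP "MF V" "MF U"
    by (rule filt_pairI) (rule filtered_MF)+
  define G where "G = tri unit_entry F"
  define h where "h x = vec n (\<lambda>a. \<Sum>b<n. G a b * x $ b)" for x :: "conv_laurent vec"
  have h_carrier: "h x \<in> carrier_vec n" for x by (simp add: h_def)
  have "filt_morph k (MF V) (MF U) h"
    unfolding filt_morph_def qdiff_hom_iff MF_sel std_qdiff_sel
  proof (intro conjI ballI allI impI h_carrier)
    fix x y :: "conv_laurent vec" and s assume x: "x \<in> carrier_vec n"
    show "h (s \<cdot>\<^sub>v x) = s \<cdot>\<^sub>v h x"
      using x by (intro eq_vecI) (simp_all add: h_def sum_distrib_left mult_ac)
    define y where "y = Phi (std_qdiff q n (AM V)) x"
    have y: "y \<in> carrier_vec n" unfolding y_def by (rule std_Phi_closed[OF AM_GL x])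
    have ye: "(\<Sum>b<n. tri D (flat V) a b * y $ b) = sigma_q q (x $ a)" if "a < n" for a
    proof -
      have "(AM V *\<^sub>v y) $ a = map_vec (sigma_q q) x $ a"
        unfolding y_def using std_Phi_eq[OF AM_GL x] by simp
      then show ?thesis using that x y by (simp add: AM_mult_nth)
    qed
    \<comment> \<open>With A_V y = sigma_q(x) the gauge equation gives A_U G y = sigma_q(G) A_V y =
      sigma_q(G) sigma_q(x) = sigma_q(G x).\<close>
    have "AM U *\<^sub>v h y = map_vec (sigma_q q) (h x)"
    proof (rule eq_vecI)
      show "dim_vec (AM U *\<^sub>v h y) = dim_vec (map_vec (sigma_q q) (h x))"
        using carrier_matD(1)[OF AM_carrier[of U]] by (simp add: h_def)
      fix a assume "a < dim_vec (map_vec (sigma_q q) (h x))"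
      then have a: "a < n" by (simp add: h_def)
      have "(AM U *\<^sub>v h y) $ a = (\<Sum>c<n. tri D (flat U) a c * (\<Sum>b<n. G c b * y $ b))"
        using a h_carrier by (simp add: AM_mult_nth) (simp add: h_def)
      also have "\<dots> = (\<Sum>c<n. \<Sum>b<n. tri D (flat U) a c * G c b * y $ b)"
        by (simp add: sum_distrib_left mult.assoc)
      also have "\<dots> = (\<Sum>b<n. (\<Sum>c<n. tri D (flat U) a c * G c b) * y $ b)"
        by (subst sum.swap) (simp add: sum_distrib_right)
      also have "\<dots> = (\<Sum>b<n. (\<Sum>c<n. sigma_q q (G a c) * tri D (flat V) c b) * y $ b)"
        using gauge[OF a] by (intro sum.cong) (simp_all add: G_def)
      also have "\<dots> = (\<Sum>b<n. \<Sum>c<n. sigma_q q (G a c) * (tri D (flat V) c b * y $ b))"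
        by (simp add: sum_distrib_right mult.assoc)
      also have "\<dots> = (\<Sum>c<n. sigma_q q (G a c) * (\<Sum>b<n. tri D (flat V) c b * y $ b))"
        by (subst sum.swap) (simp add: sum_distrib_left)
      also have "\<dots> = map_vec (sigma_q q) (h x) $ a"
        using a q0 by (simp add: ye h_def)
      finally show "(AM U *\<^sub>v h y) $ a = map_vec (sigma_q q) (h x) $ a" .
    qed
    then show "h (Phi (std_qdiff q n (AM V)) x) = Phi (std_qdiff q n (AM U)) (h x)"
      using std_Phi_iff[OF AM_GL h_carrier h_carrier, of q U x y] unfolding y_def by simp
  next
    fix x y :: "conv_laurent vec" assume "x \<in> carrier_vec n" "y \<in> carrier_vec n"
    then show "h (x + y) = h x + h y"
      by (intro eq_vecI) (simp_all add: h_def algebra_simps sum.distrib)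
  next
    show "h ` FS i \<subseteq> FS i" for i
      by (auto simp: FS_def h_def G_def tri_def intro!: sum.neutral)
    fix i x assume i: "i \<in> {1..k}" and x: "x \<in> FS i"
    have hx: "h x \<in> FS i" using x
      by (auto simp: FS_def h_def G_def tri_def intro!: sum.neutral)
    have "proj i (h x) = proj i x"
    proof (rule eq_vecI)
      fix \<alpha> assume "\<alpha> < dim_vec (proj i x)"
      then have \<alpha>: "\<alpha> < r i" by (simp add: proj_def)
      then have "h x $ (st i + \<alpha>) = (\<Sum>b\<in>blk i. unit_entry (st i + \<alpha>) b * x $ b)"
        unfolding h_def G_def using i x tri_row[of "st i + \<alpha>" "\<lambda>b. x $ b" unit_entry F]
        by (simp add: FS_def)
      also have "\<dots> = x $ (st i + \<alpha>)"
        using sum_unit_left[of "st i + \<alpha>" "\<lambda>b. x $ b"] i \<alpha> by simp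
      finally show "proj i (h x) $ \<alpha> = proj i x $ \<alpha>" using \<alpha> by (simp add: proj_def)
    qed (simp add: proj_def)
    then show "symb (MF U) i (h x) = symb (MF V) i x"
      using i x hx by (simp add: symb_MF)
  qed
  then show ?thesis unfolding filt_equiv_iff by blast
qed

text \<open>The matrix of the morphism in the standard basis has the form
  \<open>tri unit_entry F\<close>: preservation of the filtration makes it vanish below the
  diagonal, and equality of symbols makes the diagonal blocks identities.\<close>

lemma equiv_gauge:
  assumes "filt_equiv k (MF U) (MF U')"
  shows "\<exists>F. \<forall>a<n. \<forall>b<n. (\<Sum>c<n. sigma_q q (tri unit_entry F a c) * tri D (flat U) c b)
    = (\<Sum>c<n. tri D (flat U') a c * tri unit_entry F c b)"
proof -
  interpret filt_pair q k PP "MF U" "MF U'"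
    by (rule filt_pairI) (rule filtered_MF)+
  obtain f where f: "filt_morph k (MF U) (MF U') f"
    using assms unfolding filt_equiv_iff by blast
  have hom: "f \<in> qdiff_hom (std_qdiff q n (AM U)) (std_qdiff q n (AM U'))"
    using f by (simp add: filt_morph_def)
  have fc: "\<And>x. x \<in> carrier_vec n \<Longrightarrow> f x \<in> carrier_vec n"
    and fadd: "\<And>x y. x \<in> carrier_vec n \<Longrightarrow> y \<in> carrier_vec n \<Longrightarrow> f (x + y) = f x + f y"
    and fsmult: "\<And>a x. x \<in> carrier_vec n \<Longrightarrow> f (a \<cdot>\<^sub>v x) = a \<cdot>\<^sub>v f x"
    and fPhi: "\<And>x. x \<in> carrier_vec n \<Longrightarrow> f (Phi (std_qdiff q n (AM U)) x) = Phi (std_qdiff q n (AM U')) (f x)"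
    using hom unfolding qdiff_hom_iff std_qdiff_sel by blast+
  have fzero: "f (0\<^sub>v n) = 0\<^sub>v n" using hom_zero[of f] hom by simp
  define F where "F a b = f (unit_vec n b) $ a" for a b
  have f_nth: "f x $ a = (\<Sum>b<n. F a b * x $ b)" if x: "x \<in> carrier_vec n" and a: "a < n" for x a
  proof -
    \<comment> \<open>Truncations of \<open>x\<close>, so that linearity is used one coordinate at a
      time.\<close>
    define p where "p m = vec n (\<lambda>a. if a < m then x $ a else 0)" for m
    have pc: "p m \<in> carrier_vec n" for m by (simp add: p_def)
    have "f (p m) $ a = (\<Sum>b<m. F a b * x $ b)" if "m \<le> n" for m
      using that
    proof (induction m)
      case 0
      have "p 0 = 0\<^sub>v n" by (intro eq_vecI) (auto simp: p_def)
      then show ?case using fzero a by simp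
    next
      case (Suc m)
      have "p (Suc m) = p m + x $ m \<cdot>\<^sub>v unit_vec n m"
        using Suc.prems by (intro eq_vecI) (auto simp: p_def less_Suc_eq)
      then have "f (p (Suc m)) = f (p m) + x $ m \<cdot>\<^sub>v f (unit_vec n m)"
        using fadd[OF pc] fsmult by simp
      then have "f (p (Suc m)) $ a = f (p m) $ a + x $ m * F a m"
        using a fc[of "unit_vec n m"] fc[OF pc] by (simp add: F_def)
      then show ?case using Suc by simp
    qed
    moreover have "p n = x" using x by (intro eq_vecI) (auto simp: p_def)
    ultimately show ?thesis by auto
  qed
  have tri_F: "tri unit_entry F a b = F a b" if "a < n" "b < n" for a b
  proof -
    have b: "bi b \<in> {1..k}" using block_index_bounds that by blast
    have u: "unit_vec n b \<in> FS (bi b)" using that by (auto simp: FS_def)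
    have fu: "f (unit_vec n b) \<in> FS (bi b)"
      using f u b unfolding filt_morph_def MF_sel by auto
    have "symb (MF U') (bi b) (f (unit_vec n b)) = symb (MF U) (bi b) (unit_vec n b)"
      using f b u unfolding filt_morph_def MF_sel by blast
    then have pr: "proj (bi b) (f (unit_vec n b)) = proj (bi b) (unit_vec n b)"
      using symb_MF[OF b] u fu by simp
    consider "bi a < bi b" | "bi a = bi b" | "bi a > bi b" by linarith
    then show ?thesis
    proof cases
      case 2
      then have "proj (bi b) (f (unit_vec n b)) $ (a - st (bi b)) = unit_vec n b $ a"
        unfolding pr using offset_less[OF that(1)] block_index_bounds(2)[OF that(1)] by (simp add: proj_def)
      then show ?thesis
        using 2 that offset_less[OF that(1)] block_index_bounds(2)[OF that(1)]
        by (simp add: proj_def tri_def unit_entry_def F_def)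
    next
      case 3
      then show ?thesis using fu that by (simp add: tri_def F_def FS_def)
    qed (simp add: tri_def)
  qed
  have "(\<Sum>c<n. sigma_q q (F a c) * tri D (flat U) c b) = (\<Sum>c<n. tri D (flat U') a c * F c b)"
    if a: "a < n" and b: "b < n" for a b
  proof -
    have uc: "unit_vec n b \<in> carrier_vec n" by simp
    \<comment> \<open>For \<open>x\<close> mapped by \<Phi> to the unit vector, sigma_q(x) is column
      \<open>b\<close> of A_U, so commutation with \<Phi> yields column \<open>b\<close> of the
      gauge equation.\<close>
    obtain x where x: "x \<in> carrier_vec n" "Phi (std_qdiff q n (AM U)) x = unit_vec n b"
      using std_Phi_bij[OF AM_GL q0] uc unfolding bij_betw_def by (metis imageE)
    then have e: "AM U *\<^sub>v unit_vec n b = map_vec (sigma_q q) x"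
      using std_Phi_iff[OF AM_GL x(1) uc] by blast
    have sx: "sigma_q q (x $ c) = tri D (flat U) c b" if "c < n" for c
    proof -
      have "sigma_q q (x $ c) = (AM U *\<^sub>v unit_vec n b) $ c"
        unfolding e using x(1) that by simp
      also have "\<dots> = (\<Sum>d<n. tri D (flat U) c d * unit_vec n b $ d)"
        using that by (simp add: AM_mult_nth)
      also have "\<dots> = tri D (flat U) c b"
        using b by (simp add: unit_vec_def if_distrib[of "\<lambda>x. _ * x"] cong: if_cong)
      finally show ?thesis .
    qed
    have "Phi (std_qdiff q n (AM U')) (f x) = f (unit_vec n b)"
      using fPhi[OF x(1)] x(2) by simp
    then have "AM U' *\<^sub>v f (unit_vec n b) = map_vec (sigma_q q) (f x)"
      using std_Phi_iff[OF AM_GL fc[OF x(1)] fc[OF uc]] by blast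
    then have "(AM U' *\<^sub>v f (unit_vec n b)) $ a = map_vec (sigma_q q) (f x) $ a" by simp
    then have "(\<Sum>c<n. tri D (flat U') a c * F c b) = sigma_q q (f x $ a)"
      using a fc[OF uc] fc[OF x(1)] by (simp add: AM_mult_nth F_def)
    also have "\<dots> = (\<Sum>c<n. sigma_q q (F a c) * tri D (flat U) c b)"
      using f_nth[OF x(1) a] q0 sx by simp
    finally show ?thesis by simp
  qed
  then show ?thesis by (intro exI[of _ F]) (simp add: tri_F)
qed

end

context slope_data
begin

text \<open>Lifting the standard bases of the graded pieces gives a basis \<open>e\<close> of \<open>X\<close> adapted to the
  filtration; its matrix \<open>C\<close> is defined by \<open>e\<^sub>b = \<Sum>\<^sub>a C\<^sub>a\<^sub>b \<Phi>(e\<^sub>a)\<close>.\<close>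

lemma exists_matrix_form:
  fixes X :: "('e, conv_laurent vec) filt_qdiff"
  assumes X: "filtered q k PP X"
  shows "\<exists>V. filt_equiv k (MF V) X"
proof -
  interpret X: filtered_module q k PP X by (rule filtered_module.intro) fact
  have PP_sel [simp]: "carrier (PP i) = carrier_vec (r i)" "add (PP i) = (+)" "smult (PP i) = (\<cdot>\<^sub>v)" for i
    by (simp_all add: pure_piece_def)
  have bk: "bi a \<in> {1..k}" "bi a \<le> k" if "a < n" for a
    using block_index_bounds(1)[OF that] by auto
  have "\<forall>a\<in>{..<n}. \<exists>x. x \<in> X.S (bi a) \<and> symb X (bi a) x = unit_vec (r (bi a)) (a - st (bi a))"
  proof
    fix a assume "a \<in> {..<n}"
    then have "unit_vec (r (bi a)) (a - st (bi a)) \<in> symb X (bi a) ` X.S (bi a)"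
      using X.symb_image[OF bk(1)] by simp
    then show "\<exists>x. x \<in> X.S (bi a) \<and> symb X (bi a) x = unit_vec (r (bi a)) (a - st (bi a))" by force
  qed
  then obtain e where e: "\<And>a. a < n \<Longrightarrow> e a \<in> X.S (bi a)"
      "\<And>a. a < n \<Longrightarrow> symb X (bi a) (e a) = unit_vec (r (bi a)) (a - st (bi a))"
    unfolding Bex_def by (metis lessThan_iff bchoice)
  have ec: "e a \<in> carrier X.M" if "a < n" for a
    using e(1)[OF that] X.S_carrier[OF bk(2)[OF that]] by blast
  have eS: "e a \<in> X.S i" if "a < n" "bi a \<le> i" "i \<le> k" for a i
    using e(1)[OF that(1)] X.S_mono[OF that(2,3)] by blast
  have symb_zero: "symb X i y = 0\<^sub>v (r i)" if i: "i \<in> {1..k}" and y: "y \<in> X.S (i - 1)" for i y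
  proof -
    have ik: "i \<le> k" "i - 1 \<le> k" using i by auto
    have yS: "y \<in> X.S i" using y X.S_mono_1[OF i] by blast
    have zS: "\<zero>\<^bsub>X.M\<^esub> \<in> X.S i" by (rule X.S_closed(1)[OF ik(1)])
    have "symb X i y = symb X i \<zero>\<^bsub>X.M\<^esub>"
      using X.symb_eq_iff[OF i yS zS] X.S_minus[OF ik(2) y X.S_closed(1)[OF ik(2)]] by simp
    also have "\<dots> = symb X i (0 \<odot>\<^bsub>X.M\<^esub> y)"
      using X.smult_zero_left X.S_carrier[OF ik(1)] yS by auto
    also have "\<dots> = 0 \<cdot>\<^sub>v symb X i y" using X.symb_smult[OF i yS, of 0] by simp
    also have "\<dots> = 0\<^sub>v (r i)"
    proof -
      have "symb X i y \<in> carrier_vec (r i)" using X.symb_image[OF i] yS by auto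
      then show ?thesis by auto
    qed
    finally show ?thesis .
  qed
  have comb_S: "X.comb e v m \<in> X.S i" if "i \<le> k" "m \<le> n" "\<And>a. a < m \<Longrightarrow> i < bi a \<Longrightarrow> v a = 0" for v m i
  proof (rule X.comb_mem[OF that(1)])
    fix a assume a: "a < m"
    show "e a \<in> carrier X.M" using ec a that(2) by simp
    show "v a = 0 \<or> e a \<in> X.S i" using that(3)[OF a] eS[of a i] a that(1,2) by force
  qed
  \<comment> \<open>Stated for partial sums to allow induction on \<open>m\<close>: blocks before
    \<open>i\<close> contribute symbol zero, those after \<open>i\<close> have coefficient zero, and
    block \<open>i\<close> supplies its own coordinates.\<close>
  have symb_comb: "symb X i (X.comb e v m) = vec (r i) (\<lambda>\<alpha>. if st i + \<alpha> < m then v (st i + \<alpha>) else 0)"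
    if i: "i \<in> {1..k}" and "m \<le> n" "\<And>a. a < m \<Longrightarrow> i < bi a \<Longrightarrow> v a = 0" for v m i
    using that(2,3)
  proof (induction m)
    case 0
    have "\<zero>\<^bsub>X.M\<^esub> \<in> X.S (i - 1)" using i by (intro X.S_closed(1)) auto
    then have "symb X i \<zero>\<^bsub>X.M\<^esub> = 0\<^sub>v (r i)" by (rule symb_zero[OF i])
    then show ?case by auto
  next
    case (Suc m)
    have ik: "i \<le> k" using i by simp
    have m: "m < n" using Suc.prems by simp
    have IH: "symb X i (X.comb e v m) = vec (r i) (\<lambda>\<alpha>. if st i + \<alpha> < m then v (st i + \<alpha>) else 0)"
      using Suc by simp
    have cS: "X.comb e v m \<in> X.S i" using Suc.prems ik by (intro comb_S) auto
    have ne: "st i + \<alpha> \<noteq> m" if "bi m \<noteq> i" "\<alpha> < r i" for \<alpha>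
      using bi_offset[OF i that(2)] that(1) by auto
    show ?case
    proof (cases "i < bi m")
      case True
      then have "v m = 0" using Suc.prems by simp
      then have c1: "X.comb e v (Suc m) = X.comb e v m"
        using X.smult_zero_left[OF ec[OF m]] X.S_carrier[OF ik] cS by auto
      show ?thesis
        unfolding c1 IH using ne True by (intro eq_vecI) (auto simp: less_Suc_eq)
    next
      case False
      then have eS': "e m \<in> X.S i" using eS[OF m _ ik] by simp
      have sS: "v m \<odot>\<^bsub>X.M\<^esub> e m \<in> X.S i" using X.S_closed(3)[OF ik eS'] .
      have "symb X i (X.comb e v (Suc m)) = symb X i (X.comb e v m) + v m \<cdot>\<^sub>v symb X i (e m)"
        using X.symb_add[OF i cS sS] X.symb_smult[OF i eS'] by simp
      also have "\<dots> = vec (r i) (\<lambda>\<alpha>. if st i + \<alpha> < Suc m then v (st i + \<alpha>) else 0)"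
      proof (cases "bi m = i")
        case True
        have "symb X i (e m) = unit_vec (r i) (m - st i)" using e(2)[OF m] True by simp
        moreover have "st i \<le> m" using block_index_bounds(2)[OF m] True by simp
        ultimately show ?thesis
          unfolding IH by (intro eq_vecI) (auto simp: less_Suc_eq unit_vec_def)
      next
        case False
        then have "e m \<in> X.S (i - 1)"
          using \<open>\<not> i < bi m\<close> ik by (intro eS[OF m]) auto
        then have "symb X i (e m) = 0\<^sub>v (r i)" by (rule symb_zero[OF i])
        then show ?thesis
          unfolding IH using ne False by (intro eq_vecI) (auto simp: less_Suc_eq)
      qed
      finally show ?thesis .
    qed
  qed
  \<comment> \<open>Descent along the filtration: subtracting a combination with the same symbol
    moves \<open>x\<close> into the previous step. The bijectivity of the morphism \<open>g\<close>
    built from \<open>e\<close> comes from \<open>filt_morph_bij\<close>.\<close>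
  have spanning: "\<exists>v. (\<forall>a<n. i < bi a \<longrightarrow> v a = 0) \<and> x = X.comb e v n" if "i \<le> k" "x \<in> X.S i" for i x
    using that
  proof (induction i arbitrary: x)
    case 0
    then have "x = X.comb e (\<lambda>_. 0) n" using X.comb_zero[OF ec] X.S_0 by simp
    then show ?case by (intro exI[of _ "\<lambda>_. 0"] conjI allI impI refl) assumption
  next
    case (Suc i)
    have i: "Suc i \<in> {1..k}" "i \<le> k" using Suc.prems by auto
    define w where "w = symb X (Suc i) x"
    have wc: "w \<in> carrier_vec (r (Suc i))"
      using X.symb_image[OF i(1)] Suc.prems(2) by (auto simp: w_def)
    define v1 where "v1 a = (if bi a = Suc i then w $ (a - st (Suc i)) else 0)" for a
    have y: "X.comb e v1 n \<in> X.S (Suc i)" using Suc.prems by (intro comb_S) (auto simp: v1_def)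
    have "symb X (Suc i) (X.comb e v1 n) = w"
    proof -
      have "symb X (Suc i) (X.comb e v1 n) =
          vec (r (Suc i)) (\<lambda>\<alpha>. if st (Suc i) + \<alpha> < n then v1 (st (Suc i) + \<alpha>) else 0)"
        by (rule symb_comb[OF i(1)]) (auto simp: v1_def)
      also have "\<dots> = w"
        using wc n_offset[OF i(1)] bi_offset[OF i(1)] by (intro eq_vecI) (auto simp: v1_def)
      finally show ?thesis .
    qed
    then have "x \<ominus>\<^bsub>X.M\<^esub> X.comb e v1 n \<in> X.S i"
      using X.symb_eq_iff[OF i(1) Suc.prems(2) y] by (simp add: w_def)
    from Suc.IH[OF i(2) this] obtain v2 where v2: "\<forall>a<n. i < bi a \<longrightarrow> v2 a = 0"
      "x \<ominus>\<^bsub>X.M\<^esub> X.comb e v1 n = X.comb e v2 n" by blast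
    have "x = X.comb e v2 n \<oplus>\<^bsub>X.M\<^esub> X.comb e v1 n"
      unfolding v2(2)[symmetric]
      using X.S_carrier[OF Suc.prems(1)] Suc.prems(2) y by (intro X.minus_add_cancel[symmetric]) auto
    also have "\<dots> = X.comb e (\<lambda>a. v2 a + v1 a) n" using X.comb_add[OF ec] by simp
    finally show ?case using v2(1) by (intro exI[of _ "\<lambda>a. v2 a + v1 a"]) (auto simp: v1_def)
  qed
  \<comment> \<open>Coordinates of the preimage of \<open>e b\<close> under \<Phi>, taken in step
    \<open>bi b\<close> to make them triangular. Semilinearity turns them into the entries
    \<open>sigma_q q (u b a)\<close> of the matrix C.\<close>
  have "\<forall>b\<in>{..<n}. \<exists>u. (\<forall>a<n. bi b < bi a \<longrightarrow> u a = 0) \<and> e b = Phi X.M (X.comb e u n)"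
  proof
    fix b assume "b \<in> {..<n}"
    then have b: "b < n" by simp
    obtain x where x: "x \<in> X.S (bi b)" "e b = Phi X.M x"
      using e(1)[OF b] X.Phi_S[OF bk(2)[OF b]] by blast
    obtain u where "\<forall>a<n. bi b < bi a \<longrightarrow> u a = 0" "x = X.comb e u n"
      using spanning[OF bk(2)[OF b] x(1)] by blast
    then show "\<exists>u. (\<forall>a<n. bi b < bi a \<longrightarrow> u a = 0) \<and> e b = Phi X.M (X.comb e u n)"
      using x(2) by blast
  qed
  from bchoice[OF this] obtain u where u: "\<And>a b. b < n \<Longrightarrow> a < n \<Longrightarrow> bi b < bi a \<Longrightarrow> u b a = 0"
      "\<And>b. b < n \<Longrightarrow> e b = Phi X.M (X.comb e (u b) n)"
    by (auto simp: Ball_def)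
  \<comment> \<open>The diagonal blocks are forced: taking symbols turns the relation for
    \<open>e b\<close> into the one for a unit vector in the pure piece.\<close>
  have u_diag: "sigma_q q (u b a) = D a b" if a: "a < n" and b: "b < n" and eq: "bi a = bi b" for a b
  proof -
    let ?j = "bi b"
    have j: "?j \<in> {1..k}" using bk b by blast
    have ab: "a \<in> blk ?j" using a eq by (simp add: blk_def)
    define p where "p = vec (r ?j) (\<lambda>\<alpha>. u b (st ?j + \<alpha>))"
    have pc: "p \<in> carrier_vec (r ?j)" by (simp add: p_def)
    have "X.comb e (u b) n \<in> X.S ?j" using u(1)[OF b] j by (intro comb_S) auto
    then have "symb X ?j (e b) = Phi (PP ?j) (symb X ?j (X.comb e (u b) n))"
      using X.symb_Phi[OF j] u(2)[OF b] by simp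
    moreover have "symb X ?j (X.comb e (u b) n) = p"
    proof -
      have "symb X ?j (X.comb e (u b) n) = vec (r ?j) (\<lambda>\<alpha>. if st ?j + \<alpha> < n then u b (st ?j + \<alpha>) else 0)"
        using u(1)[OF b] by (intro symb_comb[OF j]) auto
      then show ?thesis using n_offset[OF j] by (auto simp: p_def)
    qed
    ultimately have "Phi (std_qdiff q (r ?j) (diag_block \<mu> A ?j)) p = unit_vec (r ?j) (b - st ?j)"
      using e(2)[OF b] by (simp add: pure_piece_def)
    then have "diag_block \<mu> A ?j *\<^sub>v unit_vec (r ?j) (b - st ?j) = map_vec (sigma_q q) p"
      using std_Phi_iff[OF diag_block_GL[OF j] pc] by simp
    then have "(diag_block \<mu> A ?j *\<^sub>v unit_vec (r ?j) (b - st ?j)) $ (a - st ?j) = sigma_q q (u b a)"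
      using pc offset_less[OF a] block_index_bounds(2)[OF a] eq by (simp add: p_def)
    moreover have "(diag_block \<mu> A ?j *\<^sub>v unit_vec (r ?j) (b - st ?j)) $ (a - st ?j)
        = (\<Sum>c\<in>blk ?j. D a c * unit_vec (r ?j) (b - st ?j) $ (c - st ?j))"
      by (rule diag_block_mult_nth[OF j _ ab]) simp
    moreover have "\<dots> = (\<Sum>c\<in>blk ?j. D a c * unit_entry c b)"
    proof (rule sum.cong[OF refl])
      fix c assume "c \<in> blk ?j"
      then have c: "c < n" "bi c = ?j" by (auto simp: blk_def)
      have "c - st ?j = b - st ?j \<longleftrightarrow> c = b"
        using block_index_bounds(2)[OF c(1)] block_index_bounds(2)[OF b] c(2) by auto
      then show "D a c * unit_vec (r ?j) (b - st ?j) $ (c - st ?j) = D a c * unit_entry c b"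
        using offset_less[OF c(1)] c(2) offset_less[OF b] by (simp add: unit_entry_def)
    qed
    moreover have "\<dots> = D a b" by (rule sum_unit_right[OF b])
    ultimately show ?thesis by simp
  qed
  define V where "V = unflat (\<lambda>a b. sigma_q q (u b a))"
  have V: "tri D (flat V) a b = sigma_q q (u b a)" if "a < n" "b < n" for a b
    using that u_diag u(1) q0 by (auto simp: V_def tri_unflat) (auto simp: tri_def)
  interpret VX: filt_pair q k PP "MF V" X
    by (rule filt_pairI) (rule filtered_MF, rule X)
  define g where "g x = X.comb e (\<lambda>a. x $ a) n" for x :: "conv_laurent vec"
  have PhiS: "Phi X.M (e a) \<in> carrier X.M" if "a < n" for a
    using X.Phi_bij ec[OF that] by (auto simp: bij_betw_def)
  have "filt_morph k (MF V) X g"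
    unfolding filt_morph_def qdiff_hom_iff MF_sel std_qdiff_sel
  proof (intro conjI ballI allI impI)
    fix x y :: "conv_laurent vec" and s assume x: "x \<in> carrier_vec n"
    show "g x \<in> carrier X.M" unfolding g_def by (rule X.comb_carrier[OF ec])
    show "g (s \<cdot>\<^sub>v x) = s \<odot>\<^bsub>X.M\<^esub> g x"
    proof -
      have "g (s \<cdot>\<^sub>v x) = X.comb e (\<lambda>a. s * x $ a) n"
        unfolding g_def using x by (intro X.comb_cong) auto
      then show ?thesis unfolding g_def by (simp add: X.comb_smult[OF ec])
    qed
    define y where "y = Phi (std_qdiff q n (AM V)) x"
    have y: "y \<in> carrier_vec n" unfolding y_def by (rule std_Phi_closed[OF AM_GL x])
    have ye: "sigma_q q (x $ a) = (\<Sum>b<n. sigma_q q (u b a) * y $ b)" if a: "a < n" for a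
    proof -
      have "(AM V *\<^sub>v y) $ a = map_vec (sigma_q q) x $ a"
        unfolding y_def using std_Phi_eq[OF AM_GL x] by simp
      then show ?thesis using a x y by (simp add: AM_mult_nth V)
    qed
    \<comment> \<open>Since C y = sigma_q(x), the coordinates with respect to the vectors
      \<open>Phi X.M (e a)\<close> are C y; regrouping by columns of C gives the combination of the
      \<open>e b\<close> with coordinates \<open>y\<close>.\<close>
    have "Phi X.M (g x) = X.comb (\<lambda>a. Phi X.M (e a)) (\<lambda>a. sigma_q q (x $ a)) n"
      unfolding g_def by (rule X.comb_Phi[OF q0 ec])
    also have "\<dots> = X.comb (\<lambda>a. Phi X.M (e a)) (\<lambda>a. \<Sum>b<n. sigma_q q (u b a) * y $ b) n"
      by (intro X.comb_cong refl ye)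
    also have "\<dots> = X.comb (\<lambda>b. X.comb (\<lambda>a. Phi X.M (e a)) (\<lambda>a. sigma_q q (u b a)) n) (\<lambda>b. y $ b) n"
      by (rule X.comb_comb[OF PhiS])
    also have "\<dots> = g y"
      unfolding g_def
    proof (intro X.comb_cong refl)
      fix b assume b: "b < n"
      show "X.comb (\<lambda>a. Phi X.M (e a)) (\<lambda>a. sigma_q q (u b a)) n = e b"
        using X.comb_Phi[OF q0 ec, where v = "u b" and m = n] u(2)[OF b] by simp
    qed
    finally show "g (Phi (std_qdiff q n (AM V)) x) = Phi X.M (g x)" by (simp add: y_def)
  next
    fix x y :: "conv_laurent vec" assume xy: "x \<in> carrier_vec n" "y \<in> carrier_vec n"
    have "g (x + y) = X.comb e (\<lambda>a. x $ a + y $ a) n"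
      unfolding g_def using xy by (intro X.comb_cong) auto
    then show "g (x + y) = g x \<oplus>\<^bsub>X.M\<^esub> g y" unfolding g_def by (simp add: X.comb_add[OF ec])
  next
    show "g ` FS i \<subseteq> X.S i" if "i \<le> k" for i
      unfolding g_def using that by (auto simp: FS_def intro!: comb_S)
    fix i x assume i: "i \<in> {1..k}" and x: "x \<in> FS i"
    have "symb X i (g x) = vec (r i) (\<lambda>\<alpha>. if st i + \<alpha> < n then x $ (st i + \<alpha>) else 0)"
      unfolding g_def using x by (intro symb_comb[OF i]) (auto simp: FS_def)
    also have "\<dots> = proj i x" using n_offset[OF i] by (auto simp: proj_def)
    finally show "symb X i (g x) = symb (MF V) i x" using symb_MF[OF i x] by simp
  qed
  then show ?thesis using VX.filt_equiv_iff by blast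
qed

text \<open>The function \<open>w\<close> records where the windows start: \<open>w = (\<lambda>_. 0)\<close> for \<^const>\<open>K_low\<close> and
  \<open>w = \<mu>\<close> for \<^const>\<open>K_window\<close>.\<close>

lemma block_params_flat:
  assumes KK: "\<And>i j. KK (\<mu> i) (\<mu> j) = window (w i) (\<mu> j - \<mu> i)"
    and U: "U \<in> block_params KK k r \<mu>" and ab: "a < n" "b < n" "bi a < bi b"
  shows "flat U a b \<in> window (w (bi a)) (\<mu> (bi b) - \<mu> (bi a))"
proof -
  have "(bi a, bi b) \<in> {(i, j). 1 \<le> i \<and> i < j \<and> j \<le> k}"
    using ab block_index_bounds(1)[OF ab(1)] block_index_bounds(1)[OF ab(2)] by simp
  from PiE_mem[OF U[unfolded block_params_def] this]
  show ?thesis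
    using offset_less[OF ab(1)] offset_less[OF ab(2)] by (simp add: mat_over_def flat_def KK)
qed

lemma block_params_unflat:
  assumes KK: "\<And>i j. KK (\<mu> i) (\<mu> j) = window (w i) (\<mu> j - \<mu> i)"
    and U: "\<And>a b. a < n \<Longrightarrow> b < n \<Longrightarrow> bi a < bi b \<Longrightarrow> U a b \<in> window (w (bi a)) (\<mu> (bi b) - \<mu> (bi a))"
  shows "unflat U \<in> block_params KK k r \<mu>"
  unfolding block_params_def
proof (rule PiE_I)
  fix p assume p: "p \<in> {(i, j). 1 \<le> i \<and> i < j \<and> j \<le> k}"
  then obtain i j where ij: "p = (i, j)" "i \<in> {1..k}" "j \<in> {1..k}" "i < j" by auto
  show "unflat U p \<in> (case p of (i, j) \<Rightarrow> mat_over (KK (\<mu> i) (\<mu> j)) (r i) (r j))"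
  proof -
    have "U (st i + \<alpha>) (st j + \<beta>) \<in> window (w i) (\<mu> j - \<mu> i)" if "\<alpha> < r i" "\<beta> < r j" for \<alpha> \<beta>
      using U[of "st i + \<alpha>" "st j + \<beta>"] ij that by simp
    then show ?thesis using p ij(1) by (simp add: mat_over_def unflat_def KK)
  qed
next
  fix p assume "p \<notin> {(i, j). 1 \<le> i \<and> i < j \<and> j \<le> k}"
  then show "unflat U p = undefined" by (auto simp: unflat_def)
qed

lemma block_params_eqI:
  assumes U: "U \<in> block_params KK k r \<mu>" "U' \<in> block_params KK k r \<mu>"
    and eq: "\<And>a b. a < n \<Longrightarrow> b < n \<Longrightarrow> bi a < bi b \<Longrightarrow> flat U a b = flat U' a b"
  shows "U = U'"
proof (rule PiE_ext[OF U[unfolded block_params_def]])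
  fix p assume p: "p \<in> {(i, j). 1 \<le> i \<and> i < j \<and> j \<le> k}"
  then obtain i j where ij: "p = (i, j)" "i \<in> {1..k}" "j \<in> {1..k}" "i < j" by auto
  have c: "U p \<in> carrier_mat (r i) (r j)" "U' p \<in> carrier_mat (r i) (r j)"
    using PiE_mem[OF U(1)[unfolded block_params_def] p] PiE_mem[OF U(2)[unfolded block_params_def] p]
    by (simp_all add: ij(1) mat_over_def)
  show "U p = U' p"
  proof (rule eq_matI)
    fix \<alpha> \<beta> assume "\<alpha> < dim_row (U' p)" "\<beta> < dim_col (U' p)"
    then have ab: "\<alpha> < r i" "\<beta> < r j" using c by auto
    then show "U p $$ (\<alpha>, \<beta>) = U' p $$ (\<alpha>, \<beta>)"
      using eq[of "st i + \<alpha>" "st j + \<beta>"] ij by (simp add: flat_def)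
  qed (use c in auto)
qed

text \<open>With an arbitrary carrier type for \<open>X\<close>, this yields both the bijection on
  classes and the final claim. For uniqueness, two normal forms of \<open>X\<close> are first made
  equivalent to each other through \<open>X\<close>, and only then compared as matrices.\<close>

lemma unique_normal_form:
  fixes X :: "('e, conv_laurent vec) filt_qdiff"
  assumes KK: "\<And>i j. KK (\<mu> i) (\<mu> j) = window (w i) (\<mu> j - \<mu> i)" and X: "filtered q k PP X"
  shows "\<exists>!U. U \<in> block_params KK k r \<mu> \<and> filt_equiv k X (MF U)"
proof (rule ex_ex1I)
  obtain V where V: "filt_equiv k (MF V) X" using exists_matrix_form[OF X] by blast
  obtain F U where U: "\<And>a b. a < n \<Longrightarrow> b < n \<Longrightarrow> bi a < bi b \<Longrightarrow> U a b \<in> window (w (bi a)) (\<mu> (bi b) - \<mu> (bi a))"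
    and FU: "\<And>a b. a < n \<Longrightarrow> b < n \<Longrightarrow> (\<Sum>c<n. sigma_q q (tri unit_entry F a c) * tri D (flat V) c b) =
        (\<Sum>c<n. tri D U a c * tri unit_entry F c b)"
    using normal_form_exists[of w "flat V"] by blast
  have "filt_equiv k (MF V) (MF (unflat U))"
    by (rule gauge_equiv[of F]) (simp add: FU tri_unflat)
  then have "filt_equiv k X (MF (unflat U))"
    using filt_equiv_trans[OF X filtered_MF filtered_MF filt_equiv_sym[OF filtered_MF X V]] by blast
  then show "\<exists>U. U \<in> block_params KK k r \<mu> \<and> filt_equiv k X (MF U)"
    using block_params_unflat[where KK = KK, OF KK U] by blast
next
  fix U U' assume U: "U \<in> block_params KK k r \<mu> \<and> filt_equiv k X (MF U)"
    and U': "U' \<in> block_params KK k r \<mu> \<and> filt_equiv k X (MF U')"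
  have "filt_equiv k (MF U) (MF U')"
    using filt_equiv_trans[OF filtered_MF X filtered_MF] filt_equiv_sym[OF X filtered_MF] U U' by blast
  then obtain F where F: "\<And>a b. a < n \<Longrightarrow> b < n \<Longrightarrow>
      (\<Sum>c<n. sigma_q q (tri unit_entry F a c) * tri D (flat U) c b) = (\<Sum>c<n. tri D (flat U') a c * tri unit_entry F c b)"
    using equiv_gauge by blast
  have "flat U a b = flat U' a b" if "a < n" "b < n" "bi a < bi b" for a b
    using U U' that F by (intro normal_form_unique[of "flat U" w "flat U'" F] block_params_flat[where KK = KK, OF KK]) auto
  then show "U = U'" using U U' by (intro block_params_eqI) auto
qed

end

text \<open>The second conjunct justifies forming the classes from modules on sets of column
  vectors: filtered modules on any other carrier type have the same normal forms.\<close>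

theorem proposition3p3p4:
  fixes q :: complex and k :: nat and r :: "nat \<Rightarrow> nat" and \<mu> :: "nat \<Rightarrow> int"
    and A :: "nat \<Rightarrow> complex mat" and KK :: "int \<Rightarrow> int \<Rightarrow> conv_laurent set"
  assumes "norm q > 1"
    and "strict_mono_on {1..k} \<mu>"
    and "\<And>i. i \<in> {1..k} \<Longrightarrow> r i \<ge> 1"
    and "\<And>i. i \<in> {1..k} \<Longrightarrow> A i \<in> GL (r i)"
    and "KK = K_low \<or> KK = K_window"
  shows "bij_betw (\<lambda>U. filt_rel q k (pure_piece q r \<mu> A) `` {M_filt q k r \<mu> A U})
           (block_params KK k r \<mu>) (filt_classes q k (pure_piece q r \<mu> A)) \<and>
         (\<forall>X :: ('e, conv_laurent vec) filt_qdiff. filtered q k (pure_piece q r \<mu> A) X \<longrightarrow>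
           (\<exists>!U. U \<in> block_params KK k r \<mu> \<and> filt_equiv k X (M_filt q k r \<mu> A U)))"
proof -
  interpret slope_data q k r \<mu> A
    by (rule slope_data.intro) (fact assms(1,2,4))+
  define w where "w = (if KK = K_low then \<lambda>_. 0 else \<mu>)"
  have KK: "KK (\<mu> i) (\<mu> j) = window (w i) (\<mu> j - \<mu> i)" for i j
    using assms(5) by (auto simp: w_def K_low_eq_window K_window_eq_window)
  have unique: "\<exists>!U. U \<in> block_params KK k r \<mu> \<and> filt_equiv k X (MF U)"
    if "filtered q k PP X" for X :: "('x, conv_laurent vec) filt_qdiff"
    by (rule unique_normal_form[where KK = KK, OF KK that])
  have "bij_betw (\<lambda>U. filt_rel q k PP `` {MF U}) (block_params KK k r \<mu>) (filt_classes q k PP)"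
    unfolding bij_betw_def
  proof (intro conjI equalityI subsetI inj_onI)
    fix U U' assume U: "U \<in> block_params KK k r \<mu>" "U' \<in> block_params KK k r \<mu>"
      and "filt_rel q k PP `` {MF U} = filt_rel q k PP `` {MF U'}"
    then have "(MF U, MF U') \<in> filt_rel q k PP"
      using eq_equiv_class[OF _ equiv_filt_rel] filtered_MF by blast
    then have "filt_equiv k (MF U) (MF U')" by (simp add: filt_rel_def)
    \<comment> \<open>Both parameters are normal forms of the module \<open>MF U\<close>
      itself.\<close>
    then show "U = U'"
      using unique[OF filtered_MF, of U] U filt_equiv_refl[OF filtered_MF] by blast
  next
    fix C assume "C \<in> (\<lambda>U. filt_rel q k PP `` {MF U}) ` block_params KK k r \<mu>"
    then show "C \<in> filt_classes q k PP"
      unfolding filt_classes_def using filtered_MF by (auto intro: quotientI)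
  next
    fix C assume "C \<in> filt_classes q k PP"
    then obtain X where X: "filtered q k PP X" and C: "C = filt_rel q k PP `` {X}"
      unfolding filt_classes_def by (auto elim: quotientE)
    obtain U where U: "U \<in> block_params KK k r \<mu>" "filt_equiv k X (MF U)"
      using unique[OF X] by blast
    then have "(X, MF U) \<in> filt_rel q k PP" using X filtered_MF by (simp add: filt_rel_def)
    then have "C = filt_rel q k PP `` {MF U}"
      unfolding C by (rule equiv_class_eq[OF equiv_filt_rel])
    then show "C \<in> (\<lambda>U. filt_rel q k PP `` {MF U}) ` block_params KK k r \<mu>" using U by blast
  qed
  then show ?thesis
    using unique_normal_form[where KK = KK, OF KK] by blast
qed

end
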